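(* Suppose $\lambda<1$ and let $\{\Phi_t\}_{t\ge0}$ be the bimodule quantum Markov semigroup for $\mathcal N\subset\mathcal M$ with $$\widehat{\mathcal L}_0=\frac{1}{\lambda^{-1/2}-\lambda^{1/2}}\,(1-e_2),\qquad \mathcal L_w=0,$$ that is, $\mathcal L=(1-\lambda)^{-1}(\mathrm{Id}-\mathbb E_{\mathcal N})$. Then $$\widehat\Gamma_2\ \ge\ \Big(\frac12+\lambda\Big)\frac{1}{1-\lambda}\,\widehat\Gamma ,$$ and the coefficient is optimal, i.e. $\left(\frac12+\lambda\right)\frac1{1-\lambda}$ is the largest $\beta\in\mathbb R$ with $\widehat\Gamma_2\ge\beta\widehat\Gamma$.
   Context: Setting. $\mathcal N\subset\mathcal M$ is a unital finite inclusion of finite von Neumann algebras, $\tau$ a normal faithful tracial state on $\mathcal M$, $L^2(\mathcal M,\tau)$ its GNS space with conjugation $J$, $e_1$ the projection of $L^2(\mathcal M,\tau)$ onto $L^2(\mathcal N)$ and $\mathcal M_1=\langle\mathcal M,e_1\rangle$. There are $\lambda>0$ and a faithful normal tracial state $\tau_1$ on $\mathcal M_1$ extending $\tau$ with $\mathbb E_{\mathcal M}(e_1)=\lambda$ (a $\lambda$-extension), extremal in the sense $\tau_1(x)=\tau_1(Jx^*J)$ for $x\in\mathcal N'\cap\mathcal M$, and this iterates to a Jones tower $\mathcal N\subset\mathcal M\subset\mathcal M_1\subset\mathcal M_2\subset\cdots$, $\mathcal M_k=\langle\mathcal M_{k-1},e_k\rangle$, with compatible traces $\tau_k$ and $\mathbb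 E_{\mathcal M_{k-1}}(e_k)=\lambda$. $\mathbb E_{\mathcal A}$ denotes the trace-preserving conditional expectation onto $\mathcal A$. For $a\in\mathcal M'\cap\mathcal M_2$, $x\in\mathcal M$ put $x*a=\lambda^{-5/2}\mathbb E_{\mathcal M}(e_2e_1a\,x\,e_1e_2)$. Every $\mathcal N$-bimodule map $\Phi:\mathcal M\to\mathcal M$ (considered here: bounded normal) has a unique Fourier multiplier $\widehat\Phi\in\mathcal M'\cap\mathcal M_2$ with $\Phi(x)=x*\widehat\Phi$. A bimodule quantum Markov semigroup is a continuous semigroup $\Phi_t=e^{-t\mathcal L}$ of normal unital completely positive $\mathcal N$-bimodule maps; $\widehat{\mathcal L}$ is the multiplier of $\mathcal L$, $\widehat{\mathcal L}_0=-(1-e_2)\widehat{\mathcal L}(1-e_2)\ge0$, $\mathcal L_a(x)=\frac12(1*\widehat{\mathcal L}_0)x+\frac12x(1*\widehat{\mathcal L}_0)-x*\widehat{\mathcal L}_0$ and $\mathcal L_w=\mathcal L-\mathcal L_a$. Gradient forms: $\Gamma(x,y)=\frac12\big(x^*\mathcal L(y)+\mathcal L(x)^*y-\mathcal L(x^*y)\big)$ and $\Gamma_2(x,y)=\frac12\big(\Gamma(x,\mathcal L(y))+\Gamma(\mathcal L(x),y)-\mathcal L(\Gamma(x,y))\big)$. Put $\widetilde e_1=\lambda^{-1}e_2e_1e_3e_2$ and $\widetilde e_2=\lambda^{-1}e_4e_3e_5e_4$. $\widehat\Gamma$ (resp. $\widehat\Gamma_2$) is the unique element of $\mathcal M_1'\cap\mathcal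 M_4$ such that $\Gamma(x,y)=\lambda^{-11/2}\mathbb E_{\mathcal M}(\widetilde e_2\widetilde e_1\,x^*e_1y\,\widehat\Gamma\,\widetilde e_1\widetilde e_2)$ (resp. with $\Gamma_2,\widehat\Gamma_2$) for all $x,y\in\mathcal M$. *)

theory Defs
  imports "HOL-Analysis.Analysis"
begin

section \<open>Complex Hilbert spaces and bounded operators\<close>

text \<open>A complex Hilbert space is a real one whose real inner product is the real part of a
  complex inner product (conjugate linear in the first variable).\<close>

class complex_hilbert = real_inner + complete_space +
  fixes scaleC :: "complex \<Rightarrow> 'a \<Rightarrow> 'a"  (infixr \<open>*\<^sub>C\<close> 75)
    and cinner :: "'a \<Rightarrow> 'a \<Rightarrow> complex"
  assumes scaleC_add_right: "c *\<^sub>C (x + y) = c *\<^sub>C x + c *\<^sub>C y"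
    and scaleC_add_left: "(c + d) *\<^sub>C x = c *\<^sub>C x + d *\<^sub>C x"
    and scaleC_scaleC: "c *\<^sub>C d *\<^sub>C x = (c * d) *\<^sub>C x"
    and scaleR_scaleC: "r *\<^sub>R x = complex_of_real r *\<^sub>C x"
    and cinner_commute: "cinner x y = cnj (cinner y x)"
    and cinner_add_right: "cinner x (y + z) = cinner x y + cinner x z"
    and cinner_scaleC_right: "cinner x (c *\<^sub>C y) = c * cinner x y"
    and inner_cinner: "x \<bullet> y = Re (cinner x y)"

text \<open>Elements of \<^typ>\<open>'h \<Rightarrow>\<^sub>L 'h\<close> are only real linear; the algebra of all bounded operators is
  cut out by complex linearity in \<open>bounded_ops\<close> below.\<close>

type_synonym 'h op = "'h \<Rightarrow>\<^sub>L 'h"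

abbreviation op_id :: "'h::complex_hilbert op"  (\<open>\<one>\<close>)
  where "\<one> \<equiv> id_blinfun"

abbreviation op_times :: "'h::complex_hilbert op \<Rightarrow> 'h op \<Rightarrow> 'h op"  (infixl \<open>\<cdot>\<close> 70)
  where "S \<cdot> T \<equiv> S o\<^sub>L T"

definition op_scaleC :: "complex \<Rightarrow> 'h::complex_hilbert op \<Rightarrow> 'h op"
  where "op_scaleC c T = Blinfun (\<lambda>\<xi>. c *\<^sub>C T \<xi>)"

definition op_adj :: "'h::complex_hilbert op \<Rightarrow> 'h op"  (\<open>(_\<^sup>\<dagger>)\<close> [1000] 999)
  where "T\<^sup>\<dagger> = (THE S :: 'h op. \<forall>\<xi> \<eta>. cinner (T \<xi>) \<eta> = cinner \<xi> (S \<eta>))"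

definition op_pos :: "'h::complex_hilbert op \<Rightarrow> bool"
  where "op_pos T \<longleftrightarrow> (\<forall>\<xi>. cinner \<xi> (T \<xi>) \<in> \<real>\<^sub>\<ge>\<^sub>0)"

definition op_le :: "'h::complex_hilbert op \<Rightarrow> 'h op \<Rightarrow> bool"  (infix \<open>\<preceq>\<close> 50)
  where "S \<preceq> T \<longleftrightarrow> op_pos (T - S)"

definition closed_csubspace :: "'h::complex_hilbert set \<Rightarrow> bool"
  where "closed_csubspace K \<longleftrightarrow> closed K \<and> 0 \<in> K \<and>
    (\<forall>\<xi>\<in>K. \<forall>\<eta>\<in>K. \<xi> + \<eta> \<in> K) \<and> (\<forall>c. \<forall>\<xi>\<in>K. c *\<^sub>C \<xi> \<in> K)"

text \<open>Orthogonal projection onto a closed complex subspace.\<close>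

definition op_proj :: "'h::complex_hilbert set \<Rightarrow> 'h op"
  where "op_proj K = (THE P :: 'h op. \<forall>\<xi>. P \<xi> \<in> K \<and> (\<forall>\<eta>\<in>K. cinner \<eta> (\<xi> - P \<xi>) = 0))"


section \<open>Von Neumann algebras\<close>

text \<open>Hilbert spaces are closed complex subspaces \<open>K\<close> of one space \<^typ>\<open>'h\<close>; a bounded operator on
  \<open>K\<close> is extended by zero to the orthogonal complement, so that the unit of \<open>bounded_ops K\<close>
  is \<open>op_proj K\<close>.\<close>

definition bounded_ops :: "'h::complex_hilbert set \<Rightarrow> 'h op set"
  where "bounded_ops K = {T. (\<forall>c \<xi>. blinfun_apply T (c *\<^sub>C \<xi>) = c *\<^sub>C blinfun_apply T \<xi>) \<and>
    op_proj K \<cdot> T = T \<and> T \<cdot> op_proj K = T}"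

definition commutant_on :: "'h::complex_hilbert set \<Rightarrow> 'h op set \<Rightarrow> 'h op set"
  where "commutant_on K S = {T \<in> bounded_ops K. \<forall>s\<in>S. T \<cdot> s = s \<cdot> T}"

abbreviation commutant :: "'h::complex_hilbert op set \<Rightarrow> 'h op set"
  where "commutant S \<equiv> commutant_on UNIV S"

text \<open>The von Neumann algebra on \<open>K\<close> generated by a self-adjoint set \<open>S\<close> is its double commutant.\<close>

definition vn_generated :: "'h::complex_hilbert set \<Rightarrow> 'h op set \<Rightarrow> 'h op set"
  where "vn_generated K S = commutant_on K (commutant_on K S)"

definition von_neumann_algebra :: "'h::complex_hilbert op set \<Rightarrow> bool"
  where "von_neumann_algebra A \<longleftrightarrow>
    A \<subseteq> bounded_ops UNIV \<and> (\<forall>x\<in>A. x\<^sup>\<dagger> \<in> A) \<and> commutant (commutant A) = A"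

definition finite_von_neumann_algebra :: "'h::complex_hilbert op set \<Rightarrow> bool"
  where "finite_von_neumann_algebra A \<longleftrightarrow>
    von_neumann_algebra A \<and> (\<forall>v\<in>A. v\<^sup>\<dagger> \<cdot> v = \<one> \<longrightarrow> v \<cdot> v\<^sup>\<dagger> = \<one>)"

text \<open>Normal means continuous for the ultraweak topology.  The ultraweakly continuous functionals
  are \<open>x \<mapsto> \<Sum>n. \<langle>\<xi>\<^sub>n, x \<eta>\<^sub>n\<rangle>\<close> with square summable \<open>\<xi>\<close> and \<open>\<eta>\<close>, and a linear
  map is ultraweakly continuous iff it pulls these back to functionals of the same kind.\<close>

definition normal_functional :: "'h::complex_hilbert op set \<Rightarrow> ('h op \<Rightarrow> complex) \<Rightarrow> bool"
  where "normal_functional A \<phi> \<longleftrightarrow> (\<exists>\<xi> \<eta> :: nat \<Rightarrow> 'h.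
    summable (\<lambda>n. (norm (\<xi> n))\<^sup>2) \<and> summable (\<lambda>n. (norm (\<eta> n))\<^sup>2) \<and>
    (\<forall>x\<in>A. (\<lambda>n. cinner (\<xi> n) (blinfun_apply x (\<eta> n))) sums \<phi> x))"

definition normal_map ::
    "'h::complex_hilbert op set \<Rightarrow> 'h op set \<Rightarrow> ('h op \<Rightarrow> 'h op) \<Rightarrow> bool"
  where "normal_map A B \<Phi> \<longleftrightarrow>
    (\<forall>\<phi>. normal_functional B \<phi> \<longrightarrow> normal_functional A (\<lambda>x. \<phi> (\<Phi> x)))"

definition linear_map_on :: "'h::complex_hilbert op set \<Rightarrow> ('h op \<Rightarrow> 'h op) \<Rightarrow> bool"
  where "linear_map_on A \<Phi> \<longleftrightarrow> (\<forall>x\<in>A. \<forall>y\<in>A. \<Phi> (x + y) = \<Phi> x + \<Phi> y) \<and>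
    (\<forall>c. \<forall>x\<in>A. \<Phi> (op_scaleC c x) = op_scaleC c (\<Phi> x))"

definition vn_isomorphism ::
    "'h::complex_hilbert op set \<Rightarrow> 'h op set \<Rightarrow> ('h op \<Rightarrow> 'h op) \<Rightarrow> bool"
  where "vn_isomorphism A B \<pi> \<longleftrightarrow> bij_betw \<pi> A B \<and> linear_map_on A \<pi> \<and>
    (\<forall>x\<in>A. \<forall>y\<in>A. \<pi> (x \<cdot> y) = \<pi> x \<cdot> \<pi> y) \<and> (\<forall>x\<in>A. \<pi> (x\<^sup>\<dagger>) = (\<pi> x)\<^sup>\<dagger>) \<and>
    (\<forall>\<phi>. normal_functional B \<phi> \<longleftrightarrow> normal_functional A (\<lambda>x. \<phi> (\<pi> x)))"

definition faithful_normal_tracial_state ::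
    "'h::complex_hilbert op set \<Rightarrow> ('h op \<Rightarrow> complex) \<Rightarrow> bool"
  where "faithful_normal_tracial_state A \<tau> \<longleftrightarrow>
    (\<forall>x\<in>A. \<forall>y\<in>A. \<tau> (x + y) = \<tau> x + \<tau> y) \<and>
    (\<forall>c. \<forall>x\<in>A. \<tau> (op_scaleC c x) = c * \<tau> x) \<and>
    \<tau> \<one> = 1 \<and> (\<forall>x\<in>A. \<tau> (x\<^sup>\<dagger> \<cdot> x) \<in> \<real>\<^sub>\<ge>\<^sub>0) \<and>
    (\<forall>x\<in>A. \<tau> (x\<^sup>\<dagger> \<cdot> x) = 0 \<longrightarrow> x = 0) \<and>
    (\<forall>x\<in>A. \<forall>y\<in>A. \<tau> (x \<cdot> y) = \<tau> (y \<cdot> x)) \<and>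
    normal_functional A \<tau>"

definition bimodule_map ::
    "'h::complex_hilbert op set \<Rightarrow> 'h op set \<Rightarrow> ('h op \<Rightarrow> 'h op) \<Rightarrow> bool"
  where "bimodule_map N A \<Phi> \<longleftrightarrow>
    linear_map_on A \<Phi> \<and> (\<forall>a\<in>N. \<forall>b\<in>N. \<forall>x\<in>A. \<Phi> (a \<cdot> x \<cdot> b) = a \<cdot> \<Phi> x \<cdot> b)"

text \<open>The (unique) \<open>\<tau>\<close>-preserving conditional expectation of \<open>A\<close> onto \<open>N\<close>.\<close>

definition cond_expectation :: "('h::complex_hilbert op \<Rightarrow> complex) \<Rightarrow>
    'h op set \<Rightarrow> 'h op set \<Rightarrow> ('h op \<Rightarrow> 'h op) \<Rightarrow> bool"
  where "cond_expectation \<tau> A N E \<longleftrightarrow> bimodule_map N A E \<and> (\<forall>x\<in>A. E x \<in> N) \<and>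
    (\<forall>a\<in>N. E a = a) \<and> (\<forall>x\<in>A. op_pos x \<longrightarrow> op_pos (E x)) \<and> (\<forall>x\<in>A. \<tau> (E x) = \<tau> x)"


section \<open>Jones towers\<close>

text \<open>\<open>K\<close> with the map \<open>\<Lambda>\<close>, sending \<open>x\<close> to its class, is the GNS space \<open>L\<^sup>2(A, \<tau>)\<close>.\<close>

definition gns_space :: "'h::complex_hilbert op set \<Rightarrow> ('h op \<Rightarrow> complex) \<Rightarrow>
    'h set \<Rightarrow> ('h op \<Rightarrow> 'h) \<Rightarrow> bool"
  where "gns_space A \<tau> K \<Lambda> \<longleftrightarrow> closed_csubspace K \<and> closure (\<Lambda> ` A) = K \<and>
    (\<forall>x\<in>A. \<forall>y\<in>A. \<Lambda> (x + y) = \<Lambda> x + \<Lambda> y) \<and>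
    (\<forall>c. \<forall>x\<in>A. \<Lambda> (op_scaleC c x) = c *\<^sub>C \<Lambda> x) \<and>
    (\<forall>x\<in>A. \<forall>y\<in>A. cinner (\<Lambda> x) (\<Lambda> y) = \<tau> (x\<^sup>\<dagger> \<cdot> y))"

definition gns_conjugation :: "'h::complex_hilbert op set \<Rightarrow>
    'h set \<Rightarrow> ('h op \<Rightarrow> 'h) \<Rightarrow> ('h \<Rightarrow> 'h) \<Rightarrow> bool"
  where "gns_conjugation A K \<Lambda> J \<longleftrightarrow>
    (\<forall>\<xi>\<in>K. J \<xi> \<in> K \<and> norm (J \<xi>) = norm \<xi>) \<and>
    (\<forall>\<xi>\<in>K. \<forall>\<eta>\<in>K. J (\<xi> + \<eta>) = J \<xi> + J \<eta>) \<and> (\<forall>c. \<forall>\<xi>\<in>K. J (c *\<^sub>C \<xi>) = cnj c *\<^sub>C J \<xi>) \<and>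
    (\<forall>x\<in>A. J (\<Lambda> x) = \<Lambda> (x\<^sup>\<dagger>))"

text \<open>\<open>B\<close> is the basic construction \<open>\<langle>A, e\<rangle>\<close> of \<open>N \<subseteq> A\<close>.  All algebras of a tower act on the same
  space \<^typ>\<open>'h\<close>, whereas \<open>\<langle>A, e\<rangle>\<close> is by definition the von Neumann algebra on \<open>L\<^sup>2(A, \<tau>)\<close>
  generated by left multiplications and by the projection onto \<open>L\<^sup>2(N)\<close>; \<open>\<pi>\<close> is the
  identification of the two.\<close>

definition basic_construction :: "'h::complex_hilbert op set \<Rightarrow> 'h op set \<Rightarrow> ('h op \<Rightarrow> complex) \<Rightarrow>
    'h op \<Rightarrow> 'h op set \<Rightarrow> 'h set \<Rightarrow> ('h op \<Rightarrow> 'h) \<Rightarrow> ('h op \<Rightarrow> 'h op) \<Rightarrow> bool"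
  where "basic_construction N A \<tau> e B K \<Lambda> \<pi> \<longleftrightarrow> gns_space A \<tau> K \<Lambda> \<and> A \<subseteq> B \<and> e \<in> B \<and>
    (\<forall>x\<in>A. \<forall>y\<in>A. \<pi> x (\<Lambda> y) = \<Lambda> (x \<cdot> y)) \<and>
    \<pi> e = op_proj (closure (\<Lambda> ` N)) \<and>
    vn_isomorphism B (vn_generated K (\<pi> ` A \<union> {\<pi> e})) \<pi>"

text \<open>\<open>\<tau>\<^sub>1 x = \<tau>\<^sub>1 (J x\<^sup>* J)\<close> for \<open>x \<in> N' \<inter> A\<close>, where \<open>J x\<^sup>* J\<close> is an operator
  on \<open>K = L\<^sup>2(A, \<tau>)\<close> and \<open>y \<in> B\<close> is the element identified with it.\<close>

definition extremal_trace :: "'h::complex_hilbert op set \<Rightarrow> 'h op set \<Rightarrow> 'h op set \<Rightarrow>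
    ('h op \<Rightarrow> complex) \<Rightarrow> 'h set \<Rightarrow> ('h \<Rightarrow> 'h) \<Rightarrow> ('h op \<Rightarrow> 'h op) \<Rightarrow> bool"
  where "extremal_trace N A B \<tau>\<^sub>1 K J \<pi> \<longleftrightarrow> (\<forall>x \<in> commutant N \<inter> A. \<exists>y\<in>B.
    (\<forall>\<xi>\<in>K. \<pi> y \<xi> = J (\<pi> (x\<^sup>\<dagger>) (J \<xi>))) \<and> \<tau>\<^sub>1 x = \<tau>\<^sub>1 y)"

text \<open>\<open>subalg T = N\<close>, \<open>alg T k = M\<^sub>k\<close> with \<open>M\<^sub>0 = M\<close>, \<open>trc T k\<close> is the trace of \<open>M\<^sub>k\<close>,
  \<open>jp T k\<close> the Jones projection in \<open>M\<^sub>k\<close> for \<open>k \<ge> 1\<close>, \<open>EN T\<close> the expectation of \<open>M\<close> onto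
  \<open>N\<close>, and \<open>EM T k\<close> the expectation onto \<open>M\<^sub>k\<close>, defined on every larger \<open>M\<^sub>j\<close>.\<close>

record (overloaded) ('h::complex_hilbert) tower =
  subalg :: "'h op set"
  alg :: "nat \<Rightarrow> 'h op set"
  trc :: "nat \<Rightarrow> 'h op \<Rightarrow> complex"
  jp :: "nat \<Rightarrow> 'h op"
  EN :: "'h op \<Rightarrow> 'h op"
  EM :: "nat \<Rightarrow> 'h op \<Rightarrow> 'h op"
  lam :: real

definition jones_tower :: "'h::complex_hilbert tower \<Rightarrow> bool"
  where "jones_tower T \<longleftrightarrow>
    lam T > 0 \<and>
    finite_von_neumann_algebra (subalg T) \<and> (\<forall>k. finite_von_neumann_algebra (alg T k)) \<and>
    subalg T \<subseteq> alg T 0 \<and> (\<forall>k. alg T k \<subseteq> alg T (Suc k)) \<and>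
    (\<forall>k. faithful_normal_tracial_state (alg T k) (trc T k)) \<and>
    (\<forall>k. \<forall>x\<in>alg T k. trc T (Suc k) x = trc T k x) \<and>
    cond_expectation (trc T 0) (alg T 0) (subalg T) (EN T) \<and>
    (\<forall>k j. k \<le> j \<longrightarrow> cond_expectation (trc T j) (alg T j) (alg T k) (EM T k)) \<and>
    (\<exists>K \<Lambda> J \<pi>. basic_construction (subalg T) (alg T 0) (trc T 0) (jp T 1) (alg T 1) K \<Lambda> \<pi> \<and>
       gns_conjugation (alg T 0) K \<Lambda> J \<and>
       extremal_trace (subalg T) (alg T 0) (alg T 1) (trc T 1) K J \<pi>) \<and>
    (\<forall>k. \<exists>K \<Lambda> \<pi>. basic_construction
       (alg T k) (alg T (Suc k)) (trc T (Suc k)) (jp T (k + 2)) (alg T (k + 2)) K \<Lambda> \<pi>) \<and>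
    (\<forall>k. EM T k (jp T (Suc k)) = lam T *\<^sub>R \<one>)"


section \<open>Fourier multipliers and quantum Markov semigroups\<close>

definition conv :: "'h::complex_hilbert tower \<Rightarrow> 'h op \<Rightarrow> 'h op \<Rightarrow> 'h op"
  where "conv T x a =
    lam T powr (-5/2) *\<^sub>R EM T 0 (jp T 2 \<cdot> jp T 1 \<cdot> a \<cdot> x \<cdot> jp T 1 \<cdot> jp T 2)"

definition multiplier :: "'h::complex_hilbert tower \<Rightarrow> ('h op \<Rightarrow> 'h op) \<Rightarrow> 'h op"
  where "multiplier T \<Phi> = (THE a. a \<in> commutant (alg T 0) \<inter> alg T 2 \<and>
    (\<forall>x\<in>alg T 0. \<Phi> x = conv T x a))"

text \<open>Positivity of the \<open>n \<times> n\<close> operator matrix \<open>X\<close> acting on the \<open>n\<close>-fold direct sum.\<close>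

definition matrix_pos :: "nat \<Rightarrow> (nat \<Rightarrow> nat \<Rightarrow> 'h::complex_hilbert op) \<Rightarrow> bool"
  where "matrix_pos n X \<longleftrightarrow>
    (\<forall>\<xi> :: nat \<Rightarrow> 'h. (\<Sum>i<n. \<Sum>j<n. cinner (\<xi> i) (X i j (\<xi> j))) \<in> \<real>\<^sub>\<ge>\<^sub>0)"

definition completely_positive :: "'h::complex_hilbert op set \<Rightarrow> ('h op \<Rightarrow> 'h op) \<Rightarrow> bool"
  where "completely_positive A \<Phi> \<longleftrightarrow> (\<forall>n X. (\<forall>i<n. \<forall>j<n. X i j \<in> A) \<longrightarrow>
    matrix_pos n X \<longrightarrow> matrix_pos n (\<lambda>i j. \<Phi> (X i j)))"

definition normal_bimodule_map ::
    "'h::complex_hilbert op set \<Rightarrow> 'h op set \<Rightarrow> ('h op \<Rightarrow> 'h op) \<Rightarrow> bool"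
  where "normal_bimodule_map N A \<Phi> \<longleftrightarrow> (\<forall>x\<in>A. \<Phi> x \<in> A) \<and> bimodule_map N A \<Phi> \<and>
    (\<exists>C. \<forall>x\<in>A. norm (\<Phi> x) \<le> C * norm x) \<and> normal_map A A \<Phi>"

definition bimodule_qms :: "'h::complex_hilbert op set \<Rightarrow> 'h op set \<Rightarrow>
    (real \<Rightarrow> 'h op \<Rightarrow> 'h op) \<Rightarrow> ('h op \<Rightarrow> 'h op) \<Rightarrow> bool"
  where "bimodule_qms N A \<Phi> L \<longleftrightarrow>
    (\<forall>t\<ge>0. normal_bimodule_map N A (\<Phi> t) \<and> completely_positive A (\<Phi> t) \<and> \<Phi> t \<one> = \<one>) \<and>
    (\<forall>x\<in>A. \<Phi> 0 x = x) \<and> (\<forall>s\<ge>0. \<forall>t\<ge>0. \<forall>x\<in>A. \<Phi> (s + t) x = \<Phi> s (\<Phi> t x)) \<and>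
    (\<forall>x\<in>A. continuous_on {0..} (\<lambda>t. \<Phi> t x)) \<and>
    normal_bimodule_map N A L \<and>
    (\<forall>t\<ge>0. \<forall>x\<in>A. (\<lambda>n. ((- t) ^ n / fact n) *\<^sub>R (L ^^ n) x) sums \<Phi> t x)"

definition Lhat0 :: "'h::complex_hilbert tower \<Rightarrow> ('h op \<Rightarrow> 'h op) \<Rightarrow> 'h op"
  where "Lhat0 T L = - ((\<one> - jp T 2) \<cdot> multiplier T L \<cdot> (\<one> - jp T 2))"

definition La :: "'h::complex_hilbert tower \<Rightarrow> ('h op \<Rightarrow> 'h op) \<Rightarrow> 'h op \<Rightarrow> 'h op"
  where "La T L x = (1/2) *\<^sub>R (conv T \<one> (Lhat0 T L) \<cdot> x) +
    (1/2) *\<^sub>R (x \<cdot> conv T \<one> (Lhat0 T L)) - conv T x (Lhat0 T L)"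

definition Lw :: "'h::complex_hilbert tower \<Rightarrow> ('h op \<Rightarrow> 'h op) \<Rightarrow> 'h op \<Rightarrow> 'h op"
  where "Lw T L x = L x - La T L x"


section \<open>Gradient forms\<close>

definition Gam :: "('h::complex_hilbert op \<Rightarrow> 'h op) \<Rightarrow> 'h op \<Rightarrow> 'h op \<Rightarrow> 'h op"
  where "Gam L x y = (1/2) *\<^sub>R (x\<^sup>\<dagger> \<cdot> L y + (L x)\<^sup>\<dagger> \<cdot> y - L (x\<^sup>\<dagger> \<cdot> y))"

definition Gam2 :: "('h::complex_hilbert op \<Rightarrow> 'h op) \<Rightarrow> 'h op \<Rightarrow> 'h op \<Rightarrow> 'h op"
  where "Gam2 L x y = (1/2) *\<^sub>R (Gam L x (L y) + Gam L (L x) y - L (Gam L x y))"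

definition et1 :: "'h::complex_hilbert tower \<Rightarrow> 'h op"
  where "et1 T = (1 / lam T) *\<^sub>R (jp T 2 \<cdot> jp T 1 \<cdot> jp T 3 \<cdot> jp T 2)"

definition et2 :: "'h::complex_hilbert tower \<Rightarrow> 'h op"
  where "et2 T = (1 / lam T) *\<^sub>R (jp T 4 \<cdot> jp T 3 \<cdot> jp T 5 \<cdot> jp T 4)"

text \<open>The multiplier in \<open>M\<^sub>1' \<inter> M\<^sub>4\<close> of a form \<open>G\<close> such as \<open>\<Gamma>\<close> or \<open>\<Gamma>\<^sub>2\<close>.\<close>

definition form_multiplier ::
    "'h::complex_hilbert tower \<Rightarrow> ('h op \<Rightarrow> 'h op \<Rightarrow> 'h op) \<Rightarrow> 'h op"
  where "form_multiplier T G = (THE g. g \<in> commutant (alg T 1) \<inter> alg T 4 \<and>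
    (\<forall>x\<in>alg T 0. \<forall>y\<in>alg T 0. G x y = lam T powr (-11/2) *\<^sub>R
       EM T 0 (et2 T \<cdot> et1 T \<cdot> x\<^sup>\<dagger> \<cdot> jp T 1 \<cdot> y \<cdot> g \<cdot> et1 T \<cdot> et2 T)))"

end

theory Submission
  imports Defs
begin

text \<open>Write \<open>E\<close> for the expectation of \<open>M\<close> onto \<open>N\<close> and \<open>c = 1 / (1 - \<lambda>)\<close>.

  The hypotheses on \<open>L\<close> give \<open>L = c (id - E)\<close> (\<open>L_eq\<close>), so that
  \<open>\<Gamma>(x, y) = (c/2) (x\<^sup>* y - x\<^sup>* E(y) - E(x\<^sup>*) y + E(x\<^sup>* y))\<close>.  This form vanishes when \<open>x\<close> or \<open>y\<close>
  lies in \<open>N\<close>, whence \<open>\<Gamma>\<^sub>2 = (c/2) (\<Gamma> + E \<circ> \<Gamma>)\<close> with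
  \<open>E(\<Gamma>(x, y)) = c (E(x\<^sup>* y) - E(x\<^sup>*) E(y))\<close>.

  The five elementary forms \<open>E(x\<^sup>* y)\<close>, \<open>E(x\<^sup>*) E(y)\<close>, \<open>x\<^sup>* y\<close>, \<open>E(x\<^sup>*) y\<close>, \<open>x\<^sup>* E(y)\<close> have the multipliers
  \<open>1\<close>, \<open>e\<^sub>3\<close> (times \<open>\<lambda>\<close> to the power \<open>1/2\<close>) and \<open>e\<^sub>4\<close>, \<open>e\<^sub>3 e\<^sub>4\<close>, \<open>e\<^sub>4 e\<^sub>3\<close> (times \<open>\<lambda>\<close> to the power
  \<open>-1/2\<close>), see \<open>represents_words\<close>.  In terms of \<open>Q = 1 - e\<^sub>3\<close> and \<open>P = Q e\<^sub>4 Q\<close> the multiplier of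
  \<open>\<Gamma>\<close> is a positive multiple of \<open>P + \<lambda> Q\<close>, and with \<open>\<beta> = (1/2 + \<lambda>) c\<close> the multiplier of
  \<open>\<Gamma>\<^sub>2 - \<beta> \<Gamma>\<close> is a positive multiple of \<open>Q - c P\<close>.  The Jones relations give
  \<open>P\<^sup>2 = (1 - \<lambda>) P\<close>, so \<open>c P\<close> is a projection below \<open>Q\<close> and \<open>Q - c P \<ge> 0\<close>.  On the range of \<open>P\<close>,
  which is nonzero because \<open>P\<close> has trace \<open>\<lambda> - \<lambda>\<^sup>2\<close>, this difference vanishes while the multiplier of
  \<open>\<Gamma>\<close> acts as a positive scalar; hence \<open>\<beta>\<close> is optimal.

  A multiplier is a definite description, so both existence and uniqueness have to be established.
  The value of the form with multiplier \<open>g\<close> is determined by its traces against \<open>z \<in> M\<close>, and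
  \<open>form_pairing\<close> writes these as traces of words in the Jones projections.  The words are
  evaluated by the Jones relations and the Markov property.  Uniqueness amounts to the totality of
  the words that occur.  It is usually deduced from weak density of the linear span of
  \<open>M\<^sub>k e\<^sub>k\<^sub>+\<^sub>1 M\<^sub>k\<close> in \<open>M\<^sub>k\<^sub>+\<^sub>1\<close>; here it rests on the push-down identity \<open>\<lambda> S = E(S) e\<^sub>k\<^sub>+\<^sub>1\<close> for
  \<open>S = S e\<^sub>k\<^sub>+\<^sub>1\<close> in \<open>M\<^sub>k\<^sub>+\<^sub>1\<close>, with \<open>E\<close> now the expectation onto \<open>M\<^sub>k\<close> (\<open>push_down\<close>),
  which follows algebraically from the next projection of the tower.  Its consequence
  \<open>tr_zero_extend\<close> is applied level by level in \<open>multiplier_unique\<close>.\<close>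


section \<open>Complex Hilbert spaces\<close>

lemma cinner_add_left: "cinner (x + y) z = cinner x z + cinner y z"
  by (metis cinner_add_right cinner_commute complex_cnj_add)

lemma cinner_scaleC_left: "cinner (c *\<^sub>C x) y = cnj c * cinner x y"
  by (metis cinner_scaleC_right cinner_commute complex_cnj_mult)

lemma cinner_scaleR_right: "cinner x (r *\<^sub>R y) = of_real r * cinner x y"
  by (simp add: scaleR_scaleC cinner_scaleC_right)

lemma cinner_scaleR_left: "cinner (r *\<^sub>R x) y = of_real r * cinner x y"
  by (simp add: scaleR_scaleC cinner_scaleC_left)

lemma cinner_zero_right [simp]: "cinner x 0 = 0"
  using cinner_scaleR_right[of x 0 0] by simp

lemma cinner_zero_left [simp]: "cinner 0 x = 0"
  using cinner_scaleR_left[of 0 0 x] by simp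

lemma cinner_minus_right: "cinner x (- y) = - cinner x y"
  using cinner_scaleR_right[of x "-1" y] by simp

lemma cinner_diff_right: "cinner x (y - z) = cinner x y - cinner x z"
  using cinner_add_right[of x y "- z"] by (simp add: cinner_minus_right)

lemma cinner_diff_left: "cinner (x - y) z = cinner x z - cinner y z"
  by (metis cinner_diff_right cinner_commute complex_cnj_diff)

lemma cinner_self: "cinner x x = of_real ((norm x)\<^sup>2)"
proof -
  have "Im (cinner x x) = 0"
    using arg_cong[OF cinner_commute[of x x], of Im] by simp
  moreover have "Re (cinner x x) = (norm x)\<^sup>2"
    by (simp add: inner_cinner[symmetric] power2_norm_eq_inner)
  ultimately show ?thesis by (simp add: complex_eq_iff)
qed

text \<open>The complex inner product is recovered from the real one, which transports orthogonality,
  continuity and Riesz representation from real to complex Hilbert spaces.\<close>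

lemma cinner_eq_inner: "cinner x y = Complex (x \<bullet> y) ((\<i> *\<^sub>C x) \<bullet> y)"
  by (simp add: complex_eq_iff inner_cinner cinner_scaleC_left)

lemma norm_scaleC: "norm (c *\<^sub>C x) = cmod c * norm x"
proof -
  have "complex_of_real ((norm (c *\<^sub>C x))\<^sup>2) = of_real ((cmod c * norm x)\<^sup>2)"
    unfolding cinner_self[symmetric] cinner_scaleC_left cinner_scaleC_right
    by (simp add: cinner_self power_mult_distrib complex_norm_square mult.assoc del: of_real_power)
  then have "(norm (c *\<^sub>C x))\<^sup>2 = (cmod c * norm x)\<^sup>2"
    using of_real_eq_iff by blast
  then show ?thesis by simp
qed

lemma scaleC_one [simp]: "1 *\<^sub>C x = x"
  using scaleR_scaleC[of 1 x] by simp

lemma bounded_linear_scaleC: "bounded_linear (\<lambda>x. c *\<^sub>C x)"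
  by (rule bounded_linear_intro[where K = "cmod c"])
    (simp_all add: scaleC_add_right scaleR_scaleC scaleC_scaleC norm_scaleC mult.commute)

lemma scaleC_zero [simp]: "c *\<^sub>C 0 = 0"
  using bounded_linear.linear[OF bounded_linear_scaleC] by (rule linear_0)

lemma continuous_on_cinner_left: "continuous_on S (\<lambda>x. cinner x y)"
proof -
  have "continuous_on S (\<lambda>x. Complex (x \<bullet> y) ((\<i> *\<^sub>C x) \<bullet> y))"
    unfolding Complex_eq
    by (intro continuous_intros bounded_linear.continuous_on[OF bounded_linear_scaleC])
  then show ?thesis by (simp add: cinner_eq_inner)
qed

lemma cinner_ext: "(\<And>y. cinner y x = cinner y z) \<Longrightarrow> x = z"
  by (metis cinner_diff_right cinner_self eq_iff_diff_eq_0 of_real_eq_0_iff power_eq_0_iff norm_eq_zero)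

text \<open>The minimal distance from \<open>x\<close> to \<open>S\<close> is attained, since by the parallelogram law every
  minimizing sequence is Cauchy; at the minimizer the remainder is orthogonal to \<open>S\<close>.\<close>

lemma ex_orthogonal_projection:
  fixes S :: "'a::{real_inner,complete_space} set"
  assumes "closed S" and S: "subspace S"
  shows "\<exists>p\<in>S. \<forall>y\<in>S. y \<bullet> (x - p) = 0"
proof -
  define f where "f p = (norm (x - p))\<^sup>2" for p
  define D where "D = Inf (f ` S)"
  have ne: "f ` S \<noteq> {}" using subspace_0[OF S] by auto
  have bdd: "bdd_below (f ` S)" by (rule bdd_belowI2[of _ 0]) (simp add: f_def)
  have D_le: "D \<le> f p" if "p \<in> S" for p
    unfolding D_def using that bdd by (simp add: cInf_lower)
  have "\<exists>p\<in>S. f p < D + 1 / (real n + 1)" for n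
    using cInf_lessD[OF ne, of "D + 1 / (real n + 1)"] by (auto simp: D_def)
  then obtain p where pS: "\<And>n. p n \<in> S" and p: "\<And>n. f (p n) < D + 1 / (real n + 1)"
    by metis
  have par: "(norm (p m - p n))\<^sup>2 \<le> 2 * (1 / (real m + 1)) + 2 * (1 / (real n + 1))" for m n
  proof -
    have "(1/2) *\<^sub>R (p m + p n) \<in> S"
      using pS S by (simp add: subspace_add subspace_mul)
    then have "D \<le> f ((1/2) *\<^sub>R (p m + p n))" by (rule D_le)
    moreover have "(norm (p m - p n))\<^sup>2 = 2 * f (p m) + 2 * f (p n) - 4 * f ((1/2) *\<^sub>R (p m + p n))"
      unfolding f_def power2_norm_eq_inner
      by (simp add: algebra_simps inner_commute)
    ultimately show ?thesis using p[of m] p[of n] by linarith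
  qed
  have "Cauchy p"
  proof (rule metric_CauchyI)
    fix e :: real assume "e > 0"
    then obtain N where N: "4 / e\<^sup>2 < real N" using reals_Archimedean2 by blast
    show "\<exists>M. \<forall>m\<ge>M. \<forall>n\<ge>M. dist (p m) (p n) < e"
    proof (intro exI allI impI)
      fix m n assume mn: "N \<le> m" "N \<le> n"
      have *: "1 / (real k + 1) < e\<^sup>2 / 4" if "N \<le> k" for k
      proof -
        have "4 / e\<^sup>2 < real k + 1" using N that by simp
        then show ?thesis using \<open>e > 0\<close> by (simp add: field_simps)
      qed
      have "(norm (p m - p n))\<^sup>2 < e\<^sup>2" using par[of m n] *[OF mn(1)] *[OF mn(2)] by linarith
      then show "dist (p m) (p n) < e"
        using \<open>e > 0\<close> by (simp add: dist_norm power_less_imp_less_base)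
    qed
  qed
  then obtain q where q: "p \<longlonglongrightarrow> q"
    using Cauchy_convergent convergent_def by blast
  have qS: "q \<in> S" using closed_sequentially[OF \<open>closed S\<close>] pS q by blast
  have "(\<lambda>n. f (p n)) \<longlonglongrightarrow> f q" unfolding f_def by (intro tendsto_intros q)
  moreover have "(\<lambda>n. D + 1 / (real n + 1)) \<longlonglongrightarrow> D + 0"
    using LIMSEQ_inverse_real_of_nat by (intro tendsto_intros) (simp add: inverse_eq_divide add.commute)
  ultimately have "f q \<le> D + 0"
    by (rule LIMSEQ_le) (use p in \<open>auto intro: less_imp_le\<close>)
  then have fq: "f q \<le> D" by simp
  have "y \<bullet> (x - q) = 0" if "y \<in> S" for y
  proof (cases "y = 0")
    case False
    define t where "t = (y \<bullet> (x - q)) / (y \<bullet> y)"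
    have yy: "y \<bullet> y > 0" using False by simp
    have "q + t *\<^sub>R y \<in> S" using qS that S by (simp add: subspace_add subspace_mul)
    then have "f q \<le> f (q + t *\<^sub>R y)" using D_le fq by (meson order_trans)
    moreover have "f (q + t *\<^sub>R y) = f q - 2 * t * (y \<bullet> (x - q)) + t * t * (y \<bullet> y)"
      unfolding f_def power2_norm_eq_inner by (simp add: algebra_simps inner_commute)
    moreover have "t * (y \<bullet> y) = y \<bullet> (x - q)" using yy by (simp add: t_def)
    ultimately have "t * (y \<bullet> (x - q)) \<le> 0"
      by (simp add: mult.assoc)
    then have "(y \<bullet> (x - q))\<^sup>2 \<le> 0"
      using yy by (simp add: t_def power2_eq_square divide_le_0_iff)
    then show ?thesis by simp
  qed simp
  with qS show ?thesis by blast
qed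

lemma closed_csubspace_subspace: "closed_csubspace K \<Longrightarrow> subspace K"
  by (auto simp: closed_csubspace_def subspace_def scaleR_scaleC)

lemma ex_cprojection:
  assumes "closed_csubspace K"
  shows "\<exists>p\<in>K. \<forall>\<eta>\<in>K. cinner \<eta> (\<xi> - p) = 0"
proof -
  obtain p where "p \<in> K" and p: "\<forall>\<eta>\<in>K. \<eta> \<bullet> (\<xi> - p) = 0"
    using ex_orthogonal_projection[OF _ closed_csubspace_subspace[OF assms], of \<xi>] assms
    by (auto simp: closed_csubspace_def)
  moreover have "cinner \<eta> (\<xi> - p) = 0" if "\<eta> \<in> K" for \<eta>
    using p that assms by (simp add: cinner_eq_inner closed_csubspace_def zero_complex.code)
  ultimately show ?thesis by blast
qed

lemma cprojection_unique:
  assumes "closed_csubspace K" "p \<in> K" "q \<in> K"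
    and "\<forall>\<eta>\<in>K. cinner \<eta> (\<xi> - p) = 0" "\<forall>\<eta>\<in>K. cinner \<eta> (\<xi> - q) = 0"
  shows "p = q"
proof -
  have "p - q \<in> K"
    using subspace_diff[OF closed_csubspace_subspace[OF assms(1)] assms(2,3)] .
  then have "cinner (p - q) ((\<xi> - q) - (\<xi> - p)) = 0"
    unfolding cinner_diff_right[of _ "\<xi> - q"] using assms by simp
  then show ?thesis by (simp add: cinner_self)
qed

lemma op_proj:
  assumes K: "closed_csubspace K"
  shows "op_proj K \<xi> \<in> K" and "\<eta> \<in> K \<Longrightarrow> cinner \<eta> (\<xi> - op_proj K \<xi>) = 0"
proof -
  obtain P where P: "\<And>\<xi>. P \<xi> \<in> K" "\<And>\<xi> \<eta>. \<eta> \<in> K \<Longrightarrow> cinner \<eta> (\<xi> - P \<xi>) = 0"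
    using ex_cprojection[OF K] by metis
  note sub = closed_csubspace_subspace[OF K]
  have P_eq: "P \<xi> = p" if "p \<in> K" "\<And>\<eta>. \<eta> \<in> K \<Longrightarrow> cinner \<eta> (\<xi> - p) = 0" for p \<xi>
    using cprojection_unique[OF K P(1) that(1)] P(2) that(2) by blast
  have "bounded_linear P"
  proof (rule bounded_linear_intro[where K = 1])
    show "P (x + y) = P x + P y" for x y
    proof (rule P_eq)
      show "cinner \<eta> (x + y - (P x + P y)) = 0" if "\<eta> \<in> K" for \<eta>
        using P(2)[OF that, of x] P(2)[OF that, of y]
        by (simp add: cinner_diff_right cinner_add_right)
    qed (simp add: P subspace_add[OF sub])
    show "P (r *\<^sub>R x) = r *\<^sub>R P x" for r x
    proof (rule P_eq)
      show "cinner \<eta> (r *\<^sub>R x - r *\<^sub>R P x) = 0" if "\<eta> \<in> K" for \<eta>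
        using P(2)[OF that, of x]
        by (simp add: cinner_diff_right cinner_scaleR_right)
    qed (simp add: P subspace_mul[OF sub])
    show "norm (P x) \<le> norm x * 1" for x
    proof -
      have "P x \<bullet> (x - P x) = 0" using P by (simp add: inner_cinner)
      then have "(norm x)\<^sup>2 = (norm (P x))\<^sup>2 + (norm (x - P x))\<^sup>2"
        unfolding power2_norm_eq_inner by (simp add: algebra_simps inner_commute)
      then show ?thesis
        by (metis mult.right_neutral le_add_same_cancel1 norm_ge_zero power2_le_imp_le zero_le_power2)
    qed
  qed
  then have "blinfun_apply (Blinfun P) = P" by (rule bounded_linear_Blinfun_apply)
  then have "\<exists>!P :: 'a op. \<forall>\<xi>. P \<xi> \<in> K \<and> (\<forall>\<eta>\<in>K. cinner \<eta> (\<xi> - P \<xi>) = 0)"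
    using P P_eq[symmetric]
    by (intro ex1I[of _ "Blinfun P"]) (auto intro!: blinfun_eqI)
  from theI'[OF this, folded op_proj_def]
  show "op_proj K \<xi> \<in> K" and "\<eta> \<in> K \<Longrightarrow> cinner \<eta> (\<xi> - op_proj K \<xi>) = 0" by blast+
qed

lemma op_proj_eqI:
  assumes "closed_csubspace K" "p \<in> K" "\<And>\<eta>. \<eta> \<in> K \<Longrightarrow> cinner \<eta> (\<xi> - p) = 0"
  shows "op_proj K \<xi> = p"
  using cprojection_unique[OF assms(1) op_proj(1)[OF assms(1)] assms(2)] op_proj(2)[OF assms(1)] assms(3)
  by blast

lemma op_proj_UNIV: "op_proj UNIV = (\<one> :: 'h::complex_hilbert op)"
  by (rule blinfun_eqI, rule op_proj_eqI) (auto simp: closed_csubspace_def)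

text \<open>Riesz representation: a functional that does not vanish is a multiple of the inner
  product with a vector orthogonal to its kernel.\<close>

lemma riesz_representation:
  fixes f :: "'a::{real_inner,complete_space} \<Rightarrow> real"
  assumes "bounded_linear f"
  shows "\<exists>z. \<forall>x. f x = x \<bullet> z"
proof (cases "\<forall>x. f x = 0")
  case True
  then show ?thesis by (intro exI[of _ 0]) simp
next
  case False
  interpret bounded_linear f by fact
  obtain x0 where x0: "f x0 \<noteq> 0" using False by blast
  let ?S = "{x. f x = 0}"
  have "closed ?S" by (intro closed_Collect_eq continuous_intros continuous_on)
  moreover have "subspace ?S" by (simp add: subspace_def add scale)
  ultimately obtain p where p: "f p = 0" and orth: "\<And>y. f y = 0 \<Longrightarrow> y \<bullet> (x0 - p) = 0"
    using ex_orthogonal_projection[of ?S x0] by auto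
  define u where "u = x0 - p"
  have fu: "f u \<noteq> 0" using x0 p by (simp add: u_def diff)
  then have uu: "u \<bullet> u \<noteq> 0" by auto
  have "f x = x \<bullet> ((f u / (u \<bullet> u)) *\<^sub>R u)" for x
  proof -
    have "f (x - (f x / f u) *\<^sub>R u) = 0" using fu by (simp add: diff scale)
    then have "x \<bullet> u = (f x / f u) * (u \<bullet> u)"
      using orth[folded u_def, of "x - (f x / f u) *\<^sub>R u"] by (simp add: inner_diff_left)
    then show ?thesis using fu uu by simp
  qed
  then show ?thesis by blast
qed

section \<open>Adjoints of bounded operators\<close>

text \<open>The type of bounded operators contains all real linear ones; only the complex linear ones
  have an adjoint with respect to the complex inner product.\<close>

definition clinear_op :: "'h::complex_hilbert op \<Rightarrow> bool"
  where "clinear_op T \<longleftrightarrow> (\<forall>c \<xi>. T (c *\<^sub>C \<xi>) = c *\<^sub>C T \<xi>)"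

lemma op_adj_eqI:
  fixes S T :: "'h::complex_hilbert op"
  assumes "\<And>\<xi> \<eta>. cinner (T \<xi>) \<eta> = cinner \<xi> (S \<eta>)"
  shows "T\<^sup>\<dagger> = S"
  unfolding op_adj_def
proof (rule the_equality)
  show "R = S" if "\<forall>\<xi> \<eta>. cinner (T \<xi>) \<eta> = cinner \<xi> (R \<eta>)" for R :: "'h op"
    by (rule blinfun_eqI, rule cinner_ext) (metis that assms)
qed (simp add: assms)

lemma op_adj:
  fixes T :: "'h::complex_hilbert op"
  assumes T: "clinear_op T"
  shows "cinner (T \<xi>) \<eta> = cinner \<xi> ((T\<^sup>\<dagger>) \<eta>)"
proof -
  have "\<exists>z. \<forall>\<xi>. T \<xi> \<bullet> \<eta> = \<xi> \<bullet> z" for \<eta>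
    by (rule riesz_representation)
      (intro bounded_linear_compose[OF bounded_linear_inner_left] blinfun.bounded_linear_right)
  then obtain S where S: "\<And>\<xi> \<eta>. T \<xi> \<bullet> \<eta> = \<xi> \<bullet> S \<eta>" by metis
  have ext: "a = b" if "\<And>\<xi>. \<xi> \<bullet> a = \<xi> \<bullet> b" for a b :: 'h
    using that[of "a - b"]
    by (metis eq_iff_diff_eq_0 inner_diff_right inner_eq_zero_iff)
  have "bounded_linear S"
  proof (rule bounded_linear_intro[where K = "norm T"])
    show "S (x + y) = S x + S y" for x y
      by (rule ext) (simp add: inner_add_right S[symmetric])
    show "S (r *\<^sub>R x) = r *\<^sub>R S x" for r x
      by (rule ext) (simp add: S[symmetric])
    show "norm (S x) \<le> norm x * norm T" for x
    proof (cases "S x = 0")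
      case False
      have "norm (S x) * norm (S x) = T (S x) \<bullet> x"
        by (simp add: S dot_square_norm power2_eq_square)
      also have "\<dots> \<le> norm (T (S x)) * norm x" by (rule norm_cauchy_schwarz)
      also have "\<dots> \<le> norm T * norm (S x) * norm x"
        by (intro mult_right_mono norm_blinfun) simp
      finally have "norm (S x) * norm (S x) \<le> norm (S x) * (norm x * norm T)"
        by (simp add: mult_ac)
      then show ?thesis
        by (rule mult_left_le_imp_le) (simp add: False)
    qed simp
  qed
  then have S_app: "blinfun_apply (Blinfun S) = S" by (rule bounded_linear_Blinfun_apply)
  have *: "cinner (T \<xi>) \<eta> = cinner \<xi> (Blinfun S \<eta>)" for \<xi> \<eta>
    using T by (simp add: S_app cinner_eq_inner S[symmetric] clinear_op_def)
  have "T\<^sup>\<dagger> = Blinfun S" by (rule op_adj_eqI) (rule *)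
  with * show ?thesis by simp
qed

lemma op_adj_left:
  assumes "clinear_op T"
  shows "cinner ((T\<^sup>\<dagger>) \<xi>) \<eta> = cinner \<xi> (T \<eta>)"
  by (metis op_adj[OF assms] cinner_commute)

lemma op_adj_adj: "clinear_op T \<Longrightarrow> (T\<^sup>\<dagger>)\<^sup>\<dagger> = T"
  by (rule op_adj_eqI) (rule op_adj_left)

lemma op_adj_times:
  "clinear_op S \<Longrightarrow> clinear_op T \<Longrightarrow> (S \<cdot> T)\<^sup>\<dagger> = T\<^sup>\<dagger> \<cdot> S\<^sup>\<dagger>"
  by (rule op_adj_eqI) (simp add: op_adj)

lemma op_adj_add:
  "clinear_op S \<Longrightarrow> clinear_op T \<Longrightarrow> (S + T)\<^sup>\<dagger> = S\<^sup>\<dagger> + T\<^sup>\<dagger>"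
  by (rule op_adj_eqI) (simp add: op_adj plus_blinfun.rep_eq cinner_add_left cinner_add_right)

lemma op_adj_diff:
  "clinear_op S \<Longrightarrow> clinear_op T \<Longrightarrow> (S - T)\<^sup>\<dagger> = S\<^sup>\<dagger> - T\<^sup>\<dagger>"
  by (rule op_adj_eqI) (simp add: op_adj minus_blinfun.rep_eq cinner_diff_left cinner_diff_right)

lemma op_adj_scaleR: "clinear_op T \<Longrightarrow> (r *\<^sub>R T)\<^sup>\<dagger> = r *\<^sub>R T\<^sup>\<dagger>"
  by (rule op_adj_eqI) (simp add: op_adj scaleR_blinfun.rep_eq cinner_scaleR_left cinner_scaleR_right)

lemma op_adj_id: "\<one>\<^sup>\<dagger> = \<one>"
  by (rule op_adj_eqI) simp

lemma op_scaleC_apply: "blinfun_apply (op_scaleC c T) \<xi> = c *\<^sub>C T \<xi>"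
  unfolding op_scaleC_def
  by (subst bounded_linear_Blinfun_apply)
    (intro bounded_linear_compose[OF bounded_linear_scaleC] blinfun.bounded_linear_right, rule refl)

lemma op_adj_scaleC: "clinear_op T \<Longrightarrow> (op_scaleC c T)\<^sup>\<dagger> = op_scaleC (cnj c) (T\<^sup>\<dagger>)"
  by (rule op_adj_eqI) (simp add: op_adj op_scaleC_apply cinner_scaleC_left cinner_scaleC_right)

lemma scaleR_op_scaleC: "r *\<^sub>R T = op_scaleC (of_real r) T"
  by (rule blinfun_eqI) (simp add: op_scaleC_apply scaleR_scaleC[symmetric] scaleR_blinfun.rep_eq)

lemma op_scaleC_times_left: "op_scaleC c S \<cdot> T = op_scaleC c (S \<cdot> T)"
  by (rule blinfun_eqI) (simp add: op_scaleC_apply)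

lemma op_scaleC_times_right: "clinear_op T \<Longrightarrow> T \<cdot> op_scaleC c S = op_scaleC c (T \<cdot> S)"
  by (rule blinfun_eqI) (simp add: op_scaleC_apply clinear_op_def)

lemma op_assoc: "(S \<cdot> T) \<cdot> U = S \<cdot> (T \<cdot> U)"
  by (rule blinfun_eqI) simp

lemma op_id_times [simp]: "\<one> \<cdot> T = T" "T \<cdot> \<one> = T"
  by (auto intro!: blinfun_eqI)

lemmas op_bilinear = bounded_bilinear.add_left[OF bounded_bilinear_blinfun_compose]
  bounded_bilinear.add_right[OF bounded_bilinear_blinfun_compose]
  bounded_bilinear.diff_left[OF bounded_bilinear_blinfun_compose]
  bounded_bilinear.diff_right[OF bounded_bilinear_blinfun_compose]
  bounded_bilinear.scaleR_left[OF bounded_bilinear_blinfun_compose]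
  bounded_bilinear.scaleR_right[OF bounded_bilinear_blinfun_compose]
  bounded_bilinear.minus_left[OF bounded_bilinear_blinfun_compose]
  bounded_bilinear.minus_right[OF bounded_bilinear_blinfun_compose]

section \<open>Von Neumann algebras, traces and expectations\<close>

lemma bounded_ops_UNIV: "T \<in> bounded_ops UNIV \<longleftrightarrow> clinear_op T"
  by (simp add: bounded_ops_def clinear_op_def op_proj_UNIV)

context
  fixes A :: "'h::complex_hilbert op set"
  assumes A: "von_neumann_algebra A"
begin

text \<open>Membership in a von Neumann algebra is commutation with its commutant, which makes all
  algebraic closure properties immediate.\<close>

lemma vn_iff: "x \<in> A \<longleftrightarrow> clinear_op x \<and> (\<forall>s\<in>commutant A. x \<cdot> s = s \<cdot> x)"
proof -
  have "x \<in> A \<longleftrightarrow> x \<in> commutant (commutant A)"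
    using A by (simp add: von_neumann_algebra_def)
  also have "\<dots> \<longleftrightarrow> clinear_op x \<and> (\<forall>s\<in>commutant A. x \<cdot> s = s \<cdot> x)"
    unfolding commutant_on_def[of UNIV "commutant A"] bounded_ops_UNIV[symmetric] by blast
  finally show ?thesis .
qed

lemma vn_clinear: "x \<in> A \<Longrightarrow> clinear_op x"
  using vn_iff by blast

lemma commutant_clinear: "s \<in> commutant A \<Longrightarrow> clinear_op s"
  by (simp add: commutant_on_def bounded_ops_UNIV)

lemma vn_one: "\<one> \<in> A"
  by (simp add: vn_iff clinear_op_def)

lemma vn_zero: "0 \<in> A"
  by (simp add: vn_iff clinear_op_def)

lemma vn_add: "x \<in> A \<Longrightarrow> y \<in> A \<Longrightarrow> x + y \<in> A"
  by (simp add: vn_iff clinear_op_def op_bilinear plus_blinfun.rep_eq scaleC_add_right)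

lemma vn_scaleC: "x \<in> A \<Longrightarrow> op_scaleC c x \<in> A"
  by (simp add: vn_iff op_scaleC_times_left op_scaleC_times_right commutant_clinear)
    (simp add: clinear_op_def op_scaleC_apply scaleC_scaleC mult.commute)

lemma vn_scaleR: "x \<in> A \<Longrightarrow> r *\<^sub>R x \<in> A"
  by (simp add: scaleR_op_scaleC vn_scaleC)

lemma vn_minus: "x \<in> A \<Longrightarrow> - x \<in> A"
  using vn_scaleR[of x "-1"] by simp

lemma vn_diff: "x \<in> A \<Longrightarrow> y \<in> A \<Longrightarrow> x - y \<in> A"
  using vn_add[of x "- y"] vn_minus[of y] by simp

lemma vn_times: "x \<in> A \<Longrightarrow> y \<in> A \<Longrightarrow> x \<cdot> y \<in> A"
  by (simp add: vn_iff clinear_op_def) (metis op_assoc)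

lemma vn_adj: "x \<in> A \<Longrightarrow> x\<^sup>\<dagger> \<in> A"
  using A by (simp add: von_neumann_algebra_def)

end

locale tracial_algebra =
  fixes A :: "'h::complex_hilbert op set" and \<tau> :: "'h op \<Rightarrow> complex"
  assumes vn: "von_neumann_algebra A"
    and trace: "faithful_normal_tracial_state A \<tau>"
begin

lemmas vn_closed = vn_one[OF vn] vn_zero[OF vn] vn_add[OF vn] vn_minus[OF vn] vn_diff[OF vn]
  vn_scaleC[OF vn] vn_scaleR[OF vn] vn_times[OF vn] vn_adj[OF vn]

lemmas clinear = vn_clinear[OF vn]

lemma tr_add: "x \<in> A \<Longrightarrow> y \<in> A \<Longrightarrow> \<tau> (x + y) = \<tau> x + \<tau> y"
  and tr_scaleC: "x \<in> A \<Longrightarrow> \<tau> (op_scaleC c x) = c * \<tau> x"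
  and tr_one: "\<tau> \<one> = 1"
  and tr_pos: "x \<in> A \<Longrightarrow> \<tau> (x\<^sup>\<dagger> \<cdot> x) \<in> \<real>\<^sub>\<ge>\<^sub>0"
  and tr_faithful: "x \<in> A \<Longrightarrow> \<tau> (x\<^sup>\<dagger> \<cdot> x) = 0 \<Longrightarrow> x = 0"
  and tr_comm: "x \<in> A \<Longrightarrow> y \<in> A \<Longrightarrow> \<tau> (x \<cdot> y) = \<tau> (y \<cdot> x)"
  using trace unfolding faithful_normal_tracial_state_def by simp_all

lemma tr_scaleR: "x \<in> A \<Longrightarrow> \<tau> (r *\<^sub>R x) = of_real r * \<tau> x"
  by (simp add: scaleR_op_scaleC tr_scaleC)

lemma tr_zero: "\<tau> 0 = 0"
  using tr_scaleR[of 0 0] by (simp add: vn_closed)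

lemma tr_diff: "x \<in> A \<Longrightarrow> y \<in> A \<Longrightarrow> \<tau> (x - y) = \<tau> x - \<tau> y"
  using tr_add[of x "(-1) *\<^sub>R y"] tr_scaleR[of y "-1"] by (simp add: vn_closed)

lemma tr_eq_0I: "x \<in> A \<Longrightarrow> (\<And>y. y \<in> A \<Longrightarrow> \<tau> (y \<cdot> x) = 0) \<Longrightarrow> x = 0"
  by (rule tr_faithful) (simp_all add: vn_closed)

text \<open>Polarization: positivity of \<open>\<tau>\<close> at \<open>(x + 1)\<^sup>* (x + 1)\<close> and at \<open>(\<i>x + 1)\<^sup>* (\<i>x + 1)\<close> makes
  the sum and the difference of \<open>\<tau> x\<^sup>*\<close> and \<open>\<tau> x\<close> real and imaginary, respectively.\<close>

lemma tr_adj: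
  assumes x: "x \<in> A"
  shows "\<tau> (x\<^sup>\<dagger>) = cnj (\<tau> x)"
proof -
  have real: "Im (\<tau> (y\<^sup>\<dagger>) + \<tau> y) = 0" if y: "y \<in> A" for y
  proof -
    have "(y + \<one>)\<^sup>\<dagger> \<cdot> (y + \<one>) = y\<^sup>\<dagger> \<cdot> y + (y\<^sup>\<dagger> + y) + \<one>"
      using y by (simp add: op_adj_add clinear vn_closed op_adj_id op_bilinear algebra_simps)
    then have "\<tau> ((y + \<one>)\<^sup>\<dagger> \<cdot> (y + \<one>)) = \<tau> (y\<^sup>\<dagger> \<cdot> y) + (\<tau> (y\<^sup>\<dagger>) + \<tau> y) + 1"
      using y by (simp add: tr_add vn_closed tr_one)
    moreover have "Im (\<tau> ((y + \<one>)\<^sup>\<dagger> \<cdot> (y + \<one>))) = 0" "Im (\<tau> (y\<^sup>\<dagger> \<cdot> y)) = 0"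
      using tr_pos[of y] tr_pos[of "y + \<one>"] y
      by (simp_all add: vn_closed complex_nonneg_Reals_iff)
    ultimately show ?thesis by simp
  qed
  have "Im (\<tau> (x\<^sup>\<dagger>) + \<tau> x) = 0" by (rule real[OF x])
  moreover have "Im (- \<i> * \<tau> (x\<^sup>\<dagger>) + \<i> * \<tau> x) = 0"
    using real[of "op_scaleC \<i> x"] x by (simp add: op_adj_scaleC clinear vn_closed tr_scaleC)
  ultimately show ?thesis by (simp add: complex_eq_iff)
qed

end

locale trace_expectation = tracial_algebra A \<tau>
  for A :: "'h::complex_hilbert op set" and \<tau> +
  fixes N :: "'h op set" and E :: "'h op \<Rightarrow> 'h op"
  assumes vn_N: "von_neumann_algebra N" and N_subset: "N \<subseteq> A"
    and E: "cond_expectation \<tau> A N E"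
begin

lemmas N_simps = vn_one[OF vn_N] vn_zero[OF vn_N] vn_add[OF vn_N] vn_minus[OF vn_N] vn_diff[OF vn_N]
  vn_scaleC[OF vn_N] vn_scaleR[OF vn_N] vn_times[OF vn_N] vn_adj[OF vn_N]

lemma N_in: "n \<in> N \<Longrightarrow> n \<in> A"
  using N_subset by blast

lemma E_in: "x \<in> A \<Longrightarrow> E x \<in> N"
  and E_id: "n \<in> N \<Longrightarrow> E n = n"
  and tr_E: "x \<in> A \<Longrightarrow> \<tau> (E x) = \<tau> x"
  and E_add: "x \<in> A \<Longrightarrow> y \<in> A \<Longrightarrow> E (x + y) = E x + E y"
  and E_scaleC: "x \<in> A \<Longrightarrow> E (op_scaleC c x) = op_scaleC c (E x)"
  and E_bimod: "m \<in> N \<Longrightarrow> n \<in> N \<Longrightarrow> x \<in> A \<Longrightarrow> E (m \<cdot> x \<cdot> n) = m \<cdot> E x \<cdot> n"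
  using E unfolding cond_expectation_def bimodule_map_def linear_map_on_def by simp_all

lemma E_left: "n \<in> N \<Longrightarrow> x \<in> A \<Longrightarrow> E (n \<cdot> x) = n \<cdot> E x"
  using E_bimod[of n \<one> x] by (simp add: N_simps)

lemma E_right: "n \<in> N \<Longrightarrow> x \<in> A \<Longrightarrow> E (x \<cdot> n) = E x \<cdot> n"
  using E_bimod[of \<one> n x] by (simp add: N_simps)

lemma E_scaleR: "x \<in> A \<Longrightarrow> E (r *\<^sub>R x) = r *\<^sub>R E x"
  by (simp add: scaleR_op_scaleC E_scaleC)

lemma E_zero: "E 0 = 0"
  by (simp add: E_id N_simps)

lemma E_diff: "x \<in> A \<Longrightarrow> y \<in> A \<Longrightarrow> E (x - y) = E x - E y"
  using E_add[of x "(-1) *\<^sub>R y"] E_scaleR[of y "-1"] by (simp add: vn_closed)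

lemma tr_E_left: "n \<in> N \<Longrightarrow> x \<in> A \<Longrightarrow> \<tau> (n \<cdot> E x) = \<tau> (n \<cdot> x)"
  using tr_E[of "n \<cdot> x"] by (simp add: E_left vn_closed N_in)

text \<open>The expectation is the orthogonal projection for the trace: \<open>E x - y\<close> is orthogonal to all
  of \<open>N\<close>, in particular to itself.\<close>

lemma E_eqI:
  assumes "x \<in> A" "y \<in> N" "\<And>n. n \<in> N \<Longrightarrow> \<tau> (n \<cdot> y) = \<tau> (n \<cdot> x)"
  shows "E x = y"
proof -
  let ?d = "E x - y"
  have d: "?d \<in> N" using assms by (simp add: N_simps E_in)
  have "\<tau> (?d\<^sup>\<dagger> \<cdot> ?d) = 0"
    using assms d tr_E_left[of "?d\<^sup>\<dagger>" x]
    by (simp add: op_bilinear tr_diff vn_closed N_in N_simps E_in)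
  then have "?d = 0" using d N_in tr_faithful by blast
  then show ?thesis by simp
qed

lemma E_adj:
  assumes x: "x \<in> A"
  shows "E (x\<^sup>\<dagger>) = (E x)\<^sup>\<dagger>"
proof (rule E_eqI)
  fix n assume n: "n \<in> N"
  have adj: "\<tau> (n \<cdot> y\<^sup>\<dagger>) = cnj (\<tau> (n\<^sup>\<dagger> \<cdot> y))" if y: "y \<in> A" for y
  proof -
    have "cnj (\<tau> (n\<^sup>\<dagger> \<cdot> y)) = \<tau> (y\<^sup>\<dagger> \<cdot> n)"
      using n y by (simp add: tr_adj[symmetric] vn_closed N_in op_adj_times clinear op_adj_adj)
    then show ?thesis using n y by (simp add: tr_comm vn_closed N_in)
  qed
  show "\<tau> (n \<cdot> (E x)\<^sup>\<dagger>) = \<tau> (n \<cdot> x\<^sup>\<dagger>)"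
    using n x by (simp add: adj E_in N_in tr_E_left N_simps)
qed (use x in \<open>simp_all add: E_in N_simps vn_closed\<close>)

end

section \<open>The basic construction\<close>

lemma closed_csubspace_closure:
  assumes "0 \<in> S" and add: "\<And>x y. x \<in> S \<Longrightarrow> y \<in> S \<Longrightarrow> x + y \<in> S"
    and scale: "\<And>c x. x \<in> S \<Longrightarrow> c *\<^sub>C x \<in> S"
  shows "closed_csubspace (closure S)"
  unfolding closed_csubspace_def
proof (intro conjI ballI allI)
  show "0 \<in> closure S" using assms closure_subset by blast
  show "x + y \<in> closure S" if xy: "x \<in> closure S" "y \<in> closure S" for x y
  proof -
    obtain f g where "\<And>n. f n \<in> S" "f \<longlonglongrightarrow> x" "\<And>n. g n \<in> S" "g \<longlonglongrightarrow> y"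
      using xy unfolding closure_sequential by blast
    then show ?thesis
      unfolding closure_sequential
      by (intro exI[of _ "\<lambda>n. f n + g n"]) (simp add: add tendsto_add)
  qed
  show "c *\<^sub>C x \<in> closure S" if x: "x \<in> closure S" for c x
  proof -
    obtain f where "\<And>n. f n \<in> S" "f \<longlonglongrightarrow> x"
      using x unfolding closure_sequential by blast
    then show ?thesis
      unfolding closure_sequential
      by (intro exI[of _ "\<lambda>n. c *\<^sub>C f n"])
        (simp add: scale bounded_linear.tendsto[OF bounded_linear_scaleC])
  qed
qed simp

lemma op_proj_adj:
  assumes K: "closed_csubspace K"
  shows "(op_proj K)\<^sup>\<dagger> = op_proj K"
proof (rule op_adj_eqI)
  let ?P = "op_proj K"
  have right: "cinner (?P \<xi>) \<eta> = cinner (?P \<xi>) (?P \<eta>)" for \<xi> \<eta>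
    using op_proj(2)[OF K op_proj(1)[OF K], of \<xi> \<eta>] by (simp add: cinner_diff_right)
  have left: "cinner \<xi> (?P \<eta>) = cinner (?P \<xi>) (?P \<eta>)" for \<xi> \<eta>
    using right[of \<eta> \<xi>] by (metis cinner_commute)
  show "cinner (?P \<xi>) \<eta> = cinner \<xi> (?P \<eta>)" for \<xi> \<eta>
    using left right by simp
qed

locale basic_constr = trace_expectation A \<tau> N E
  for A :: "'h::complex_hilbert op set" and \<tau> N E +
  fixes B :: "'h op set" and e :: "'h op" and K \<Lambda> \<pi>
  assumes vn_B: "von_neumann_algebra B"
    and bc: "basic_construction N A \<tau> e B K \<Lambda> \<pi>"
begin

lemma gns: "gns_space A \<tau> K \<Lambda>" and A_subset: "A \<subseteq> B" and e_in: "e \<in> B"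
  and pi_app: "\<And>x y. x \<in> A \<Longrightarrow> y \<in> A \<Longrightarrow> \<pi> x (\<Lambda> y) = \<Lambda> (x \<cdot> y)"
  and pi_e: "\<pi> e = op_proj (closure (\<Lambda> ` N))"
  and iso: "vn_isomorphism B (vn_generated K (\<pi> ` A \<union> {\<pi> e})) \<pi>"
  using bc unfolding basic_construction_def by (elim conjE; assumption | simp)+

lemma closed_K: "closed_csubspace K" and closure_K: "closure (\<Lambda> ` A) = K"
  and Lam_add: "\<And>x y. x \<in> A \<Longrightarrow> y \<in> A \<Longrightarrow> \<Lambda> (x + y) = \<Lambda> x + \<Lambda> y"
  and Lam_scaleC: "\<And>c x. x \<in> A \<Longrightarrow> \<Lambda> (op_scaleC c x) = c *\<^sub>C \<Lambda> x"
  and Lam_cinner: "\<And>x y. x \<in> A \<Longrightarrow> y \<in> A \<Longrightarrow> cinner (\<Lambda> x) (\<Lambda> y) = \<tau> (x\<^sup>\<dagger> \<cdot> y)"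
  using gns unfolding gns_space_def by simp_all

lemma pi_times: "x \<in> B \<Longrightarrow> y \<in> B \<Longrightarrow> \<pi> (x \<cdot> y) = \<pi> x \<cdot> \<pi> y"
  and pi_adj: "x \<in> B \<Longrightarrow> \<pi> (x\<^sup>\<dagger>) = (\<pi> x)\<^sup>\<dagger>"
  and pi_bij: "bij_betw \<pi> B (vn_generated K (\<pi> ` A \<union> {\<pi> e}))"
  and pi_scaleC: "x \<in> B \<Longrightarrow> \<pi> (op_scaleC c x) = op_scaleC c (\<pi> x)"
  using iso unfolding vn_isomorphism_def linear_map_on_def by (elim conjE; assumption | simp)+

lemma pi_inj: "x \<in> B \<Longrightarrow> y \<in> B \<Longrightarrow> \<pi> x = \<pi> y \<Longrightarrow> x = y"
  using pi_bij unfolding bij_betw_def inj_on_def by blast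

lemmas B_simps = vn_one[OF vn_B] vn_zero[OF vn_B] vn_add[OF vn_B] vn_minus[OF vn_B] vn_diff[OF vn_B]
  vn_scaleC[OF vn_B] vn_scaleR[OF vn_B] vn_times[OF vn_B] vn_adj[OF vn_B] e_in

lemma A_in: "a \<in> A \<Longrightarrow> a \<in> B"
  using A_subset by blast

lemma pi_zero: "\<pi> 0 = 0"
proof -
  have "op_scaleC 0 x = 0" for x :: "'h op"
    using scaleR_op_scaleC[of 0 x] by simp
  then show ?thesis using pi_scaleC[of 0 0] by (simp add: B_simps)
qed

text \<open>An element of \<open>B\<close> is determined by its action on the dense set of vectors \<open>\<Lambda> a\<close>.\<close>

lemma eq_by_action:
  assumes x: "x \<in> B" and y: "y \<in> B" and eq: "\<And>a. a \<in> A \<Longrightarrow> \<pi> x (\<Lambda> a) = \<pi> y (\<Lambda> a)"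
  shows "x = y"
proof (rule pi_inj[OF x y], rule blinfun_eqI)
  fix \<xi>
  have "\<pi> x \<zeta> = \<pi> y \<zeta>" if "\<zeta> \<in> K" for \<zeta>
  proof -
    have "closed {\<zeta>. \<pi> x \<zeta> = \<pi> y \<zeta>}"
      by (intro closed_Collect_eq continuous_intros)
    then have "closure (\<Lambda> ` A) \<subseteq> {\<zeta>. \<pi> x \<zeta> = \<pi> y \<zeta>}"
      by (intro closure_minimal) (auto simp: eq)
    then show ?thesis using that closure_K by blast
  qed
  moreover have "\<pi> z \<xi> = \<pi> z (op_proj K \<xi>)" if "z \<in> B" for z
  proof -
    have "\<pi> z \<in> bounded_ops K"
      using bij_betwE[OF pi_bij] that unfolding vn_generated_def commutant_on_def by blast
    then have "\<pi> z \<cdot> op_proj K = \<pi> z" by (simp add: bounded_ops_def)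
    then show ?thesis by (metis blinfun_apply_blinfun_compose)
  qed
  ultimately show "\<pi> x \<xi> = \<pi> y \<xi>"
    using x y op_proj(1)[OF closed_K] by simp
qed

lemma closed_LN: "closed_csubspace (closure (\<Lambda> ` N))"
proof (rule closed_csubspace_closure)
  have "op_scaleC 0 0 = (0 :: 'h op)" using scaleR_op_scaleC[of 0 "0 :: 'h op"] by simp
  moreover have "0 *\<^sub>C \<Lambda> 0 = 0" using scaleR_scaleC[of 0 "\<Lambda> 0"] by simp
  ultimately have "\<Lambda> 0 = 0" using Lam_scaleC[of 0 0] by (simp add: vn_closed)
  then show "0 \<in> \<Lambda> ` N" by (metis vn_zero[OF vn_N] imageI)
  show "x + y \<in> \<Lambda> ` N" if "x \<in> \<Lambda> ` N" "y \<in> \<Lambda> ` N" for x y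
    using that by (auto simp: Lam_add[symmetric] N_in N_simps)
  show "c *\<^sub>C x \<in> \<Lambda> ` N" if "x \<in> \<Lambda> ` N" for c x
    using that by (auto simp: Lam_scaleC[symmetric] N_in N_simps)
qed

lemma pi_e_Lam:
  assumes a: "a \<in> A"
  shows "\<pi> e (\<Lambda> a) = \<Lambda> (E a)"
  unfolding pi_e
proof (rule op_proj_eqI[OF closed_LN])
  show "\<Lambda> (E a) \<in> closure (\<Lambda> ` N)"
    by (rule subsetD[OF closure_subset imageI[OF E_in[OF a]]])
  have "closed {\<eta>. cinner \<eta> (\<Lambda> a - \<Lambda> (E a)) = 0}"
    by (rule closed_Collect_eq[OF continuous_on_cinner_left continuous_on_const])
  moreover have "cinner (\<Lambda> n) (\<Lambda> a - \<Lambda> (E a)) = 0" if n: "n \<in> N" for n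
    using n a by (simp add: cinner_diff_right Lam_cinner tr_E_left N_in N_simps E_in)
  ultimately have "closure (\<Lambda> ` N) \<subseteq> {\<eta>. cinner \<eta> (\<Lambda> a - \<Lambda> (E a)) = 0}"
    by (intro closure_minimal) auto
  then show "cinner \<eta> (\<Lambda> a - \<Lambda> (E a)) = 0" if "\<eta> \<in> closure (\<Lambda> ` N)" for \<eta>
    using that by blast
qed

lemma e_adj: "e\<^sup>\<dagger> = e"
  by (rule pi_inj) (simp_all add: B_simps pi_adj, simp add: pi_e op_proj_adj closed_LN)

lemma e_idem: "e \<cdot> e = e"
  by (rule eq_by_action)
    (simp_all add: B_simps pi_times pi_e_Lam N_in E_in E_id)

lemma e_commute:
  assumes n: "n \<in> N"
  shows "e \<cdot> n = n \<cdot> e"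
  by (rule eq_by_action)
    (use n in \<open>simp_all add: B_simps A_in pi_times pi_e_Lam N_in E_in E_left pi_app vn_closed\<close>)

lemma e_sandwich:
  assumes x: "x \<in> A"
  shows "e \<cdot> x \<cdot> e = E x \<cdot> e"
  by (rule eq_by_action)
    (use x in \<open>simp_all add: B_simps A_in pi_times pi_e_Lam N_in E_in E_right pi_app vn_closed\<close>)

text \<open>As \<open>\<pi> e\<close> fixes \<open>\<Lambda> 1\<close>, the vector \<open>\<pi> b (\<Lambda> a)\<close> equals \<open>\<pi> (b a e) (\<Lambda> 1)\<close>.\<close>

lemma eq_0_if_annihilates_e:
  assumes b: "b \<in> B" and "\<And>a. a \<in> A \<Longrightarrow> b \<cdot> a \<cdot> e = 0"
  shows "b = 0"
proof (rule eq_by_action[OF b])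
  fix a assume a: "a \<in> A"
  have "\<pi> b (\<Lambda> a) = \<pi> (b \<cdot> a \<cdot> e) (\<Lambda> \<one>)"
    using a b by (simp add: pi_times B_simps A_in pi_e_Lam vn_closed E_id N_simps pi_app)
  then show "\<pi> b (\<Lambda> a) = \<pi> 0 (\<Lambda> a)" using assms a by (simp add: pi_zero)
qed (simp add: B_simps)

end

section \<open>Jones towers\<close>

text \<open>The property by which the multiplier of a form is singled out; existence and uniqueness are
  \<open>represents_words\<close> and \<open>represents_unique\<close> below.\<close>

definition represents ::
    "'h::complex_hilbert tower \<Rightarrow> 'h op \<Rightarrow> ('h op \<Rightarrow> 'h op \<Rightarrow> 'h op) \<Rightarrow> bool"
  where "represents T g G \<longleftrightarrow> g \<in> commutant (alg T 1) \<inter> alg T 4 \<and>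
    (\<forall>x\<in>alg T 0. \<forall>y\<in>alg T 0. G x y = lam T powr (-11/2) *\<^sub>R
       EM T 0 (et2 T \<cdot> et1 T \<cdot> x\<^sup>\<dagger> \<cdot> jp T 1 \<cdot> y \<cdot> g \<cdot> et1 T \<cdot> et2 T))"

locale jones =
  fixes T :: "'h::complex_hilbert tower"
  assumes tower: "jones_tower T"
begin

abbreviation M where "M \<equiv> alg T"
abbreviation N where "N \<equiv> subalg T"
abbreviation tr where "tr \<equiv> trc T"
abbreviation e where "e \<equiv> jp T"
abbreviation E where "E \<equiv> EM T"
abbreviation l where "l \<equiv> lam T"

lemma lam_pos: "l > 0" and vn_M: "von_neumann_algebra (M k)" and vn_N: "von_neumann_algebra N"
  and N_subset: "N \<subseteq> M 0" and M_Suc: "M k \<subseteq> M (Suc k)"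
  and tr_M: "faithful_normal_tracial_state (M k) (tr k)"
  and tr_Suc: "x \<in> M k \<Longrightarrow> tr (Suc k) x = tr k x"
  and cond_EN: "cond_expectation (tr 0) (M 0) N (EN T)"
  and cond_E: "k \<le> j \<Longrightarrow> cond_expectation (tr j) (M j) (M k) (E k)"
  and E_e: "E k (e (Suc k)) = l *\<^sub>R \<one>"
  using tower unfolding jones_tower_def finite_von_neumann_algebra_def by simp_all

sublocale lev: tracial_algebra "M k" "tr k" for k
  by unfold_locales (rule vn_M, rule tr_M)

lemma M_mono: "k \<le> j \<Longrightarrow> M k \<subseteq> M j"
  using M_Suc by (rule lift_Suc_mono_le)

lemma M_in: "x \<in> M k \<Longrightarrow> k \<le> j \<Longrightarrow> x \<in> M j"
  using M_mono by blast

lemma tr_eq: "x \<in> M k \<Longrightarrow> k \<le> j \<Longrightarrow> tr j x = tr k x"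
proof (induction j)
  case (Suc j)
  then show ?case by (cases "k = Suc j") (auto simp: tr_Suc M_in)
qed simp

lemma expectation: "k \<le> j \<Longrightarrow> trace_expectation (M j) (tr j) (M k) (E k)"
  by unfold_locales (simp_all add: vn_M M_mono cond_E)

lemma expectation_Suc: "trace_expectation (M (Suc k)) (tr (Suc k)) (M k) (E k)"
  by (rule expectation) simp

lemma basic_constr_first:
  "\<exists>K \<Lambda> \<pi>. basic_constr (M 0) (tr 0) N (EN T) (M 1) (e 1) K \<Lambda> \<pi>"
proof -
  have "\<exists>K \<Lambda> J \<pi>. basic_construction N (M 0) (tr 0) (e 1) (M 1) K \<Lambda> \<pi> \<and>
      gns_conjugation (M 0) K \<Lambda> J \<and> extremal_trace N (M 0) (M 1) (tr 1) K J \<pi>"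
    using tower unfolding jones_tower_def by (elim conjE)
  then obtain K \<Lambda> \<pi> where "basic_construction N (M 0) (tr 0) (e 1) (M 1) K \<Lambda> \<pi>"
    by blast
  then have "basic_constr (M 0) (tr 0) N (EN T) (M 1) (e 1) K \<Lambda> \<pi>"
    by unfold_locales (simp_all add: vn_M vn_N N_subset cond_EN)
  then show ?thesis by blast
qed

lemma basic_constr_step:
  "\<exists>K \<Lambda> \<pi>. basic_constr (M (Suc k)) (tr (Suc k)) (M k) (E k) (M (k + 2)) (e (k + 2)) K \<Lambda> \<pi>"
proof -
  have "\<forall>k. \<exists>K \<Lambda> \<pi>. basic_construction (M k) (M (Suc k)) (tr (Suc k)) (e (k + 2)) (M (k + 2)) K \<Lambda> \<pi>"
    using tower unfolding jones_tower_def by (elim conjE)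
  then obtain K \<Lambda> \<pi> where
    "basic_construction (M k) (M (Suc k)) (tr (Suc k)) (e (k + 2)) (M (k + 2)) K \<Lambda> \<pi>"
    by blast
  then have "basic_constr (M (Suc k)) (tr (Suc k)) (M k) (E k) (M (k + 2)) (e (k + 2)) K \<Lambda> \<pi>"
    by unfold_locales (simp_all add: vn_M M_Suc cond_E)
  then show ?thesis by blast
qed

lemma basic_constr_any:
  "\<exists>N' E' K \<Lambda> \<pi>. basic_constr (M k) (tr k) N' E' (M (Suc k)) (e (Suc k)) K \<Lambda> \<pi>"
proof (cases k)
  case 0
  obtain K \<Lambda> \<pi> where "basic_constr (M 0) (tr 0) N (EN T) (M 1) (e 1) K \<Lambda> \<pi>"
    using basic_constr_first by blast
  then show ?thesis unfolding 0 One_nat_def by (intro exI)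
next
  case (Suc i)
  obtain K \<Lambda> \<pi> where
    "basic_constr (M (Suc i)) (tr (Suc i)) (M i) (E i) (M (i + 2)) (e (i + 2)) K \<Lambda> \<pi>"
    using basic_constr_step by blast
  then show ?thesis unfolding Suc add_2_eq_Suc' by (intro exI)
qed

lemma e_in: "0 < i \<Longrightarrow> i \<le> j \<Longrightarrow> e i \<in> M j"
  using basic_constr_any[of "i - 1"] basic_constr.e_in M_in
  by (metis Suc_diff_1)

lemma e_adj: "0 < i \<Longrightarrow> (e i)\<^sup>\<dagger> = e i"
  using basic_constr_any[of "i - 1"] basic_constr.e_adj by fastforce

lemma e_idem: "0 < i \<Longrightarrow> e i \<cdot> e i = e i"
  using basic_constr_any[of "i - 1"] basic_constr.e_idem by fastforce

lemma e_commute: "x \<in> M k \<Longrightarrow> k + 2 \<le> i \<Longrightarrow> e i \<cdot> x = x \<cdot> e i"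
proof -
  assume x: "x \<in> M k" and "k + 2 \<le> i"
  then have "x \<in> M (i - 2)" by (intro M_in[OF x]) simp
  moreover have "i - 2 + 2 = i" using \<open>k + 2 \<le> i\<close> by simp
  ultimately show ?thesis using basic_constr_step[of "i - 2"] basic_constr.e_commute by metis
qed

lemma e_sandwich: "x \<in> M (Suc k) \<Longrightarrow> e (k + 2) \<cdot> x \<cdot> e (k + 2) = E k x \<cdot> e (k + 2)"
  using basic_constr_step[of k] basic_constr.e_sandwich by metis

lemma e1_sandwich: "x \<in> M 0 \<Longrightarrow> e 1 \<cdot> x \<cdot> e 1 = EN T x \<cdot> e 1"
  using basic_constr_first basic_constr.e_sandwich by metis

lemma eq_0_if_annihilates_e:
  "b \<in> M (Suc k) \<Longrightarrow> (\<And>a. a \<in> M k \<Longrightarrow> b \<cdot> a \<cdot> e (Suc k) = 0) \<Longrightarrow> b = 0"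
  using basic_constr_any[of k] basic_constr.eq_0_if_annihilates_e by metis

lemma E_sandwich_e:
  assumes "x \<in> M k" "y \<in> M k"
  shows "E k (x \<cdot> e (Suc k) \<cdot> y) = l *\<^sub>R (x \<cdot> y)"
  using trace_expectation.E_bimod[OF expectation_Suc assms e_in[of "Suc k" "Suc k"]]
  by (simp add: E_e op_bilinear)

text \<open>The Markov property: a letter \<open>e\<^sub>k\<^sub>+\<^sub>1\<close> between elements of \<open>M\<^sub>k\<close> contributes a factor \<open>\<lambda>\<close>.\<close>

lemma tr_e:
  assumes "x \<in> M k" "y \<in> M k" "k < j"
  shows "tr j (x \<cdot> (e (Suc k) \<cdot> y)) = l * tr j (x \<cdot> y)"
proof -
  have in_M: "x \<cdot> e (Suc k) \<cdot> y \<in> M (Suc k)"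
    using assms by (simp add: lev.vn_closed e_in M_in[OF assms(1)] M_in[OF assms(2)])
  have "tr j (x \<cdot> e (Suc k) \<cdot> y) = tr (Suc k) (x \<cdot> e (Suc k) \<cdot> y)"
    using in_M assms by (intro tr_eq) auto
  also have "\<dots> = tr (Suc k) (E k (x \<cdot> e (Suc k) \<cdot> y))"
    using trace_expectation.tr_E[OF expectation_Suc in_M] by simp
  also have "\<dots> = l * tr (Suc k) (x \<cdot> y)"
    using assms by (simp add: E_sandwich_e lev.tr_scaleR lev.vn_closed M_in[OF assms(1)] M_in[OF assms(2)])
  also have "tr (Suc k) (x \<cdot> y) = tr j (x \<cdot> y)"
  proof -
    have "x \<cdot> y \<in> M k" using assms by (simp add: lev.vn_closed)
    from tr_eq[OF this, of j] tr_eq[OF this, of "Suc k"] show ?thesis using \<open>k < j\<close> by simp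
  qed
  finally show ?thesis by (simp add: op_assoc)
qed

lemma jones_up:
  "e (k + 2) \<cdot> e (k + 1) \<cdot> e (k + 2) = l *\<^sub>R e (k + 2)"
  using e_sandwich[of "e (Suc k)" k] by (simp add: e_in E_e op_bilinear)

text \<open>Let \<open>p = e\<^sub>k\<^sub>+\<^sub>1\<close> and \<open>q = e\<^sub>k\<^sub>+\<^sub>2\<close>.  By the opposite relation the defect \<open>r = \<lambda> p - p q p\<close> is
  \<open>\<lambda>\<close> times a projection, and it has trace zero since \<open>p q p\<close> and \<open>p q\<close> have the same trace, which
  is \<open>\<lambda>\<close> times that of \<open>p\<close>; faithfulness gives \<open>r = 0\<close>.\<close>

lemma jones_down:
  "e (k + 1) \<cdot> e (k + 2) \<cdot> e (k + 1) = l *\<^sub>R e (k + 1)"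
proof -
  define p q where "p = e (k + 1)" and "q = e (k + 2)"
  define j where "j = k + 2"
  have pq: "p \<in> M j" "q \<in> M j" by (simp_all add: p_def q_def j_def e_in)
  have idem: "p \<cdot> p = p" "q \<cdot> q = q" by (simp_all add: p_def q_def e_idem)
  have adj: "p\<^sup>\<dagger> = p" "q\<^sup>\<dagger> = q" by (simp_all add: p_def q_def e_adj)
  have qpq: "q \<cdot> (p \<cdot> q) = l *\<^sub>R q" using jones_up[of k] by (simp add: p_def q_def op_assoc)
  have tr_pq: "tr j (p \<cdot> q) = l * tr j p"
    using tr_e[of p "k + 1" \<one> j] by (simp add: p_def q_def j_def e_in lev.vn_closed)
  define r where "r = l *\<^sub>R p - p \<cdot> (q \<cdot> p)"
  have r: "r \<in> M j" by (simp add: r_def pq lev.vn_closed)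
  have "r\<^sup>\<dagger> = r"
    by (simp add: r_def op_adj_diff op_adj_scaleR op_adj_times lev.clinear[of _ j] pq
        lev.vn_closed adj op_assoc)
  have contract: "p \<cdot> (p \<cdot> x) = p \<cdot> x" "q \<cdot> (p \<cdot> (q \<cdot> x)) = l *\<^sub>R (q \<cdot> x)" for x
    using idem qpq by (metis op_assoc) (metis op_assoc op_bilinear(5) qpq)
  have "r\<^sup>\<dagger> \<cdot> r = l *\<^sub>R r"
    unfolding \<open>r\<^sup>\<dagger> = r\<close>
    by (simp add: r_def op_bilinear op_assoc idem contract scaleR_diff_right)
  moreover have "tr j r = 0"
  proof -
    have "tr j (p \<cdot> (q \<cdot> p)) = tr j (p \<cdot> q)"
      using lev.tr_comm[of p j "q \<cdot> p"] lev.tr_comm[of p j q]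
      by (simp add: pq lev.vn_closed op_assoc idem)
    then show ?thesis
      by (simp add: r_def lev.tr_diff lev.tr_scaleR pq lev.vn_closed tr_pq)
  qed
  ultimately have "r = 0"
    using lev.tr_faithful[OF r] by (simp add: lev.tr_scaleR r)
  then show ?thesis by (simp add: r_def p_def q_def op_assoc)
qed

text \<open>The expectation of \<open>b\<^sup>* e\<^sub>k\<^sub>+\<^sub>1 b\<close> onto \<open>M\<^sub>k\<close> is \<open>\<lambda> b\<^sup>* b\<close>.\<close>

lemma e_cancel:
  assumes b: "b \<in> M k" and "e (Suc k) \<cdot> b = 0"
  shows "b = 0"
proof -
  have "E k (b\<^sup>\<dagger> \<cdot> e (Suc k) \<cdot> b) = l *\<^sub>R (b\<^sup>\<dagger> \<cdot> b)"
    using b by (intro E_sandwich_e) (simp_all add: lev.vn_closed)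
  then have "b\<^sup>\<dagger> \<cdot> b = 0"
    using assms lam_pos trace_expectation.E_zero[OF expectation_Suc[of k]] by (simp add: op_assoc)
  then show ?thesis using lev.tr_faithful[OF b] by (simp add: lev.tr_zero)
qed

text \<open>Elements of \<open>M\<^sub>k\<^sub>+\<^sub>1 e\<^sub>k\<^sub>+\<^sub>1\<close> already lie in \<open>M\<^sub>k e\<^sub>k\<^sub>+\<^sub>1\<close>.  With \<open>e = e\<^sub>k\<^sub>+\<^sub>1\<close> and the next
  projection \<open>f = e\<^sub>k\<^sub>+\<^sub>2\<close>, compressing \<open>S = S e\<close> gives \<open>f S f = E(S) f\<close>; multiplying by \<open>e\<close> on
  the right, \<open>\<lambda> f S = f S e f e = f E(S) e\<close>, and \<open>f\<close> can be cancelled.\<close>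

lemma push_down:
  assumes S: "S \<in> M (Suc k)" and Se: "S \<cdot> e (Suc k) = S"
  shows "l *\<^sub>R S = E k S \<cdot> e (Suc k)"
proof -
  define p q where "p = e (Suc k)" and "q = e (k + 2)"
  have ES: "E k S \<in> M k" using trace_expectation.E_in[OF expectation_Suc S] by simp
  have p: "p \<in> M (Suc k)" by (simp add: p_def e_in)
  have "q \<cdot> S \<cdot> q \<cdot> p = E k S \<cdot> q \<cdot> p"
    using e_sandwich[OF S] by (simp add: q_def)
  also have "\<dots> = q \<cdot> (E k S \<cdot> p)"
    using e_commute[OF ES, of "k + 2"] by (simp add: q_def op_assoc[symmetric])
  finally have 1: "q \<cdot> S \<cdot> q \<cdot> p = q \<cdot> (E k S \<cdot> p)" .
  have "q \<cdot> S \<cdot> q \<cdot> p = q \<cdot> (S \<cdot> (p \<cdot> q \<cdot> p))"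
    using Se by (metis op_assoc p_def)
  also have "\<dots> = q \<cdot> (l *\<^sub>R S)"
    using jones_down[of k] Se by (simp add: p_def q_def op_bilinear)
  finally have "q \<cdot> (l *\<^sub>R S - E k S \<cdot> p) = 0"
    using 1 by (simp add: op_bilinear)
  then have "l *\<^sub>R S - E k S \<cdot> p = 0"
    using e_cancel[of "l *\<^sub>R S - E k S \<cdot> p" "Suc k"] S p ES
    by (simp add: q_def lev.vn_closed M_in[OF ES])
  then show ?thesis by (simp add: p_def)
qed

text \<open>This replaces weak density of the span of \<open>M\<^sub>k e\<^sub>k\<^sub>+\<^sub>1 M\<^sub>k\<close> in \<open>M\<^sub>k\<^sub>+\<^sub>1\<close>.  If \<open>w\<close> is the
  expectation of \<open>W\<close> onto \<open>M\<^sub>k\<^sub>+\<^sub>1\<close>, the hypothesis says that \<open>S = w\<^sup>* a e\<^sub>k\<^sub>+\<^sub>1\<close> has expectation zero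
  on \<open>M\<^sub>k\<close> for each \<open>a\<close> in \<open>M\<^sub>k\<close>.  By \<open>push_down\<close> then \<open>S = 0\<close>, so \<open>w\<^sup>*\<close> vanishes on a dense set of
  vectors of the GNS space of \<open>M\<^sub>k\<close>.\<close>

lemma tr_zero_extend:
  assumes W: "W \<in> M j" and "k < j"
    and zero: "\<And>x y. x \<in> M k \<Longrightarrow> y \<in> M k \<Longrightarrow> tr j (x \<cdot> (e (Suc k) \<cdot> (y \<cdot> W))) = 0"
    and u: "u \<in> M (Suc k)"
  shows "tr j (u \<cdot> W) = 0"
proof -
  have le: "Suc k \<le> j" using \<open>k < j\<close> by simp
  interpret j: trace_expectation "M j" "tr j" "M (Suc k)" "E (Suc k)"
    by (rule expectation[OF le])
  interpret k: trace_expectation "M (Suc k)" "tr (Suc k)" "M k" "E k"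
    by (rule expectation_Suc)
  define w where "w = E (Suc k) W"
  have w: "w \<in> M (Suc k)" using j.E_in[OF W] by (simp add: w_def)
  have tr_w: "tr j (v \<cdot> W) = tr (Suc k) (v \<cdot> w)" if "v \<in> M (Suc k)" for v
  proof -
    have "v \<cdot> w \<in> M (Suc k)" using that w by (simp add: lev.vn_closed)
    then show ?thesis using j.tr_E_left[OF that W] tr_eq[OF _ le] by (simp add: w_def)
  qed
  have e: "e (Suc k) \<in> M (Suc k)" by (simp add: e_in)
  have "w\<^sup>\<dagger> = 0"
  proof (rule eq_0_if_annihilates_e)
    fix a assume a: "a \<in> M k"
    define S where "S = w\<^sup>\<dagger> \<cdot> a \<cdot> e (Suc k)"
    have a1: "a \<in> M (Suc k)" "a\<^sup>\<dagger> \<in> M k" "a\<^sup>\<dagger> \<in> M (Suc k)"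
      using a M_in[OF a, of "Suc k"] by (simp_all add: lev.vn_closed)
    have S: "S \<in> M (Suc k)" using w a1 e by (simp add: S_def lev.vn_closed)
    have S_adj: "S\<^sup>\<dagger> = e (Suc k) \<cdot> (a\<^sup>\<dagger> \<cdot> w)"
      using w a1 e
      by (simp add: S_def op_adj_times op_adj_adj lev.clinear[of _ "Suc k"] lev.vn_closed e_adj)
    have "E k (S\<^sup>\<dagger>) = 0"
    proof (rule k.E_eqI)
      fix n assume n: "n \<in> M k"
      have "n \<cdot> e (Suc k) \<cdot> a\<^sup>\<dagger> \<in> M (Suc k)"
        using n e a1 by (simp add: lev.vn_closed M_in[OF n])
      from tr_w[OF this] zero[OF n a1(2)]
      show "tr (Suc k) (n \<cdot> 0) = tr (Suc k) (n \<cdot> S\<^sup>\<dagger>)"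
        by (simp add: S_adj op_assoc lev.tr_zero)
    qed (use S in \<open>simp_all add: lev.vn_closed\<close>)
    then have "(E k S)\<^sup>\<dagger> = 0" using k.E_adj[OF S] by simp
    then have "((E k S)\<^sup>\<dagger>)\<^sup>\<dagger> = 0\<^sup>\<dagger>" by simp
    moreover have "0\<^sup>\<dagger> = (0 :: 'h op)" by (rule op_adj_eqI) simp
    ultimately have "E k S = 0"
      using k.E_in[OF S] by (simp add: op_adj_adj lev.clinear)
    moreover have "S \<cdot> e (Suc k) = S" by (simp add: S_def op_assoc e_idem)
    ultimately have "l *\<^sub>R S = 0" using push_down[OF S] by simp
    then show "w\<^sup>\<dagger> \<cdot> a \<cdot> e (Suc k) = 0" using lam_pos by (simp add: S_def)
  qed (simp add: w lev.vn_closed)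
  then have "w = 0"
    using lev.tr_faithful[OF w] by (simp add: lev.tr_zero)
  then show ?thesis using tr_w[OF u] by (simp add: lev.tr_zero)
qed

section \<open>Words in the Jones projections\<close>

lemma commute_far: "0 < k \<Longrightarrow> k + 2 \<le> i \<Longrightarrow> e i \<cdot> e k = e k \<cdot> e i"
  using e_commute[OF e_in[of k k]] by simp

lemma jones_relation:
  assumes "0 < i" "0 < j" "j = i + 1 \<or> i = j + 1"
  shows "e i \<cdot> (e j \<cdot> e i) = l *\<^sub>R e i"
  using assms jones_down[of "i - 1"] jones_up[of "j - 1"]
  by (cases i; cases j; auto simp: op_assoc)

lemma in_left: "u \<cdot> v = u' \<cdot> v' \<Longrightarrow> u \<cdot> (v \<cdot> w) = u' \<cdot> (v' \<cdot> w)"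
  by (metis op_assoc)

lemma idem_word: "0 < i \<Longrightarrow> e i \<cdot> (e i \<cdot> w) = e i \<cdot> w"
  by (metis e_idem op_assoc)

lemma jones_word:
  assumes "0 < i" "0 < j" "j = i + 1 \<or> i = j + 1"
  shows "e i \<cdot> (e j \<cdot> (e i \<cdot> w)) = l *\<^sub>R (e i \<cdot> w)"
  by (metis jones_relation[OF assms] op_assoc op_bilinear(5))

text \<open>Words are normalized by moving letters of larger index to the left, or to the right; which of
  the two brings letters together that contract depends on the word.\<close>

lemma letters_left:
  assumes "k + 2 \<le> i"
  shows "0 < k \<Longrightarrow> e k \<cdot> e i = e i \<cdot> e k" "0 < k \<Longrightarrow> e k \<cdot> (e i \<cdot> w) = e i \<cdot> (e k \<cdot> w)"
    and "x \<in> M k \<Longrightarrow> x \<cdot> e i = e i \<cdot> x" "x \<in> M k \<Longrightarrow> x \<cdot> (e i \<cdot> w) = e i \<cdot> (x \<cdot> w)"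
  using commute_far[of k i] e_commute[of x k i] assms in_left by metis+

lemma letters_right:
  assumes "k + 2 \<le> i"
  shows "0 < k \<Longrightarrow> e i \<cdot> e k = e k \<cdot> e i" "0 < k \<Longrightarrow> e i \<cdot> (e k \<cdot> w) = e k \<cdot> (e i \<cdot> w)"
    and "x \<in> M k \<Longrightarrow> e i \<cdot> x = x \<cdot> e i" "x \<in> M k \<Longrightarrow> e i \<cdot> (x \<cdot> w) = x \<cdot> (e i \<cdot> w)"
  using commute_far[of k i] e_commute[of x k i] assms in_left by metis+

text \<open>Contractions that are hidden by a letter commuting with both ends.\<close>

lemma jones_word_gap:
  assumes "0 < i" "0 < j" "j = i + 1 \<or> i = j + 1" "0 < k" "k + 2 \<le> i"
  shows "e i \<cdot> (e j \<cdot> (e k \<cdot> (e i \<cdot> w))) = l *\<^sub>R (e i \<cdot> (e k \<cdot> w))"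
    and "e i \<cdot> (e k \<cdot> (e j \<cdot> (e i \<cdot> w))) = l *\<^sub>R (e i \<cdot> (e k \<cdot> w))"
    and "e i \<cdot> (e j \<cdot> (e k \<cdot> e i)) = l *\<^sub>R (e i \<cdot> e k)"
    and "e i \<cdot> (e k \<cdot> (e j \<cdot> e i)) = l *\<^sub>R (e i \<cdot> e k)"
proof -
  have 1: "e i \<cdot> (e j \<cdot> (e k \<cdot> (e i \<cdot> w))) = l *\<^sub>R (e i \<cdot> (e k \<cdot> w))" for w
    unfolding letters_left(2)[OF assms(5,4)] by (rule jones_word[OF assms(1-3)])
  have 2: "e i \<cdot> (e k \<cdot> (e j \<cdot> (e i \<cdot> w))) = l *\<^sub>R (e i \<cdot> (e k \<cdot> w))" for w
    unfolding letters_right(2)[OF assms(5,4)]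
    by (simp add: jones_word[OF assms(1-3)] op_bilinear)
  show "e i \<cdot> (e j \<cdot> (e k \<cdot> (e i \<cdot> w))) = l *\<^sub>R (e i \<cdot> (e k \<cdot> w))"
    "e i \<cdot> (e k \<cdot> (e j \<cdot> (e i \<cdot> w))) = l *\<^sub>R (e i \<cdot> (e k \<cdot> w))"
    "e i \<cdot> (e j \<cdot> (e k \<cdot> e i)) = l *\<^sub>R (e i \<cdot> e k)"
    "e i \<cdot> (e k \<cdot> (e j \<cdot> e i)) = l *\<^sub>R (e i \<cdot> e k)"
    using 1[of w] 2[of w] 1[of "\<one>"] 2[of "\<one>"] by simp_all
qed

lemmas word_simps = op_assoc op_bilinear e_idem idem_word jones_relation jones_word jones_word_gap

text \<open>For variable indices the commutation rules are permutative and the simplifier would apply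
  them only in the direction of its term order; the instances below are oriented.\<close>

lemmas letters_left_inst =
  letters_left(1,2)[of 1 3, simplified]
  letters_left(1,2)[of 1 4, simplified]
  letters_left(1,2)[of 1 5, simplified]
  letters_left(1,2)[of 2 4, simplified]
  letters_left(1,2)[of 2 5, simplified]
  letters_left(1,2)[of 3 5, simplified]

lemmas letters_left_M0 =
  letters_left(3,4)[of 0 2, simplified]
  letters_left(3,4)[of 0 3, simplified]
  letters_left(3,4)[of 0 4, simplified]
  letters_left(3,4)[of 0 5, simplified]

lemmas letters_left_M1 =
  letters_left(3,4)[of 1 3, simplified]
  letters_left(3,4)[of 1 4, simplified]
  letters_left(3,4)[of 1 5, simplified]

lemmas letters_right_inst =
  letters_right(1,2)[of 1 3, simplified]
  letters_right(1,2)[of 1 4, simplified]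
  letters_right(1,2)[of 1 5, simplified]
  letters_right(1,2)[of 2 4, simplified]
  letters_right(1,2)[of 2 5, simplified]
  letters_right(1,2)[of 3 5, simplified]

lemmas letters_right_M0 =
  letters_right(3,4)[of 0 2, simplified]
  letters_right(3,4)[of 0 3, simplified]
  letters_right(3,4)[of 0 4, simplified]
  letters_right(3,4)[of 0 5, simplified]

lemmas letters_right_M1 =
  letters_right(3,4)[of 1 3, simplified]
  letters_right(3,4)[of 1 4, simplified]
  letters_right(3,4)[of 1 5, simplified]

text \<open>Up to the factor \<open>\<lambda>\<^sup>2\<close> this word is \<open>f e\<^sub>4 z f\<close> for the projection \<open>f = et1 T\<close>; it is what remains of the
  formula that defines a multiplier when the trace against \<open>z\<close> is taken.\<close>

abbreviation V where "V z \<equiv> e 2 \<cdot> (e 1 \<cdot> (z \<cdot> (e 3 \<cdot> (e 2 \<cdot> (e 1 \<cdot> (e 4 \<cdot> (e 3 \<cdot> e 2)))))))"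

lemma tr_M0: "x \<in> M 0 \<Longrightarrow> tr j x = tr 0 x"
  by (rule tr_eq) simp_all

text \<open>The projection \<open>et2 T\<close> commutes with \<open>z\<close>, so by the trace property one of its two occurrences
  is absorbed.  In the other one, \<open>e\<^sub>5\<close> is removed by the Markov property, and
  \<open>e\<^sub>4 e\<^sub>3 e\<^sub>4 = \<lambda> e\<^sub>4\<close> leaves a single letter \<open>e\<^sub>4\<close>.\<close>

lemma form_pairing:
  assumes X: "X \<in> M 1" and g: "g \<in> M 4" and gX: "g \<cdot> X = X \<cdot> g" and z: "z \<in> M 0"
  shows "tr 0 (z \<cdot> E 0 (et2 T \<cdot> et1 T \<cdot> X \<cdot> g \<cdot> et1 T \<cdot> et2 T)) =
    of_real (1 / l) * tr 4 (g \<cdot> (X \<cdot> V z))"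
proof -
  interpret E0: trace_expectation "M 5" "tr 5" "M 0" "E 0"
    by (rule expectation) simp
  define B where "B = e 2 \<cdot> (e 1 \<cdot> (e 3 \<cdot> e 2))"
  define F where "F = e 4 \<cdot> (e 3 \<cdot> (e 5 \<cdot> e 4))"
  define W where "W = B \<cdot> (X \<cdot> (g \<cdot> B))"
  note mem = lev.vn_closed e_in M_in[OF X] M_in[OF g] M_in[OF z]
  have W: "W \<in> M 4" "z \<cdot> W \<in> M 4" by (simp_all add: W_def B_def mem)
  note W5 = M_in[OF W(1)] M_in[OF W(2)]
  have F: "F \<in> M 5" by (simp add: F_def mem)
  have FF: "F \<cdot> (z \<cdot> F) = l *\<^sub>R (F \<cdot> z)"
    by (simp add: F_def word_simps letters_left_inst letters_left_M0[OF z])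
  have "et2 T \<cdot> et1 T \<cdot> X \<cdot> g \<cdot> et1 T \<cdot> et2 T = (1 / l ^ 4) *\<^sub>R (F \<cdot> (W \<cdot> F))"
    by (simp add: et1_def et2_def W_def B_def F_def op_assoc op_bilinear power4_eq_xxxx)
  then have "tr 0 (z \<cdot> E 0 (et2 T \<cdot> et1 T \<cdot> X \<cdot> g \<cdot> et1 T \<cdot> et2 T)) =
      tr 5 (z \<cdot> E 0 ((1 / l ^ 4) *\<^sub>R (F \<cdot> (W \<cdot> F))))"
    using E0.E_in[of "(1 / l ^ 4) *\<^sub>R (F \<cdot> (W \<cdot> F))"] F W5
    by (simp add: tr_M0[of _ 5] mem)
  also have "\<dots> = tr 5 (z \<cdot> ((1 / l ^ 4) *\<^sub>R (F \<cdot> (W \<cdot> F))))"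
    using F W5 by (intro E0.tr_E_left z) (simp add: mem)
  also have "\<dots> = of_real (1 / l ^ 4) * tr 5 (z \<cdot> (F \<cdot> W) \<cdot> F)"
    using F W5 by (simp add: op_bilinear lev.tr_scaleR mem op_assoc)
  also have "tr 5 (z \<cdot> (F \<cdot> W) \<cdot> F) = tr 5 (F \<cdot> (z \<cdot> F) \<cdot> W)"
    using F W5 lev.tr_comm[of "z \<cdot> (F \<cdot> W)" 5 F] by (simp add: op_assoc mem)
  also have "\<dots> = of_real l * tr 5 ((e 4 \<cdot> e 3) \<cdot> (e (Suc 4) \<cdot> (e 4 \<cdot> (z \<cdot> W))))"
    unfolding FF using F W5 by (simp add: op_bilinear lev.tr_scaleR mem op_assoc F_def)
  also have "\<dots> = of_real l * (of_real l * tr 5 ((e 4 \<cdot> e 3) \<cdot> (e 4 \<cdot> (z \<cdot> W))))"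
    by (subst tr_e) (simp_all add: mem W)
  also have "\<dots> = of_real (l ^ 3) * tr 5 (e 4 \<cdot> (z \<cdot> W))"
    using W5 by (simp add: word_simps lev.tr_scaleR mem power3_eq_cube)
  also have "tr 5 (e 4 \<cdot> (z \<cdot> W)) = tr 4 (e 4 \<cdot> (z \<cdot> W))"
    using W by (intro tr_eq) (simp_all add: mem)
  also have "\<dots> = tr 4 ((X \<cdot> g) \<cdot> (B \<cdot> (e 4 \<cdot> (z \<cdot> B))))"
    using lev.tr_comm[of "e 4 \<cdot> (z \<cdot> B)" 4 "X \<cdot> (g \<cdot> B)"] by (simp add: W_def B_def mem op_assoc)
  also have "B \<cdot> (e 4 \<cdot> (z \<cdot> B)) = V z"
    by (simp add: B_def word_simps letters_left_inst letters_left_M0[OF z])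
  also have "of_real (1 / l ^ 4) * (of_real (l ^ 3) * tr 4 ((X \<cdot> g) \<cdot> V z)) =
      of_real (1 / l) * tr 4 (g \<cdot> (X \<cdot> V z))"
    using lam_pos by (simp add: op_assoc gX[symmetric] in_left[OF gX] power_numeral_reduce field_simps)
  finally show ?thesis .
qed

section \<open>Uniqueness of multipliers\<close>

text \<open>The commutation of \<open>g\<close> with \<open>M\<^sub>1\<close> puts arbitrary elements of \<open>M\<^sub>1\<close> on both sides of \<open>V z\<close>.
  From there elements of larger and larger algebras are inserted: by \<open>tr_zero_extend\<close> an element of
  \<open>M\<^sub>k\<^sub>+\<^sub>1\<close> may be replaced by \<open>x e\<^sub>k\<^sub>+\<^sub>1 y\<close> with \<open>x\<close> and \<open>y\<close> in \<open>M\<^sub>k\<close>, and \<open>x\<close>, \<open>y\<close> are then moved through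
  the letters with which they commute, until one arrives at a word that has already been treated.
  At the end \<open>g\<close> is orthogonal to all of \<open>M\<^sub>4\<close>.\<close>

lemma multiplier_unique:
  assumes g: "g \<in> M 4" and comm: "\<And>X. X \<in> M 1 \<Longrightarrow> g \<cdot> X = X \<cdot> g"
    and zero: "\<And>x y z. x \<in> M 0 \<Longrightarrow> y \<in> M 0 \<Longrightarrow> z \<in> M 0 \<Longrightarrow>
      tr 4 (g \<cdot> ((x \<cdot> (e 1 \<cdot> y)) \<cdot> V z)) = 0"
  shows "g = 0"
proof -
  note mem = lev.vn_closed e_in g
  have extend: "tr 4 (u \<cdot> W) = 0"
    if "W \<in> M 4" "k < 4" "u \<in> M (Suc k)"
      "\<And>x y. x \<in> M k \<Longrightarrow> y \<in> M k \<Longrightarrow> tr 4 (x \<cdot> (e (Suc k) \<cdot> (y \<cdot> W))) = 0" for u W k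
    using that tr_zero_extend[of W 4 k u] by blast
  have V_in: "V z \<in> M 4" if "z \<in> M 0" for z
    using M_in[OF that, of 4] by (simp add: mem)
  \<comment> \<open>The elements \<open>x e\<^sub>1 y\<close> become an arbitrary \<open>X \<in> M\<^sub>1\<close>.\<close>
  have S1: "tr 4 (X \<cdot> (V z \<cdot> g)) = 0" if z: "z \<in> M 0" and X: "X \<in> M 1" for X z
  proof (rule extend[where k = 0])
    fix x y assume xy: "x \<in> M 0" "y \<in> M 0"
    have "tr 4 (g \<cdot> ((x \<cdot> (e 1 \<cdot> y)) \<cdot> V z)) = tr 4 (((x \<cdot> (e 1 \<cdot> y)) \<cdot> V z) \<cdot> g)"
      using M_in[OF xy(1), of 4] M_in[OF xy(2), of 4] V_in[OF z]
      by (intro lev.tr_comm) (simp_all add: mem)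
    then show "tr 4 (x \<cdot> (e (Suc 0) \<cdot> (y \<cdot> (V z \<cdot> g)))) = 0"
      using zero[OF xy z] by (simp add: op_assoc)
  qed (use V_in[OF z] X in \<open>simp_all add: mem\<close>)
  \<comment> \<open>As \<open>g\<close> commutes with \<open>Y\<close>, the latter moves cyclically to the front and merges with \<open>X\<close>.\<close>
  have S2: "tr 4 (X \<cdot> (V z \<cdot> (Y \<cdot> g))) = 0"
    if z: "z \<in> M 0" and X: "X \<in> M 1" and Y: "Y \<in> M 1" for X Y z
  proof -
    note XY = M_in[OF X, of 4] M_in[OF Y, of 4]
    have "tr 4 (X \<cdot> (V z \<cdot> (Y \<cdot> g))) = tr 4 ((X \<cdot> (V z \<cdot> g)) \<cdot> Y)"
      by (simp add: op_assoc comm[OF Y])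
    also have "\<dots> = tr 4 (Y \<cdot> (X \<cdot> (V z \<cdot> g)))"
      using XY V_in[OF z] by (intro lev.tr_comm) (simp_all add: mem)
    also have "\<dots> = tr 4 ((Y \<cdot> X) \<cdot> (V z \<cdot> g))" by (simp add: op_assoc)
    also have "\<dots> = 0" using X Y by (intro S1 z) (simp add: mem)
    finally show ?thesis .
  qed
  \<comment> \<open>The middle factor \<open>v \<in> M\<^sub>2\<close> is reduced to \<open>(a e\<^sub>1 b) e\<^sub>2 (c e\<^sub>1 d)\<close>; here \<open>a\<close> and \<open>d\<close> are absorbed into
     the outer factors and \<open>b c\<close> becomes the argument of \<open>V\<close>.\<close>
  have S3: "tr 4 (u \<cdot> (e 2 \<cdot> (e 3 \<cdot> (v \<cdot> (e 4 \<cdot> (e 3 \<cdot> (e 2 \<cdot> (y \<cdot> g)))))))) = 0"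
    if u: "u \<in> M 1" and y: "y \<in> M 1" and v: "v \<in> M 2" for u y v
  proof -
    define R where "R = e 4 \<cdot> (e 3 \<cdot> (e 2 \<cdot> (y \<cdot> g)))"
    define L where "L = u \<cdot> (e 2 \<cdot> e 3)"
    have RL: "R \<in> M 4" "L \<in> M 4"
      using M_in[OF u, of 4] M_in[OF y, of 4] by (simp_all add: R_def L_def mem)
    have base: "tr 4 (L \<cdot> ((a \<cdot> (e 1 \<cdot> b)) \<cdot> (e 2 \<cdot> ((c \<cdot> (e 1 \<cdot> d)) \<cdot> R)))) = 0"
      if abcd: "a \<in> M 0" "b \<in> M 0" "c \<in> M 0" "d \<in> M 0" for a b c d
    proof -
      have "L \<cdot> ((a \<cdot> (e 1 \<cdot> b)) \<cdot> (e 2 \<cdot> ((c \<cdot> (e 1 \<cdot> d)) \<cdot> R))) =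
          (u \<cdot> a) \<cdot> (V (b \<cdot> c) \<cdot> ((d \<cdot> y) \<cdot> g))"
        unfolding L_def R_def
        by (simp add: word_simps letters_left_inst abcd[THEN letters_left_M0(1)]
            abcd[THEN letters_left_M0(2)] abcd[THEN letters_left_M0(3)] abcd[THEN letters_left_M0(4)]
            abcd[THEN letters_left_M0(5)] abcd[THEN letters_left_M0(6)])
      then show ?thesis
        using S2[of "b \<cdot> c" "u \<cdot> a" "d \<cdot> y"] abcd u y M_in[OF abcd(1), of 1] M_in[OF abcd(4), of 1]
        by (simp add: mem)
    qed
    have step1: "tr 4 (L \<cdot> ((a \<cdot> (e 1 \<cdot> b)) \<cdot> (e 2 \<cdot> (q \<cdot> R)))) = 0"
      if ab: "a \<in> M 0" "b \<in> M 0" and q: "q \<in> M 1" for a b q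
    proof -
      define P where "P = L \<cdot> ((a \<cdot> (e 1 \<cdot> b)) \<cdot> e 2)"
      have P: "P \<in> M 4"
        using M_in[OF ab(1), of 4] M_in[OF ab(2), of 4] RL by (simp add: P_def mem)
      have "tr 4 (q \<cdot> (R \<cdot> P)) = 0"
      proof (rule extend[where k = 0])
        fix c d assume cd: "c \<in> M 0" "d \<in> M 0"
        have "tr 4 (P \<cdot> (c \<cdot> (e 1 \<cdot> (d \<cdot> R)))) = tr 4 ((c \<cdot> (e 1 \<cdot> (d \<cdot> R))) \<cdot> P)"
          using M_in[OF cd(1), of 4] M_in[OF cd(2), of 4] RL P
          by (intro lev.tr_comm) (simp_all add: mem)
        then show "tr 4 (c \<cdot> (e (Suc 0) \<cdot> (d \<cdot> (R \<cdot> P)))) = 0"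
          using base[OF ab cd] by (simp add: P_def op_assoc)
      qed (use P RL q in \<open>simp_all add: mem\<close>)
      moreover have "tr 4 (P \<cdot> (q \<cdot> R)) = tr 4 ((q \<cdot> R) \<cdot> P)"
        using P RL M_in[OF q, of 4] by (intro lev.tr_comm) (simp_all add: mem)
      ultimately show ?thesis by (simp add: P_def op_assoc)
    qed
    have step2: "tr 4 (L \<cdot> (p \<cdot> (e 2 \<cdot> (q \<cdot> R)))) = 0"
      if p: "p \<in> M 1" and q: "q \<in> M 1" for p q
    proof -
      define Q where "Q = e 2 \<cdot> (q \<cdot> R)"
      have Q: "Q \<in> M 4" using M_in[OF q, of 4] RL by (simp add: Q_def mem)
      have "tr 4 (p \<cdot> (Q \<cdot> L)) = 0"
      proof (rule extend[where k = 0])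
        fix a b assume ab: "a \<in> M 0" "b \<in> M 0"
        have "tr 4 (L \<cdot> (a \<cdot> (e 1 \<cdot> (b \<cdot> Q)))) = tr 4 ((a \<cdot> (e 1 \<cdot> (b \<cdot> Q))) \<cdot> L)"
          using M_in[OF ab(1), of 4] M_in[OF ab(2), of 4] RL Q
          by (intro lev.tr_comm) (simp_all add: mem)
        then show "tr 4 (a \<cdot> (e (Suc 0) \<cdot> (b \<cdot> (Q \<cdot> L)))) = 0"
          using step1[OF ab q] by (simp add: Q_def op_assoc)
      qed (use Q RL p in \<open>simp_all add: mem\<close>)
      moreover have "tr 4 (L \<cdot> (p \<cdot> Q)) = tr 4 ((p \<cdot> Q) \<cdot> L)"
        using Q RL M_in[OF p, of 4] by (intro lev.tr_comm) (simp_all add: mem)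
      ultimately show ?thesis by (simp add: Q_def op_assoc)
    qed
    have "tr 4 (v \<cdot> (R \<cdot> L)) = 0"
    proof (rule extend[where k = 1])
      fix p q assume pq: "p \<in> M 1" "q \<in> M 1"
      have "tr 4 (L \<cdot> (p \<cdot> (e 2 \<cdot> (q \<cdot> R)))) = tr 4 ((p \<cdot> (e 2 \<cdot> (q \<cdot> R))) \<cdot> L)"
        using M_in[OF pq(1), of 4] M_in[OF pq(2), of 4] RL
        by (intro lev.tr_comm) (simp_all add: mem)
      then show "tr 4 (p \<cdot> (e (Suc 1) \<cdot> (q \<cdot> (R \<cdot> L)))) = 0"
        using step2[OF pq] by (simp add: op_assoc numeral_2_eq_2[symmetric])
    qed (use RL v in \<open>simp_all add: mem numeral_2_eq_2\<close>)
    moreover have "tr 4 (L \<cdot> (v \<cdot> R)) = tr 4 ((v \<cdot> R) \<cdot> L)"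
      using RL M_in[OF v, of 4] by (intro lev.tr_comm) (simp_all add: mem)
    ultimately show ?thesis by (simp add: L_def R_def op_assoc)
  qed
  \<comment> \<open>The outer factors from \<open>M\<^sub>2\<close> are reduced to \<open>a e\<^sub>2 b\<close> and \<open>p e\<^sub>2 q\<close>; \<open>b\<close> and \<open>p\<close> commute with \<open>e\<^sub>3\<close> and \<open>e\<^sub>4\<close>
     and are absorbed into \<open>v\<close>.\<close>
  have S4: "tr 4 (u \<cdot> (e 3 \<cdot> (v \<cdot> (e 4 \<cdot> (e 3 \<cdot> (w \<cdot> g)))))) = 0"
    if u: "u \<in> M 2" and v: "v \<in> M 2" and w: "w \<in> M 2" for u v w
  proof -
    define L where "L = u \<cdot> (e 3 \<cdot> (v \<cdot> (e 4 \<cdot> e 3)))"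
    have L: "L \<in> M 4"
      using M_in[OF u, of 4] M_in[OF v, of 4] by (simp add: L_def mem)
    have "tr 4 (w \<cdot> (g \<cdot> L)) = 0"
    proof (rule extend[where k = 1])
      fix p q assume pq: "p \<in> M 1" "q \<in> M 1"
      note pq4 = M_in[OF pq(1), of 4] M_in[OF pq(2), of 4]
      define R where "R = e 3 \<cdot> ((v \<cdot> p) \<cdot> (e 4 \<cdot> (e 3 \<cdot> (e 2 \<cdot> (q \<cdot> g)))))"
      have R: "R \<in> M 4"
        using pq4 M_in[OF v, of 4] by (simp add: R_def mem)
      have "tr 4 (u \<cdot> R) = 0"
      proof (rule extend[where k = 1])
        fix a b assume ab: "a \<in> M 1" "b \<in> M 1"
        have "b \<cdot> v \<cdot> p \<in> M 2"
          using M_in[OF ab(2), of 2] M_in[OF pq(1), of 2] v by (simp add: mem)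
        from S3[OF ab(1) pq(2) this] show "tr 4 (a \<cdot> (e (Suc 1) \<cdot> (b \<cdot> R))) = 0"
          by (simp add: R_def op_assoc numeral_2_eq_2[symmetric] letters_left_M1 ab[simplified])
      qed (use R u in \<open>simp_all add: numeral_2_eq_2\<close>)
      moreover have "L \<cdot> (p \<cdot> (e 2 \<cdot> (q \<cdot> g))) = u \<cdot> R"
        by (simp add: L_def R_def op_assoc letters_left_M1 pq[simplified])
      moreover have "tr 4 (L \<cdot> (p \<cdot> (e 2 \<cdot> (q \<cdot> g)))) = tr 4 ((p \<cdot> (e 2 \<cdot> (q \<cdot> g))) \<cdot> L)"
        using pq4 L by (intro lev.tr_comm) (simp_all add: mem)
      ultimately show "tr 4 (p \<cdot> (e (Suc 1) \<cdot> (q \<cdot> (g \<cdot> L)))) = 0"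
        by (simp add: op_assoc numeral_2_eq_2[symmetric])
    qed (use L w in \<open>simp_all add: mem numeral_2_eq_2\<close>)
    moreover have "tr 4 (L \<cdot> (w \<cdot> g)) = tr 4 ((w \<cdot> g) \<cdot> L)"
      using L M_in[OF w, of 4] by (intro lev.tr_comm) (simp_all add: mem)
    ultimately show ?thesis by (simp add: L_def op_assoc)
  qed
  \<comment> \<open>\<open>U\<close> is reduced to \<open>a e\<^sub>3 b\<close>, then \<open>b W\<close> to \<open>p e\<^sub>3 q\<close>; both \<open>b\<close> and \<open>p\<close> commute with \<open>e\<^sub>4\<close>.\<close>
  have S5: "tr 4 (U \<cdot> (e 4 \<cdot> (W \<cdot> g))) = 0" if U: "U \<in> M 3" and W: "W \<in> M 3" for U W
  proof (rule extend[where k = 2])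
    fix a b assume ab: "a \<in> M 2" "b \<in> M 2"
    define L where "L = a \<cdot> (e 3 \<cdot> e 4)"
    have L: "L \<in> M 4" using M_in[OF ab(1), of 4] by (simp add: L_def mem)
    have bW: "b \<cdot> W \<in> M 3" using M_in[OF ab(2), of 3] W by (simp add: mem)
    have "tr 4 ((b \<cdot> W) \<cdot> (g \<cdot> L)) = 0"
    proof (rule extend[where k = 2])
      fix p q assume pq: "p \<in> M 2" "q \<in> M 2"
      have "L \<cdot> (p \<cdot> (e 3 \<cdot> (q \<cdot> g))) = a \<cdot> (e 3 \<cdot> (p \<cdot> (e 4 \<cdot> (e 3 \<cdot> (q \<cdot> g)))))"
        using in_left[OF e_commute[OF pq(1), of 4]] by (simp add: L_def op_assoc)
      moreover have "tr 4 (L \<cdot> (p \<cdot> (e 3 \<cdot> (q \<cdot> g)))) = tr 4 ((p \<cdot> (e 3 \<cdot> (q \<cdot> g))) \<cdot> L)"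
        using M_in[OF pq(1), of 4] M_in[OF pq(2), of 4] L by (intro lev.tr_comm) (simp_all add: mem)
      ultimately show "tr 4 (p \<cdot> (e (Suc 2) \<cdot> (q \<cdot> (g \<cdot> L)))) = 0"
        using S4[OF ab(1) pq] by (simp add: op_assoc)
    qed (use L bW in \<open>simp_all add: mem\<close>)
    moreover have "tr 4 (L \<cdot> ((b \<cdot> W) \<cdot> g)) = tr 4 (((b \<cdot> W) \<cdot> g) \<cdot> L)"
      using L M_in[OF bW, of 4] by (intro lev.tr_comm) (simp_all add: mem)
    moreover have "L \<cdot> ((b \<cdot> W) \<cdot> g) = a \<cdot> (e 3 \<cdot> (b \<cdot> (e 4 \<cdot> (W \<cdot> g))))"
      using in_left[OF e_commute[OF ab(2), of 4]] by (simp add: L_def op_assoc)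
    ultimately show "tr 4 (a \<cdot> (e (Suc 2) \<cdot> (b \<cdot> (e 4 \<cdot> (W \<cdot> g))))) = 0"
      by (simp add: op_assoc)
  qed (use M_in[OF W, of 4] U in \<open>simp_all add: mem\<close>)
  have "tr 4 (U \<cdot> g) = 0" if U: "U \<in> M 4" for U
    by (rule extend[where k = 3]) (use U S5 in \<open>simp_all add: mem\<close>)
  then show ?thesis using lev.tr_eq_0I[OF g] by blast
qed

section \<open>Multipliers of forms\<close>

lemma commutant_M1_iff:
  "g \<in> commutant (M 1) \<inter> M 4 \<longleftrightarrow> g \<in> M 4 \<and> (\<forall>X\<in>M 1. g \<cdot> X = X \<cdot> g)"
  by (auto simp: commutant_on_def bounded_ops_UNIV lev.clinear)

lemma in_M_words:
  assumes "x \<in> M 0" "y \<in> M 0"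
  shows "x \<cdot> (e 1 \<cdot> y) \<in> M 1"
  using M_in[OF assms(1), of 1] M_in[OF assms(2), of 1] by (simp add: lev.vn_closed e_in)

lemma et_in: "et1 T \<in> M 5" "et2 T \<in> M 5"
  by (simp_all add: et1_def et2_def lev.vn_closed e_in)

lemma E0_form_in:
  assumes "x \<in> M 0" "y \<in> M 0" "g \<in> M 4"
  shows "et2 T \<cdot> et1 T \<cdot> x\<^sup>\<dagger> \<cdot> e 1 \<cdot> y \<cdot> g \<cdot> et1 T \<cdot> et2 T \<in> M 5"
  using M_in[OF assms(1), of 5] M_in[OF assms(2), of 5] M_in[OF assms(3), of 5]
  by (simp add: lev.vn_closed e_in et_in)

lemma tr_form_value:
  assumes g: "g \<in> commutant (M 1) \<inter> M 4" and x: "x \<in> M 0" and y: "y \<in> M 0" and z: "z \<in> M 0"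
  shows "tr 0 (z \<cdot> (l powr (-11/2) *\<^sub>R
      E 0 (et2 T \<cdot> et1 T \<cdot> x\<^sup>\<dagger> \<cdot> e 1 \<cdot> y \<cdot> g \<cdot> et1 T \<cdot> et2 T))) =
    of_real (l powr (-13/2)) * tr 4 (g \<cdot> ((x\<^sup>\<dagger> \<cdot> (e 1 \<cdot> y)) \<cdot> V z))"
proof -
  let ?W = "et2 T \<cdot> et1 T \<cdot> x\<^sup>\<dagger> \<cdot> e 1 \<cdot> y \<cdot> g \<cdot> et1 T \<cdot> et2 T"
  have X: "x\<^sup>\<dagger> \<cdot> (e 1 \<cdot> y) \<in> M 1"
    using x y by (intro in_M_words) (simp_all add: lev.vn_closed)
  have EW: "E 0 ?W \<in> M 0"
    by (rule trace_expectation.E_in[OF expectation E0_form_in]) (use g x y in auto)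
  have "tr 0 (z \<cdot> (l powr (-11/2) *\<^sub>R E 0 ?W)) = of_real (l powr (-11/2)) * tr 0 (z \<cdot> E 0 ?W)"
    using EW z by (simp add: op_bilinear lev.tr_scaleR lev.vn_closed)
  also have "tr 0 (z \<cdot> E 0 ?W) = of_real (1 / l) * tr 4 (g \<cdot> ((x\<^sup>\<dagger> \<cdot> (e 1 \<cdot> y)) \<cdot> V z))"
  proof -
    have "g \<in> M 4" "g \<cdot> (x\<^sup>\<dagger> \<cdot> (e 1 \<cdot> y)) = (x\<^sup>\<dagger> \<cdot> (e 1 \<cdot> y)) \<cdot> g"
      using g X unfolding commutant_M1_iff by blast+
    from form_pairing[OF X this z] show ?thesis by (simp add: op_assoc)
  qed
  also have "of_real (l powr (-11/2)) * (of_real (1 / l) * tr 4 (g \<cdot> ((x\<^sup>\<dagger> \<cdot> (e 1 \<cdot> y)) \<cdot> V z))) =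
      of_real (l powr (-13/2)) * tr 4 (g \<cdot> ((x\<^sup>\<dagger> \<cdot> (e 1 \<cdot> y)) \<cdot> V z))"
  proof -
    have "l powr (-11/2) * (1 / l) = l powr (-13/2)"
      using lam_pos powr_add[of l "-11/2" "-1"] by (simp add: powr_minus field_simps)
    then show ?thesis by (simp only: mult.assoc[symmetric] of_real_mult[symmetric])
  qed
  finally show ?thesis .
qed

lemma representsI:
  assumes g: "g \<in> commutant (M 1) \<inter> M 4"
    and G: "\<And>x y. x \<in> M 0 \<Longrightarrow> y \<in> M 0 \<Longrightarrow> G x y \<in> M 0"
    and eq: "\<And>x y z. x \<in> M 0 \<Longrightarrow> y \<in> M 0 \<Longrightarrow> z \<in> M 0 \<Longrightarrow>
      of_real (l powr (-13/2)) * tr 4 (g \<cdot> ((x\<^sup>\<dagger> \<cdot> (e 1 \<cdot> y)) \<cdot> V z)) = tr 0 (z \<cdot> G x y)"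
  shows "represents T g G"
  unfolding represents_def
proof (intro conjI ballI)
  fix x y assume xy: "x \<in> M 0" "y \<in> M 0"
  define F where
    "F = l powr (-11/2) *\<^sub>R E 0 (et2 T \<cdot> et1 T \<cdot> x\<^sup>\<dagger> \<cdot> e 1 \<cdot> y \<cdot> g \<cdot> et1 T \<cdot> et2 T)"
  have "E 0 (et2 T \<cdot> et1 T \<cdot> x\<^sup>\<dagger> \<cdot> e 1 \<cdot> y \<cdot> g \<cdot> et1 T \<cdot> et2 T) \<in> M 0"
    by (rule trace_expectation.E_in[OF expectation E0_form_in]) (use g xy in auto)
  then have F: "F \<in> M 0" by (simp add: F_def lev.vn_closed)
  have "G x y - F = 0"
  proof (rule lev.tr_eq_0I[of _ 0])
    fix z assume z: "z \<in> M 0"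
    have "tr 0 (z \<cdot> G x y) = tr 0 (z \<cdot> F)"
      unfolding F_def tr_form_value[OF g xy z] using eq[OF xy z] by (rule sym)
    then show "tr 0 (z \<cdot> (G x y - F)) = 0"
      using F G[OF xy] z by (simp add: op_bilinear lev.tr_diff lev.vn_closed)
  qed (use F G[OF xy] in \<open>simp add: lev.vn_closed\<close>)
  then show "G x y = l powr (-11/2) *\<^sub>R
      E 0 (et2 T \<cdot> et1 T \<cdot> x\<^sup>\<dagger> \<cdot> e 1 \<cdot> y \<cdot> g \<cdot> et1 T \<cdot> et2 T)"
    by (simp add: F_def)
qed (use g in auto)

text \<open>Since \<open>x\<^sup>*\<close> ranges over all of \<open>M\<close> as \<open>x\<close> does, equal forms have multipliers with the same
  pairings against \<open>x e\<^sub>1 y\<close> and \<open>z\<close>.\<close>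

lemma represents_unique:
  assumes "represents T g G" "represents T h G"
  shows "g = h"
proof -
  have gh: "g \<in> commutant (M 1) \<inter> M 4" "h \<in> commutant (M 1) \<inter> M 4"
    using assms by (simp_all add: represents_def)
  have "g - h = 0"
  proof (rule multiplier_unique)
    show "g - h \<in> M 4" using gh by (simp add: lev.vn_closed)
    show "(g - h) \<cdot> X = X \<cdot> (g - h)" if "X \<in> M 1" for X
      using gh[unfolded commutant_M1_iff] that by (simp add: op_bilinear)
    fix x y z assume xyz: "x \<in> M 0" "y \<in> M 0" "z \<in> M 0"
    define U where "U = (x \<cdot> (e 1 \<cdot> y)) \<cdot> V z"
    have U: "U \<in> M 4"
      using xyz[THEN M_in[where j = 4]] by (simp add: U_def lev.vn_closed e_in)
    have x': "x\<^sup>\<dagger> \<in> M 0" using xyz by (simp add: lev.vn_closed)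
    have *: "tr 0 (z \<cdot> G (x\<^sup>\<dagger>) y) = of_real (l powr (-13/2)) * tr 4 (k \<cdot> U)"
      if k: "represents T k G" for k
      using tr_form_value[OF _ x' xyz(2,3), of k] k x' xyz
      by (simp add: represents_def U_def op_adj_adj lev.clinear[OF xyz(1)])
    have "l powr (-13/2) \<noteq> 0" using lam_pos by simp
    then have "tr 4 (g \<cdot> U) = tr 4 (h \<cdot> U)"
      using *[OF assms(1)] *[OF assms(2)] by simp
    then show "tr 4 ((g - h) \<cdot> ((x \<cdot> (e 1 \<cdot> y)) \<cdot> V z)) = 0"
      unfolding U_def[symmetric] using gh U by (simp add: op_bilinear lev.tr_diff lev.vn_closed)
  qed
  then show ?thesis by simp
qed

lemma form_multiplier_eqI:
  assumes "represents T g G"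
  shows "form_multiplier T G = g"
  unfolding form_multiplier_def
proof (rule the_equality)
  fix h
  assume "h \<in> commutant (M 1) \<inter> M 4 \<and> (\<forall>x\<in>M 0. \<forall>y\<in>M 0. G x y = l powr (-11/2) *\<^sub>R
    E 0 (et2 T \<cdot> et1 T \<cdot> x\<^sup>\<dagger> \<cdot> e 1 \<cdot> y \<cdot> h \<cdot> et1 T \<cdot> et2 T))"
  then have "represents T h G" by (simp add: represents_def)
  then show "h = g" using assms by (rule represents_unique)
qed (use assms in \<open>simp_all add: represents_def\<close>)

lemma represents_cong:
  assumes "represents T g G" "\<And>x y. x \<in> M 0 \<Longrightarrow> y \<in> M 0 \<Longrightarrow> H x y = G x y"
  shows "represents T g H"
  using assms by (simp add: represents_def)

lemma represents_add:
  assumes "represents T g G" "represents T h H"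
  shows "represents T (g + h) (\<lambda>x y. G x y + H x y)"
proof -
  interpret E0: trace_expectation "M 5" "tr 5" "M 0" "E 0"
    by (rule expectation) simp
  have "g \<in> M 4" "h \<in> M 4" using assms by (simp_all add: represents_def)
  note mem = E0_form_in[unfolded One_nat_def, OF _ _ this(1)] E0_form_in[unfolded One_nat_def, OF _ _ this(2)]
  show ?thesis
    using assms unfolding represents_def commutant_M1_iff
    by (simp add: op_bilinear lev.vn_closed E0.E_add mem scaleR_add_right)
qed

lemma represents_scaleR:
  assumes "represents T g G"
  shows "represents T (r *\<^sub>R g) (\<lambda>x y. r *\<^sub>R G x y)"
proof -
  interpret E0: trace_expectation "M 5" "tr 5" "M 0" "E 0"
    by (rule expectation) simp
  have "g \<in> M 4" using assms by (simp add: represents_def)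
  note mem = E0_form_in[unfolded One_nat_def, OF _ _ this]
  show ?thesis
    using assms unfolding represents_def commutant_M1_iff
    by (simp add: op_bilinear lev.vn_closed E0.E_scaleR mem mult.commute)
qed

lemma represents_diff:
  assumes "represents T g G" "represents T h H"
  shows "represents T (g - h) (\<lambda>x y. G x y - H x y)"
  using represents_add[OF assms(1) represents_scaleR[OF assms(2), of "-1"]] by simp

sublocale EN: trace_expectation "M 0" "tr 0" N "EN T"
  by unfold_locales (rule vn_N, rule N_subset, rule cond_EN)

lemma tr_EN_swap:
  assumes "z \<in> M 0" "w \<in> M 0"
  shows "tr 0 (EN T z \<cdot> w) = tr 0 (z \<cdot> EN T w)"
proof -
  note En = EN.E_in[OF assms(1)] EN.E_in[OF assms(2)]
  note En0 = EN.N_in[OF En(1)] EN.N_in[OF En(2)]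
  have "tr 0 (EN T z \<cdot> w) = tr 0 (EN T z \<cdot> EN T w)"
    using En(1) assms(2) by (rule EN.tr_E_left[symmetric])
  also have "\<dots> = tr 0 (EN T w \<cdot> EN T z)"
    using En0 by (rule lev.tr_comm)
  also have "\<dots> = tr 0 (EN T w \<cdot> z)"
    using En(2) assms(1) by (rule EN.tr_E_left)
  also have "\<dots> = tr 0 (z \<cdot> EN T w)"
    using En0(2) assms(1) by (rule lev.tr_comm)
  finally show ?thesis .
qed

lemma tr4_e4: "x \<in> M 3 \<Longrightarrow> w \<in> M 3 \<Longrightarrow> tr 4 (x \<cdot> (e 4 \<cdot> w)) = l * tr 4 (x \<cdot> w)"
  using tr_e[of x 3 w 4] by simp

lemma tr4_e3: "x \<in> M 2 \<Longrightarrow> w \<in> M 2 \<Longrightarrow> tr 4 (x \<cdot> (e 3 \<cdot> w)) = l * tr 4 (x \<cdot> w)"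
  using tr_e[of x 2 w 4] by (simp add: numeral_3_eq_3 numeral_2_eq_2)

lemma tr4_e2: "x \<in> M 1 \<Longrightarrow> w \<in> M 1 \<Longrightarrow> tr 4 (x \<cdot> (e 2 \<cdot> w)) = l * tr 4 (x \<cdot> w)"
  using tr_e[of x 1 w 4] by (simp add: numeral_2_eq_2)

lemma tr4_e1: "x \<in> M 0 \<Longrightarrow> w \<in> M 0 \<Longrightarrow> tr 4 (x \<cdot> (e 1 \<cdot> w)) = l * tr 4 (x \<cdot> w)"
  using tr_e[of x 0 w 4] by simp

text \<open>The pairing of \<open>V z\<close> with the words \<open>1\<close>, \<open>e\<^sub>3\<close>, \<open>e\<^sub>4\<close>, \<open>e\<^sub>3 e\<^sub>4\<close> and \<open>e\<^sub>4 e\<^sub>3\<close>.  The letters \<open>e\<^sub>4\<close>, \<open>e\<^sub>3\<close>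
  and \<open>e\<^sub>2\<close> are removed in this order: the Jones relations reduce each to a single occurrence, which
  the Markov property turns into a factor \<open>\<lambda>\<close>.\<close>

context
  fixes X z
  assumes X: "X \<in> M 1" and z: "z \<in> M 0"
begin

lemma EN_z: "EN T z \<in> M 0"
  using EN.E_in[OF z] EN.N_in by simp

lemmas word_mem = lev.vn_closed e_in M_in[OF X] M_in[OF z] M_in[OF EN_z]

lemma e1_z_e1: "e 1 \<cdot> (z \<cdot> (e 1 \<cdot> w)) = EN T z \<cdot> (e 1 \<cdot> w)" "e 1 \<cdot> (z \<cdot> e 1) = EN T z \<cdot> e 1"
  using e1_sandwich[OF z] by (simp_all add: op_assoc[symmetric])

lemmas normalize_left = word_simps letters_left_inst letters_left_M0[OF z] letters_left_M0[OF EN_z]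
  letters_right_M1[OF X[simplified]]
lemmas normalize_right = word_simps letters_right_inst letters_right_M0[OF z] letters_right_M0[OF EN_z]
  letters_right_M1[OF X[simplified]]

lemma pairing_one: "tr 4 (X \<cdot> V z) = l ^ 5 * tr 4 (X \<cdot> EN T z)"
proof -
  have "tr 4 (X \<cdot> V z) = tr 4 ((X \<cdot> (e 2 \<cdot> (e 1 \<cdot> (z \<cdot> (e 3 \<cdot> (e 2 \<cdot> e 1)))))) \<cdot> (e 4 \<cdot> (e 3 \<cdot> e 2)))"
    by (simp add: op_assoc)
  also have "\<dots> = l * tr 4 ((X \<cdot> (e 2 \<cdot> (e 1 \<cdot> (z \<cdot> (e 3 \<cdot> (e 2 \<cdot> e 1)))))) \<cdot> (e 3 \<cdot> e 2))"
    by (rule tr4_e4) (simp_all add: word_mem)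
  also have "(X \<cdot> (e 2 \<cdot> (e 1 \<cdot> (z \<cdot> (e 3 \<cdot> (e 2 \<cdot> e 1)))))) \<cdot> (e 3 \<cdot> e 2) =
      l *\<^sub>R ((X \<cdot> (e 2 \<cdot> (e 1 \<cdot> z))) \<cdot> (e 3 \<cdot> (e 1 \<cdot> e 2)))"
    by (simp add: normalize_left)
  also have "tr 4 \<dots> = l * tr 4 ((X \<cdot> (e 2 \<cdot> (e 1 \<cdot> z))) \<cdot> (e 3 \<cdot> (e 1 \<cdot> e 2)))"
    by (rule lev.tr_scaleR) (simp add: word_mem)
  also have "tr 4 ((X \<cdot> (e 2 \<cdot> (e 1 \<cdot> z))) \<cdot> (e 3 \<cdot> (e 1 \<cdot> e 2))) =
      l * tr 4 ((X \<cdot> (e 2 \<cdot> (e 1 \<cdot> z))) \<cdot> (e 1 \<cdot> e 2))"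
    by (rule tr4_e3) (simp_all add: word_mem)
  also have "(X \<cdot> (e 2 \<cdot> (e 1 \<cdot> z))) \<cdot> (e 1 \<cdot> e 2) = l *\<^sub>R ((X \<cdot> EN T z) \<cdot> (e 2 \<cdot> \<one>))"
    by (simp add: normalize_right e1_z_e1[simplified])
  also have "tr 4 \<dots> = l * tr 4 ((X \<cdot> EN T z) \<cdot> (e 2 \<cdot> \<one>))"
    by (rule lev.tr_scaleR) (simp add: word_mem)
  also have "tr 4 ((X \<cdot> EN T z) \<cdot> (e 2 \<cdot> \<one>)) = l * tr 4 ((X \<cdot> EN T z) \<cdot> \<one>)"
    by (rule tr4_e2) (simp_all add: word_mem)
  finally show ?thesis by (simp add: power_numeral_reduce)
qed

lemma pairing_e3: "tr 4 (e 3 \<cdot> (X \<cdot> V z)) = l ^ 5 * tr 4 (X \<cdot> (EN T z \<cdot> e 1))"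
proof -
  have "tr 4 (e 3 \<cdot> (X \<cdot> V z)) =
      tr 4 ((e 3 \<cdot> (X \<cdot> (e 2 \<cdot> (e 1 \<cdot> (z \<cdot> (e 3 \<cdot> (e 2 \<cdot> e 1))))))) \<cdot> (e 4 \<cdot> (e 3 \<cdot> e 2)))"
    by (simp add: op_assoc)
  also have "\<dots> = l * tr 4 ((e 3 \<cdot> (X \<cdot> (e 2 \<cdot> (e 1 \<cdot> (z \<cdot> (e 3 \<cdot> (e 2 \<cdot> e 1))))))) \<cdot> (e 3 \<cdot> e 2))"
    by (rule tr4_e4) (simp_all add: word_mem)
  also have "(e 3 \<cdot> (X \<cdot> (e 2 \<cdot> (e 1 \<cdot> (z \<cdot> (e 3 \<cdot> (e 2 \<cdot> e 1))))))) \<cdot> (e 3 \<cdot> e 2) =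
      l *\<^sub>R (X \<cdot> (e 3 \<cdot> (e 2 \<cdot> (e 3 \<cdot> (e 1 \<cdot> (z \<cdot> (e 1 \<cdot> e 2)))))))"
    by (simp add: normalize_left)
  also have "\<dots> = (l * l) *\<^sub>R (X \<cdot> (e 3 \<cdot> (EN T z \<cdot> (e 1 \<cdot> e 2))))"
    by (simp add: word_simps e1_z_e1[simplified])
  also have "tr 4 \<dots> = of_real (l * l) * tr 4 (X \<cdot> (e 3 \<cdot> (EN T z \<cdot> (e 1 \<cdot> e 2))))"
    by (rule lev.tr_scaleR) (simp add: word_mem)
  also have "tr 4 (X \<cdot> (e 3 \<cdot> (EN T z \<cdot> (e 1 \<cdot> e 2)))) = l * tr 4 (X \<cdot> (EN T z \<cdot> (e 1 \<cdot> e 2)))"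
    by (rule tr4_e3) (simp_all add: word_mem)
  also have "X \<cdot> (EN T z \<cdot> (e 1 \<cdot> e 2)) = (X \<cdot> (EN T z \<cdot> e 1)) \<cdot> (e 2 \<cdot> \<one>)" by (simp add: op_assoc)
  also have "tr 4 \<dots> = l * tr 4 ((X \<cdot> (EN T z \<cdot> e 1)) \<cdot> \<one>)"
    by (rule tr4_e2) (simp_all add: word_mem)
  finally show ?thesis by (simp add: power_numeral_reduce)
qed

lemma pairing_e4: "tr 4 (e 4 \<cdot> (X \<cdot> V z)) = l ^ 6 * tr 4 (X \<cdot> z)"
proof -
  have "e 4 \<cdot> (X \<cdot> V z) = l *\<^sub>R ((X \<cdot> (e 2 \<cdot> (e 1 \<cdot> z))) \<cdot> (e 4 \<cdot> (e 2 \<cdot> (e 1 \<cdot> (e 3 \<cdot> e 2)))))"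
    by (simp add: normalize_left)
  also have "tr 4 \<dots> = l * tr 4 ((X \<cdot> (e 2 \<cdot> (e 1 \<cdot> z))) \<cdot> (e 4 \<cdot> (e 2 \<cdot> (e 1 \<cdot> (e 3 \<cdot> e 2)))))"
    by (rule lev.tr_scaleR) (simp add: word_mem)
  also have "tr 4 ((X \<cdot> (e 2 \<cdot> (e 1 \<cdot> z))) \<cdot> (e 4 \<cdot> (e 2 \<cdot> (e 1 \<cdot> (e 3 \<cdot> e 2))))) =
      l * tr 4 ((X \<cdot> (e 2 \<cdot> (e 1 \<cdot> z))) \<cdot> (e 2 \<cdot> (e 1 \<cdot> (e 3 \<cdot> e 2))))"
    by (rule tr4_e4) (simp_all add: word_mem)
  also have "(X \<cdot> (e 2 \<cdot> (e 1 \<cdot> z))) \<cdot> (e 2 \<cdot> (e 1 \<cdot> (e 3 \<cdot> e 2))) =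
      (X \<cdot> (e 2 \<cdot> (e 1 \<cdot> (e 2 \<cdot> (z \<cdot> e 1))))) \<cdot> (e 3 \<cdot> e 2)"
    by (simp add: op_assoc letters_left_M0[OF z])
  also have "tr 4 \<dots> = l * tr 4 ((X \<cdot> (e 2 \<cdot> (e 1 \<cdot> (e 2 \<cdot> (z \<cdot> e 1))))) \<cdot> e 2)"
    by (rule tr4_e3) (simp_all add: word_mem)
  also have "(X \<cdot> (e 2 \<cdot> (e 1 \<cdot> (e 2 \<cdot> (z \<cdot> e 1))))) \<cdot> e 2 =
      l *\<^sub>R (X \<cdot> (e 2 \<cdot> (z \<cdot> (e 1 \<cdot> e 2))))"
    by (simp add: word_simps)
  also have "\<dots> = (l * l) *\<^sub>R ((X \<cdot> z) \<cdot> (e 2 \<cdot> \<one>))"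
    by (simp add: normalize_right)
  also have "tr 4 \<dots> = of_real (l * l) * tr 4 ((X \<cdot> z) \<cdot> (e 2 \<cdot> \<one>))"
    by (rule lev.tr_scaleR) (simp add: word_mem)
  also have "tr 4 ((X \<cdot> z) \<cdot> (e 2 \<cdot> \<one>)) = l * tr 4 ((X \<cdot> z) \<cdot> \<one>)"
    by (rule tr4_e2) (simp_all add: word_mem)
  finally show ?thesis by (simp add: power_numeral_reduce)
qed

lemma pairing_e3_e4: "tr 4 (e 3 \<cdot> (e 4 \<cdot> (X \<cdot> V z))) = l ^ 6 * tr 4 (X \<cdot> (z \<cdot> e 1))"
proof -
  have "e 3 \<cdot> (e 4 \<cdot> (X \<cdot> V z)) =
      l *\<^sub>R ((X \<cdot> (e 3 \<cdot> (e 2 \<cdot> (e 1 \<cdot> z)))) \<cdot> (e 4 \<cdot> (e 2 \<cdot> (e 1 \<cdot> (e 3 \<cdot> e 2)))))"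
    by (simp add: normalize_left)
  also have "tr 4 \<dots> =
      l * tr 4 ((X \<cdot> (e 3 \<cdot> (e 2 \<cdot> (e 1 \<cdot> z)))) \<cdot> (e 4 \<cdot> (e 2 \<cdot> (e 1 \<cdot> (e 3 \<cdot> e 2)))))"
    by (rule lev.tr_scaleR) (simp add: word_mem)
  also have "tr 4 ((X \<cdot> (e 3 \<cdot> (e 2 \<cdot> (e 1 \<cdot> z)))) \<cdot> (e 4 \<cdot> (e 2 \<cdot> (e 1 \<cdot> (e 3 \<cdot> e 2))))) =
      l * tr 4 ((X \<cdot> (e 3 \<cdot> (e 2 \<cdot> (e 1 \<cdot> z)))) \<cdot> (e 2 \<cdot> (e 1 \<cdot> (e 3 \<cdot> e 2))))"
    by (rule tr4_e4) (simp_all add: word_mem)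
  also have "(X \<cdot> (e 3 \<cdot> (e 2 \<cdot> (e 1 \<cdot> z)))) \<cdot> (e 2 \<cdot> (e 1 \<cdot> (e 3 \<cdot> e 2))) =
      (l * l) *\<^sub>R (X \<cdot> (e 3 \<cdot> (z \<cdot> (e 1 \<cdot> e 2))))"
    by (simp add: normalize_left)
  also have "tr 4 \<dots> = of_real (l * l) * tr 4 (X \<cdot> (e 3 \<cdot> (z \<cdot> (e 1 \<cdot> e 2))))"
    by (rule lev.tr_scaleR) (simp add: word_mem)
  also have "tr 4 (X \<cdot> (e 3 \<cdot> (z \<cdot> (e 1 \<cdot> e 2)))) = l * tr 4 (X \<cdot> (z \<cdot> (e 1 \<cdot> e 2)))"
    by (rule tr4_e3) (simp_all add: word_mem)
  also have "X \<cdot> (z \<cdot> (e 1 \<cdot> e 2)) = (X \<cdot> (z \<cdot> e 1)) \<cdot> (e 2 \<cdot> \<one>)" by (simp add: op_assoc)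
  also have "tr 4 \<dots> = l * tr 4 ((X \<cdot> (z \<cdot> e 1)) \<cdot> \<one>)"
    by (rule tr4_e2) (simp_all add: word_mem)
  finally show ?thesis by (simp add: power_numeral_reduce)
qed

lemma pairing_e4_e3: "tr 4 (e 4 \<cdot> (e 3 \<cdot> (X \<cdot> V z))) = l ^ 6 * tr 4 (X \<cdot> (e 1 \<cdot> z))"
proof -
  have "e 4 \<cdot> (e 3 \<cdot> (X \<cdot> V z)) =
      X \<cdot> (e 4 \<cdot> (e 3 \<cdot> (e 2 \<cdot> (e 3 \<cdot> (e 1 \<cdot> (z \<cdot> (e 2 \<cdot> (e 1 \<cdot> (e 4 \<cdot> (e 3 \<cdot> e 2))))))))))"
    by (simp add: op_assoc letters_right_M1[OF X[simplified]] letters_left(2)[of 1 3, simplified]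
        letters_left_M0[OF z])
  also have "\<dots> = (l * l) *\<^sub>R ((X \<cdot> (e 1 \<cdot> z)) \<cdot> (e 4 \<cdot> (e 2 \<cdot> (e 1 \<cdot> (e 3 \<cdot> e 2)))))"
    by (simp add: normalize_left)
  also have "tr 4 \<dots> = of_real (l * l) * tr 4 ((X \<cdot> (e 1 \<cdot> z)) \<cdot> (e 4 \<cdot> (e 2 \<cdot> (e 1 \<cdot> (e 3 \<cdot> e 2)))))"
    by (rule lev.tr_scaleR) (simp add: word_mem)
  also have "tr 4 ((X \<cdot> (e 1 \<cdot> z)) \<cdot> (e 4 \<cdot> (e 2 \<cdot> (e 1 \<cdot> (e 3 \<cdot> e 2))))) =
      l * tr 4 ((X \<cdot> (e 1 \<cdot> z)) \<cdot> (e 2 \<cdot> (e 1 \<cdot> (e 3 \<cdot> e 2))))"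
    by (rule tr4_e4) (simp_all add: word_mem)
  also have "(X \<cdot> (e 1 \<cdot> z)) \<cdot> (e 2 \<cdot> (e 1 \<cdot> (e 3 \<cdot> e 2))) =
      (X \<cdot> (e 1 \<cdot> (z \<cdot> (e 2 \<cdot> e 1)))) \<cdot> (e 3 \<cdot> e 2)"
    by (simp add: op_assoc)
  also have "tr 4 \<dots> = l * tr 4 ((X \<cdot> (e 1 \<cdot> (z \<cdot> (e 2 \<cdot> e 1)))) \<cdot> e 2)"
    by (rule tr4_e3) (simp_all add: word_mem)
  also have "(X \<cdot> (e 1 \<cdot> (z \<cdot> (e 2 \<cdot> e 1)))) \<cdot> e 2 = l *\<^sub>R ((X \<cdot> (e 1 \<cdot> z)) \<cdot> (e 2 \<cdot> \<one>))"
    by (simp add: word_simps)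
  also have "tr 4 \<dots> = l * tr 4 ((X \<cdot> (e 1 \<cdot> z)) \<cdot> (e 2 \<cdot> \<one>))"
    by (rule lev.tr_scaleR) (simp add: word_mem)
  also have "tr 4 ((X \<cdot> (e 1 \<cdot> z)) \<cdot> (e 2 \<cdot> \<one>)) = l * tr 4 ((X \<cdot> (e 1 \<cdot> z)) \<cdot> \<one>)"
    by (rule tr4_e2) (simp_all add: word_mem)
  finally show ?thesis by (simp add: power_numeral_reduce)
qed

end

lemma commutant_word_simps:
  "\<one> \<in> commutant (M 1) \<inter> M 4"
  "e 3 \<in> commutant (M 1) \<inter> M 4" "e 4 \<in> commutant (M 1) \<inter> M 4"
  "\<lbrakk>g \<in> commutant (M 1) \<inter> M 4; h \<in> commutant (M 1) \<inter> M 4\<rbrakk>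
    \<Longrightarrow> g \<cdot> h \<in> commutant (M 1) \<inter> M 4"
proof -
  show "\<one> \<in> commutant (M 1) \<inter> M 4" "e 3 \<in> commutant (M 1) \<inter> M 4" "e 4 \<in> commutant (M 1) \<inter> M 4"
    unfolding commutant_M1_iff using e_commute[of _ 1 3] e_commute[of _ 1 4]
    by (auto simp: lev.vn_closed e_in)
  assume "g \<in> commutant (M 1) \<inter> M 4" "h \<in> commutant (M 1) \<inter> M 4"
  then show "g \<cdot> h \<in> commutant (M 1) \<inter> M 4"
    unfolding commutant_M1_iff by (auto simp: lev.vn_closed) (metis op_assoc)
qed

text \<open>The exponent \<open>13/2\<close> collects \<open>11/2\<close> from the defining formula and \<open>1\<close> from \<open>form_pairing\<close>.\<close>

lemma represents_pairingI:
  assumes g: "g \<in> commutant (M 1) \<inter> M 4"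
    and G: "\<And>x y. x \<in> M 0 \<Longrightarrow> y \<in> M 0 \<Longrightarrow> G x y \<in> M 0"
    and eq: "\<And>x y z. x \<in> M 0 \<Longrightarrow> y \<in> M 0 \<Longrightarrow> z \<in> M 0 \<Longrightarrow>
      tr 4 (g \<cdot> ((x\<^sup>\<dagger> \<cdot> (e 1 \<cdot> y)) \<cdot> V z)) = of_real (l ^ n) * tr 0 (z \<cdot> G x y)"
  shows "represents T (l powr (13/2 - n) *\<^sub>R g) G"
proof -
  have "represents T g (\<lambda>x y. l powr (n - 13/2) *\<^sub>R G x y)"
  proof (rule representsI[OF g])
    fix x y z assume xyz: "x \<in> M 0" "y \<in> M 0" "z \<in> M 0"
    have "l powr (-13/2) * l ^ n = l powr (n - 13/2)"
      using lam_pos powr_add[of l "-13/2" n] by (simp add: powr_realpow algebra_simps)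
    then have "of_real (l powr (-13/2)) * (of_real (l ^ n) * tr 0 (z \<cdot> G x y)) =
        of_real (l powr (n - 13/2)) * tr 0 (z \<cdot> G x y)"
      by (simp only: mult.assoc[symmetric] of_real_mult[symmetric])
    also have "\<dots> = tr 0 (z \<cdot> l powr (n - 13/2) *\<^sub>R G x y)"
      using xyz G[OF xyz(1,2)] by (simp add: op_bilinear lev.tr_scaleR lev.vn_closed)
    finally show "of_real (l powr (-13/2)) * tr 4 (g \<cdot> ((x\<^sup>\<dagger> \<cdot> (e 1 \<cdot> y)) \<cdot> V z)) =
        tr 0 (z \<cdot> l powr (n - 13/2) *\<^sub>R G x y)"
      unfolding eq[OF xyz] .
  qed (use G in \<open>simp add: lev.vn_closed\<close>)
  from represents_scaleR[OF this, of "l powr (13/2 - n)"] show ?thesis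
    by (rule represents_cong) (use lam_pos in \<open>simp add: powr_add[symmetric]\<close>)
qed

lemma EN_in: "w \<in> M 0 \<Longrightarrow> EN T w \<in> M 0"
  using EN.E_in EN.N_in by blast

lemma compress: "w \<in> M 0 \<Longrightarrow> e 1 \<cdot> (w \<cdot> e 1) = EN T w \<cdot> e 1"
  "w \<in> M 0 \<Longrightarrow> e 1 \<cdot> (w \<cdot> (e 1 \<cdot> v)) = EN T w \<cdot> (e 1 \<cdot> v)"
  using e1_sandwich[of w] by (metis op_assoc)+

lemma tr4_M0: "u \<in> M 0 \<Longrightarrow> v \<in> M 0 \<Longrightarrow> tr 4 (u \<cdot> (e 1 \<cdot> v)) = of_real l * tr 0 (u \<cdot> v)"
  using tr4_e1[of u v] tr_M0[of "u \<cdot> v" 4] by (simp add: lev.vn_closed)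

lemma tr_rotate: "u \<in> M 0 \<Longrightarrow> v \<in> M 0 \<Longrightarrow> tr 0 (u \<cdot> v) = tr 0 (v \<cdot> u)"
  by (rule lev.tr_comm)

text \<open>With \<open>X = x\<^sup>* e\<^sub>1 y\<close> in these pairings, two letters \<open>e\<^sub>1\<close> compress the
  element of \<open>M\<close> between them to its expectation onto \<open>N\<close>, and the \<open>e\<^sub>1\<close> that remains contributes a
  last factor \<open>\<lambda>\<close>.\<close>

context
  fixes x y z
  assumes x: "x \<in> M 0" and y: "y \<in> M 0" and z: "z \<in> M 0"
begin

lemma xe1y_in: "x\<^sup>\<dagger> \<cdot> (e 1 \<cdot> y) \<in> M 1"
  using x y by (intro in_M_words) (simp_all add: lev.vn_closed)

lemmas M0_mem = lev.vn_closed x y z EN_in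

lemma value_one:
  "tr 4 (\<one> \<cdot> ((x\<^sup>\<dagger> \<cdot> (e 1 \<cdot> y)) \<cdot> V z)) = of_real (l ^ 6) * tr 0 (z \<cdot> EN T (x\<^sup>\<dagger> \<cdot> y))"
proof -
  have "tr 4 ((x\<^sup>\<dagger> \<cdot> (e 1 \<cdot> y)) \<cdot> EN T z) = tr 4 (x\<^sup>\<dagger> \<cdot> (e 1 \<cdot> (y \<cdot> EN T z)))"
    by (simp add: op_assoc)
  also have "\<dots> = of_real l * tr 0 ((x\<^sup>\<dagger> \<cdot> y) \<cdot> EN T z)"
    by (subst tr4_M0) (simp_all add: M0_mem op_assoc)
  also have "tr 0 ((x\<^sup>\<dagger> \<cdot> y) \<cdot> EN T z) = tr 0 (EN T z \<cdot> (x\<^sup>\<dagger> \<cdot> y))"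
    by (rule tr_rotate) (simp_all add: M0_mem)
  also have "\<dots> = tr 0 (z \<cdot> EN T (x\<^sup>\<dagger> \<cdot> y))"
    by (rule tr_EN_swap) (simp_all add: M0_mem)
  finally show ?thesis
    using pairing_one[OF xe1y_in z] by (simp add: power_numeral_reduce)
qed

lemma value_e3:
  "tr 4 (e 3 \<cdot> ((x\<^sup>\<dagger> \<cdot> (e 1 \<cdot> y)) \<cdot> V z)) = of_real (l ^ 6) * tr 0 (z \<cdot> (EN T (x\<^sup>\<dagger>) \<cdot> EN T y))"
proof -
  have "(x\<^sup>\<dagger> \<cdot> (e 1 \<cdot> y)) \<cdot> (EN T z \<cdot> e 1) = x\<^sup>\<dagger> \<cdot> (e 1 \<cdot> ((y \<cdot> EN T z) \<cdot> e 1))"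
    by (simp add: op_assoc)
  also have "\<dots> = (x\<^sup>\<dagger> \<cdot> (EN T y \<cdot> EN T z)) \<cdot> (e 1 \<cdot> \<one>)"
    using y z by (subst compress) (simp_all add: M0_mem EN.E_right EN.E_in op_assoc)
  also have "tr 4 \<dots> = of_real l * tr 0 ((x\<^sup>\<dagger> \<cdot> (EN T y \<cdot> EN T z)) \<cdot> \<one>)"
    by (rule tr4_M0) (simp_all add: M0_mem)
  also have "tr 0 ((x\<^sup>\<dagger> \<cdot> (EN T y \<cdot> EN T z)) \<cdot> \<one>) = tr 0 (EN T z \<cdot> (x\<^sup>\<dagger> \<cdot> EN T y))"
    using tr_rotate[of "x\<^sup>\<dagger> \<cdot> EN T y" "EN T z"] by (simp add: M0_mem op_assoc)
  also have "\<dots> = tr 0 (z \<cdot> EN T (x\<^sup>\<dagger> \<cdot> EN T y))"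
    by (rule tr_EN_swap) (simp_all add: M0_mem)
  also have "EN T (x\<^sup>\<dagger> \<cdot> EN T y) = EN T (x\<^sup>\<dagger>) \<cdot> EN T y"
    using y by (intro EN.E_right) (simp_all add: EN.E_in M0_mem)
  finally show ?thesis
    using pairing_e3[OF xe1y_in z] by (simp add: power_numeral_reduce)
qed

lemma value_e4:
  "tr 4 (e 4 \<cdot> ((x\<^sup>\<dagger> \<cdot> (e 1 \<cdot> y)) \<cdot> V z)) = of_real (l ^ 7) * tr 0 (z \<cdot> (x\<^sup>\<dagger> \<cdot> y))"
proof -
  have "tr 4 ((x\<^sup>\<dagger> \<cdot> (e 1 \<cdot> y)) \<cdot> z) = tr 4 (x\<^sup>\<dagger> \<cdot> (e 1 \<cdot> (y \<cdot> z)))"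
    by (simp add: op_assoc)
  also have "\<dots> = of_real l * tr 0 ((x\<^sup>\<dagger> \<cdot> y) \<cdot> z)"
    by (subst tr4_M0) (simp_all add: M0_mem op_assoc)
  also have "tr 0 ((x\<^sup>\<dagger> \<cdot> y) \<cdot> z) = tr 0 (z \<cdot> (x\<^sup>\<dagger> \<cdot> y))"
    by (rule tr_rotate) (simp_all add: M0_mem)
  finally show ?thesis
    using pairing_e4[OF xe1y_in z] by (simp add: power_numeral_reduce)
qed

lemma value_e3_e4:
  "tr 4 ((e 3 \<cdot> e 4) \<cdot> ((x\<^sup>\<dagger> \<cdot> (e 1 \<cdot> y)) \<cdot> V z)) = of_real (l ^ 7) * tr 0 (z \<cdot> (EN T (x\<^sup>\<dagger>) \<cdot> y))"
proof -
  have "(x\<^sup>\<dagger> \<cdot> (e 1 \<cdot> y)) \<cdot> (z \<cdot> e 1) = x\<^sup>\<dagger> \<cdot> (e 1 \<cdot> ((y \<cdot> z) \<cdot> e 1))"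
    by (simp add: op_assoc)
  also have "\<dots> = (x\<^sup>\<dagger> \<cdot> EN T (y \<cdot> z)) \<cdot> (e 1 \<cdot> \<one>)"
    by (subst compress) (simp_all add: M0_mem op_assoc)
  also have "tr 4 \<dots> = of_real l * tr 0 ((x\<^sup>\<dagger> \<cdot> EN T (y \<cdot> z)) \<cdot> \<one>)"
    by (rule tr4_M0) (simp_all add: M0_mem)
  also have "tr 0 ((x\<^sup>\<dagger> \<cdot> EN T (y \<cdot> z)) \<cdot> \<one>) = tr 0 (EN T (x\<^sup>\<dagger>) \<cdot> (y \<cdot> z))"
    using tr_EN_swap[of "x\<^sup>\<dagger>" "y \<cdot> z"] by (simp add: M0_mem)
  also have "\<dots> = tr 0 (z \<cdot> (EN T (x\<^sup>\<dagger>) \<cdot> y))"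
    using tr_rotate[of "EN T (x\<^sup>\<dagger>) \<cdot> y" z] by (simp add: M0_mem op_assoc)
  finally show ?thesis
    using pairing_e3_e4[OF xe1y_in z] by (simp add: power_numeral_reduce op_assoc)
qed

lemma value_e4_e3:
  "tr 4 ((e 4 \<cdot> e 3) \<cdot> ((x\<^sup>\<dagger> \<cdot> (e 1 \<cdot> y)) \<cdot> V z)) = of_real (l ^ 7) * tr 0 (z \<cdot> (x\<^sup>\<dagger> \<cdot> EN T y))"
proof -
  have "(x\<^sup>\<dagger> \<cdot> (e 1 \<cdot> y)) \<cdot> (e 1 \<cdot> z) = x\<^sup>\<dagger> \<cdot> (e 1 \<cdot> (y \<cdot> (e 1 \<cdot> z)))"
    by (simp add: op_assoc)
  also have "\<dots> = (x\<^sup>\<dagger> \<cdot> EN T y) \<cdot> (e 1 \<cdot> z)"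
    by (subst compress) (simp_all add: M0_mem op_assoc)
  also have "tr 4 \<dots> = of_real l * tr 0 ((x\<^sup>\<dagger> \<cdot> EN T y) \<cdot> z)"
    by (rule tr4_M0) (simp_all add: M0_mem)
  also have "tr 0 ((x\<^sup>\<dagger> \<cdot> EN T y) \<cdot> z) = tr 0 (z \<cdot> (x\<^sup>\<dagger> \<cdot> EN T y))"
    by (rule tr_rotate) (simp_all add: M0_mem)
  finally show ?thesis
    using pairing_e4_e3[OF xe1y_in z] by (simp add: power_numeral_reduce op_assoc)
qed

end

lemma represents_words:
  "represents T (l powr (1/2) *\<^sub>R \<one>) (\<lambda>x y. EN T (x\<^sup>\<dagger> \<cdot> y))"
  "represents T (l powr (1/2) *\<^sub>R e 3) (\<lambda>x y. EN T (x\<^sup>\<dagger>) \<cdot> EN T y)"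
  "represents T (l powr (-1/2) *\<^sub>R e 4) (\<lambda>x y. x\<^sup>\<dagger> \<cdot> y)"
  "represents T (l powr (-1/2) *\<^sub>R (e 3 \<cdot> e 4)) (\<lambda>x y. EN T (x\<^sup>\<dagger>) \<cdot> y)"
  "represents T (l powr (-1/2) *\<^sub>R (e 4 \<cdot> e 3)) (\<lambda>x y. x\<^sup>\<dagger> \<cdot> EN T y)"
proof -
  note mem = lev.vn_closed EN_in commutant_word_simps[unfolded One_nat_def]
  show "represents T (l powr (1/2) *\<^sub>R \<one>) (\<lambda>x y. EN T (x\<^sup>\<dagger> \<cdot> y))"
    using represents_pairingI[of \<one> "\<lambda>x y. EN T (x\<^sup>\<dagger> \<cdot> y)" 6, OF commutant_word_simps(1) _ value_one]
    by (simp add: mem)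
  show "represents T (l powr (1/2) *\<^sub>R e 3) (\<lambda>x y. EN T (x\<^sup>\<dagger>) \<cdot> EN T y)"
    using represents_pairingI[of "e 3" "\<lambda>x y. EN T (x\<^sup>\<dagger>) \<cdot> EN T y" 6,
        OF commutant_word_simps(2) _ value_e3]
    by (simp add: mem)
  show "represents T (l powr (-1/2) *\<^sub>R e 4) (\<lambda>x y. x\<^sup>\<dagger> \<cdot> y)"
    using represents_pairingI[of "e 4" "\<lambda>x y. x\<^sup>\<dagger> \<cdot> y" 7, OF commutant_word_simps(3) _ value_e4]
    by (simp add: mem)
  show "represents T (l powr (-1/2) *\<^sub>R (e 3 \<cdot> e 4)) (\<lambda>x y. EN T (x\<^sup>\<dagger>) \<cdot> y)"
    using represents_pairingI[of "e 3 \<cdot> e 4" "\<lambda>x y. EN T (x\<^sup>\<dagger>) \<cdot> y" 7,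
        OF commutant_word_simps(4)[OF commutant_word_simps(2,3)] _ value_e3_e4]
    by (simp add: mem)
  show "represents T (l powr (-1/2) *\<^sub>R (e 4 \<cdot> e 3)) (\<lambda>x y. x\<^sup>\<dagger> \<cdot> EN T y)"
    using represents_pairingI[of "e 4 \<cdot> e 3" "\<lambda>x y. x\<^sup>\<dagger> \<cdot> EN T y" 7,
        OF commutant_word_simps(4)[OF commutant_word_simps(3,2)] _ value_e4_e3]
    by (simp add: mem)
qed

section \<open>The generator and its gradient forms\<close>

text \<open>In the convolution \<open>1\<close> acts as a multiple of the expectation onto \<open>N\<close> and \<open>e\<^sub>2\<close> as a multiple of
  the identity.\<close>

lemma conv_one_minus_e2:
  assumes x: "x \<in> M 0"
  shows "conv T x (r *\<^sub>R (\<one> - e 2)) = r *\<^sub>R (l powr (-1/2) *\<^sub>R EN T x - l powr (1/2) *\<^sub>R x)"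
proof -
  interpret E0: trace_expectation "M 2" "tr 2" "M 0" "E 0"
    by (rule expectation) simp
  note mem = lev.vn_closed e_in EN_in x M_in[OF x] M_in[OF EN_in[OF x]]
  have E0_e2: "E 0 (w \<cdot> e 2) = l *\<^sub>R w" if w: "w \<in> M 0" for w
  proof (rule E0.E_eqI)
    fix n assume n: "n \<in> M 0"
    have "tr 2 ((n \<cdot> w) \<cdot> (e (Suc 1) \<cdot> \<one>)) = l * tr 2 ((n \<cdot> w) \<cdot> \<one>)"
      using M_in[OF n, of 1] M_in[OF w, of 1] by (intro tr_e) (simp_all add: lev.vn_closed)
    then show "tr 2 (n \<cdot> l *\<^sub>R w) = tr 2 (n \<cdot> (w \<cdot> e 2))"
      using M_in[OF n, of 2] M_in[OF w, of 2]
      by (simp add: op_assoc op_bilinear lev.tr_scaleR lev.vn_closed numeral_2_eq_2[symmetric])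
  qed (use w M_in[OF w, of 2] in \<open>simp_all add: lev.vn_closed e_in\<close>)
  have word: "e 2 \<cdot> e 1 \<cdot> (r *\<^sub>R (\<one> - e 2)) \<cdot> x \<cdot> e 1 \<cdot> e 2 =
      (r * l) *\<^sub>R ((EN T x - l *\<^sub>R x) \<cdot> e 2)"
  proof -
    have a: "e 2 \<cdot> (e 1 \<cdot> (x \<cdot> (e 1 \<cdot> e 2))) = l *\<^sub>R (EN T x \<cdot> e 2)"
      using compress(2)[OF x, of "e 2"] letters_right_M0[OF EN_in[OF x]]
      by (simp add: word_simps)
    have "e 2 \<cdot> (e 1 \<cdot> (e 2 \<cdot> (x \<cdot> (e 1 \<cdot> e 2)))) = l *\<^sub>R (e 2 \<cdot> (x \<cdot> (e 1 \<cdot> e 2)))"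
      by (simp add: word_simps)
    also have "\<dots> = (l * l) *\<^sub>R (x \<cdot> e 2)"
      by (simp add: word_simps letters_right_M0[OF x])
    finally have b: "e 2 \<cdot> (e 1 \<cdot> (e 2 \<cdot> (x \<cdot> (e 1 \<cdot> e 2)))) = (l * l) *\<^sub>R (x \<cdot> e 2)" .
    show ?thesis
      using a b by (simp add: op_assoc op_bilinear scaleR_diff_right mult.assoc)
  qed
  have "E 0 (e 2 \<cdot> e 1 \<cdot> (r *\<^sub>R (\<one> - e 2)) \<cdot> x \<cdot> e 1 \<cdot> e 2) =
      (r * l * l) *\<^sub>R (EN T x - l *\<^sub>R x)"
    unfolding word by (subst E0.E_scaleR) (simp_all add: E0_e2 mem)
  moreover have "l powr (-5/2) * (r * l * l) = r * l powr (-1/2)"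
    using lam_pos powr_add[of l "-5/2" 2] by (simp add: power2_eq_square mult_ac)
  ultimately have "conv T x (r *\<^sub>R (\<one> - e 2)) = (r * l powr (-1/2)) *\<^sub>R (EN T x - l *\<^sub>R x)"
    unfolding conv_def by (simp only: scaleR_scaleR)
  also have "\<dots> = r *\<^sub>R (l powr (-1/2) *\<^sub>R EN T x - (l powr (-1/2) * l) *\<^sub>R x)"
    by (simp add: scaleR_diff_right)
  also have "l powr (-1/2) * l = l powr (1/2)"
    using lam_pos powr_add[of l "-1/2" 1] by simp
  finally show ?thesis .
qed

end

locale jones_generator = jones T
  for T :: "'h::complex_hilbert tower" +
  fixes L :: "'h op \<Rightarrow> 'h op"
  assumes lam_less: "l < 1"
    and Lhat0: "Lhat0 T L = (1 / (l powr (-1/2) - l powr (1/2))) *\<^sub>R (\<one> - e 2)"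
    and Lw: "x \<in> M 0 \<Longrightarrow> Lw T L x = 0"
begin

definition c :: real where "c = 1 / (1 - l)"

lemma c_pos: "c > 0" and c_eq: "1 + c * l = c"
  using lam_less by (simp_all add: c_def field_simps)

lemma conv_Lhat0:
  assumes x: "x \<in> M 0"
  shows "conv T x (Lhat0 T L) = c *\<^sub>R (EN T x - l *\<^sub>R x)"
proof -
  have s: "l powr (1/2) = l powr (-1/2) * l" "l powr (-1/2) > 0"
    using lam_pos powr_add[of l "-1/2" 1] by simp_all
  then have "l powr (-1/2) - l powr (1/2) = l powr (-1/2) * (1 - l)"
    by (simp add: algebra_simps)
  then have "1 / (l powr (-1/2) - l powr (1/2)) * l powr (-1/2) = c"
    using s lam_less by (simp add: c_def)
  then show ?thesis
    unfolding Lhat0 conv_one_minus_e2[OF x] using s(1)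
    by (simp add: scaleR_diff_right mult.assoc[symmetric])
qed

lemma L_eq:
  assumes x: "x \<in> M 0"
  shows "L x = c *\<^sub>R (x - EN T x)"
proof -
  have "EN T \<one> = \<one>" using EN.E_id EN.N_simps by blast
  then have "conv T \<one> (Lhat0 T L) = c *\<^sub>R (\<one> - l *\<^sub>R \<one>)"
    using conv_Lhat0[of \<one>] by (simp add: lev.vn_closed)
  also have "\<dots> = (c * (1 - l)) *\<^sub>R \<one>"
    by (simp add: scaleR_diff_left right_diff_distrib scaleR_diff_right)
  also have "\<dots> = \<one>" using lam_less by (simp add: c_def)
  finally have one: "conv T \<one> (Lhat0 T L) = \<one>" .
  have "L x = La T L x" using Lw[OF x] by (simp add: Lw_def)
  also have "\<dots> = (1/2) *\<^sub>R x + (1/2) *\<^sub>R x - c *\<^sub>R (EN T x - l *\<^sub>R x)"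
    unfolding La_def one conv_Lhat0[OF x] by simp
  also have "\<dots> = (1 + c * l) *\<^sub>R x - c *\<^sub>R EN T x"
    by (simp add: algebra_simps scaleR_left_distrib[symmetric])
  finally show ?thesis by (simp add: c_eq scaleR_diff_right)
qed

lemma L_in: "x \<in> M 0 \<Longrightarrow> L x \<in> M 0"
  by (simp add: L_eq lev.vn_closed EN_in)

lemma EN_facts:
  "x \<in> M 0 \<Longrightarrow> EN T (EN T x) = EN T x"
  "x \<in> M 0 \<Longrightarrow> y \<in> M 0 \<Longrightarrow> EN T (x \<cdot> EN T y) = EN T x \<cdot> EN T y"
  "x \<in> M 0 \<Longrightarrow> y \<in> M 0 \<Longrightarrow> EN T (EN T x \<cdot> y) = EN T x \<cdot> EN T y"
  by (simp_all add: EN.E_id EN.E_in EN.E_right EN.E_left)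

lemmas EN_simps = EN_facts EN.E_add EN.E_diff EN.E_scaleR EN.E_adj[symmetric] EN_in lev.vn_closed

lemma adj_L: "x \<in> M 0 \<Longrightarrow> (L x)\<^sup>\<dagger> = L (x\<^sup>\<dagger>)"
  by (simp add: L_eq lev.vn_closed op_adj_scaleR op_adj_diff lev.clinear[of _ 0] EN_in EN.E_adj)

lemma Gam_eq:
  assumes "x \<in> M 0" "y \<in> M 0"
  shows "Gam L x y = (c / 2) *\<^sub>R (x\<^sup>\<dagger> \<cdot> y - x\<^sup>\<dagger> \<cdot> EN T y - EN T (x\<^sup>\<dagger>) \<cdot> y + EN T (x\<^sup>\<dagger> \<cdot> y))"
  unfolding Gam_def adj_L[OF assms(1)] using assms
  by (simp add: L_eq lev.vn_closed op_bilinear algebra_simps)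

text \<open>\<open>L\<close> acts on either argument of \<open>\<Gamma>\<close> as the scalar \<open>c\<close>, because \<open>\<Gamma>\<close> vanishes on \<open>N\<close>.\<close>

lemma Gam2_eq:
  assumes x: "x \<in> M 0" and y: "y \<in> M 0"
  shows "Gam2 L x y =
    (c / 2) *\<^sub>R (Gam L x y + c *\<^sub>R (EN T (x\<^sup>\<dagger> \<cdot> y) - EN T (x\<^sup>\<dagger>) \<cdot> EN T y))"
proof -
  have right: "Gam L x (L y) = c *\<^sub>R Gam L x y"
    using x y
    by (simp add: Gam_eq L_in, simp add: L_eq EN_simps op_bilinear algebra_simps)
  have left: "Gam L (L x) y = c *\<^sub>R Gam L x y"
    using x y
    by (simp add: Gam_eq L_in, simp add: adj_L, simp add: L_eq EN_simps op_bilinear algebra_simps)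
  have Gam_in: "Gam L x y \<in> M 0" using x y by (simp add: Gam_eq EN_simps)
  have EN_Gam: "EN T (Gam L x y) = c *\<^sub>R (EN T (x\<^sup>\<dagger> \<cdot> y) - EN T (x\<^sup>\<dagger>) \<cdot> EN T y)"
    using x y
    by (simp add: Gam_eq EN_simps scaleR_diff_right scaleR_add_right)
      (simp add: algebra_simps scaleR_left_distrib[symmetric])
  have "Gam2 L x y = (1/2) *\<^sub>R (c *\<^sub>R Gam L x y + c *\<^sub>R Gam L x y -
      c *\<^sub>R (Gam L x y - EN T (Gam L x y)))"
    unfolding Gam2_def right left L_eq[OF Gam_in] ..
  also have "\<dots> = (c / 2) *\<^sub>R (Gam L x y + EN T (Gam L x y))"
    by (simp add: algebra_simps)
  finally show ?thesis by (simp add: EN_Gam)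
qed

section \<open>The optimal lower bound\<close>

text \<open>The element \<open>(1 - e\<^sub>3) e\<^sub>4 (1 - e\<^sub>3)\<close>, expanded in the words that carry the elementary forms.\<close>

definition P where "P = e 4 - e 4 \<cdot> e 3 - e 3 \<cdot> e 4 + l *\<^sub>R e 3"
definition Q where "Q = \<one> - e 3"

abbreviation s where "s \<equiv> l powr (1/2)"
abbreviation t where "t \<equiv> l powr (-1/2)"

lemma s_eq: "s = t * l" and t_pos: "t > 0"
  using lam_pos powr_add[of l "-1/2" 1] by simp_all

lemma represents_Gam:
  "represents T ((c / 2 * t) *\<^sub>R (P + l *\<^sub>R Q)) (Gam L)"
proof -
  have "represents T ((c / 2) *\<^sub>R (t *\<^sub>R e 4 - t *\<^sub>R (e 4 \<cdot> e 3) - t *\<^sub>R (e 3 \<cdot> e 4) + s *\<^sub>R \<one>))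
      (\<lambda>x y. (c / 2) *\<^sub>R (x\<^sup>\<dagger> \<cdot> y - x\<^sup>\<dagger> \<cdot> EN T y - EN T (x\<^sup>\<dagger>) \<cdot> y + EN T (x\<^sup>\<dagger> \<cdot> y)))"
    by (intro represents_scaleR represents_add represents_diff represents_words)
  moreover have "(c / 2) *\<^sub>R (t *\<^sub>R e 4 - t *\<^sub>R (e 4 \<cdot> e 3) - t *\<^sub>R (e 3 \<cdot> e 4) + s *\<^sub>R \<one>) =
      (c / 2 * t) *\<^sub>R (P + l *\<^sub>R Q)"
    by (simp add: P_def Q_def s_eq algebra_simps)
  ultimately show ?thesis by (simp add: represents_cong Gam_eq)
qed

lemma represents_Gam2:
  "represents T ((c / 2) *\<^sub>R ((c / 2 * t) *\<^sub>R (P + l *\<^sub>R Q) + (c * s) *\<^sub>R Q)) (Gam2 L)"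
proof -
  have "represents T ((c / 2) *\<^sub>R ((c / 2 * t) *\<^sub>R (P + l *\<^sub>R Q) + c *\<^sub>R (s *\<^sub>R \<one> - s *\<^sub>R e 3)))
      (\<lambda>x y. (c / 2) *\<^sub>R (Gam L x y + c *\<^sub>R (EN T (x\<^sup>\<dagger> \<cdot> y) - EN T (x\<^sup>\<dagger>) \<cdot> EN T y)))"
    by (intro represents_scaleR represents_add represents_diff represents_words represents_Gam)
  moreover have "c *\<^sub>R (s *\<^sub>R \<one> - s *\<^sub>R e 3) = (c * s) *\<^sub>R Q"
    by (simp add: Q_def scaleR_diff_right)
  ultimately show ?thesis by (simp add: represents_cong Gam2_eq)
qed

definition \<beta> :: real where "\<beta> = (1/2 + l) * c"

abbreviation Gamma_hat where "Gamma_hat \<equiv> (c / 2 * t) *\<^sub>R (P + l *\<^sub>R Q)"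
abbreviation Gamma2_hat where "Gamma2_hat \<equiv> (c / 2) *\<^sub>R (Gamma_hat + (c * s) *\<^sub>R Q)"

lemma adj_P: "P\<^sup>\<dagger> = P" and adj_Q: "Q\<^sup>\<dagger> = Q"
  and PP: "P \<cdot> P = (1 - l) *\<^sub>R P" and QQ: "Q \<cdot> Q = Q" and QP: "Q \<cdot> P = P" and PQ: "P \<cdot> Q = P"
proof -
  note mem = lev.vn_closed e_in lev.clinear[of _ 4]
  show "P\<^sup>\<dagger> = P"
    by (simp add: P_def op_adj_add op_adj_diff op_adj_scaleR op_adj_times mem e_adj)
  show "Q\<^sup>\<dagger> = Q"
    by (simp add: Q_def op_adj_diff mem e_adj op_adj_id)
  show "P \<cdot> P = (1 - l) *\<^sub>R P"
    by (simp add: P_def op_bilinear word_simps algebra_simps)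
  show "Q \<cdot> Q = Q" "Q \<cdot> P = P" "P \<cdot> Q = P"
    by (simp_all add: P_def Q_def op_bilinear word_simps algebra_simps)
qed

lemma P_nonzero: "P \<noteq> 0"
proof
  assume P: "P = 0"
  have "tr 4 (e 3) = l" "tr 4 (e 4) = l" "tr 4 (e 3 \<cdot> e 4) = l * l"
    using tr4_e3[of \<one> \<one>] tr4_e4[of \<one> \<one>] tr4_e4[of "e 3" \<one>]
    by (simp_all add: lev.vn_closed lev.tr_one e_in)
  moreover have "tr 4 (e 4 \<cdot> e 3) = tr 4 (e 3 \<cdot> e 4)"
    by (rule lev.tr_comm) (simp_all add: e_in)
  ultimately have "tr 4 P = of_real (l - l * l)"
    by (simp add: P_def lev.tr_add lev.tr_diff lev.tr_scaleR lev.vn_closed e_in)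
  then have "l - l * l = 0" using P by (simp add: lev.tr_zero del: of_real_diff of_real_mult)
  then show False using lam_pos lam_less by (simp add: algebra_simps)
qed

text \<open>\<open>\<beta>\<close> is the coefficient for which the difference vanishes on the range of \<open>P\<close>; it is then a
  multiple of the projection \<open>Q - c P\<close>.\<close>

lemma hat_difference:
  "Gamma2_hat - \<beta> *\<^sub>R Gamma_hat = (c / 2 * s) *\<^sub>R (Q - c *\<^sub>R P)"
proof -
  have b: "\<beta> = c / 2 + l * c" by (simp add: \<beta>_def algebra_simps)
  have *: "(c / 2) *\<^sub>R (A + (c * s) *\<^sub>R Q) - \<beta> *\<^sub>R A =
      (c / 2 * s * c) *\<^sub>R Q - (l * c) *\<^sub>R A" for A
    by (simp add: b scaleR_right_distrib scaleR_left_distrib mult_ac)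
  have "Gamma2_hat - \<beta> *\<^sub>R Gamma_hat =
      (c / 2 * s * c) *\<^sub>R Q - (l * c * (c / 2 * t)) *\<^sub>R (P + l *\<^sub>R Q)"
    unfolding * by (simp only: scaleR_scaleR)
  also have "l * c * (c / 2 * t) = c / 2 * s * c"
    by (simp add: s_eq)
  also have "(c / 2 * s * c) *\<^sub>R Q - (c / 2 * s * c) *\<^sub>R (P + l *\<^sub>R Q) =
      (c / 2 * s) *\<^sub>R ((c - c * l) *\<^sub>R Q - c *\<^sub>R P)"
    by (simp add: scaleR_diff_right scaleR_diff_left scaleR_add_right right_diff_distrib mult.assoc)
  also have "c - c * l = 1" using c_eq by simp
  finally show ?thesis by simp
qed

lemma op_pos_projection:
  fixes R :: "'h op"
  assumes "clinear_op R" "R\<^sup>\<dagger> = R" "R \<cdot> R = R" "r \<ge> 0"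
  shows "op_pos (r *\<^sub>R R)"
  unfolding op_pos_def
proof
  fix \<xi>
  have "cinner \<xi> (R \<xi>) = cinner (R \<xi>) (R \<xi>)"
    using assms op_adj[OF assms(1), of \<xi> "R \<xi>"] by (metis blinfun_apply_blinfun_compose)
  then show "cinner \<xi> ((r *\<^sub>R R) \<xi>) \<in> \<real>\<^sub>\<ge>\<^sub>0"
    using \<open>r \<ge> 0\<close>
    by (simp add: scaleR_blinfun.rep_eq cinner_scaleR_right cinner_self complex_nonneg_Reals_iff)
qed

lemma hat_lower_bound: "\<beta> *\<^sub>R Gamma_hat \<preceq> Gamma2_hat"
  unfolding op_le_def hat_difference
proof (rule op_pos_projection)
  have "P \<in> M 4" "Q \<in> M 4" by (simp_all add: P_def Q_def lev.vn_closed e_in)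
  then have cl: "clinear_op P" "clinear_op Q" "clinear_op (c *\<^sub>R P)" "clinear_op (Q - c *\<^sub>R P)"
    by (rule_tac lev.clinear[of _ 4], simp add: lev.vn_closed)+
  then show "clinear_op (Q - c *\<^sub>R P)" "(Q - c *\<^sub>R P)\<^sup>\<dagger> = Q - c *\<^sub>R P"
    by (simp_all add: op_adj_diff op_adj_scaleR adj_P adj_Q)
  have "c * (1 - l) = 1" using lam_less by (simp add: c_def)
  then show "(Q - c *\<^sub>R P) \<cdot> (Q - c *\<^sub>R P) = Q - c *\<^sub>R P"
    by (simp add: op_bilinear PP QQ QP PQ mult.assoc)
  show "c / 2 * s \<ge> 0" using c_pos by simp
qed

text \<open>On the range of \<open>P\<close> both multipliers are scalars, with ratio exactly \<open>\<beta>\<close>.\<close>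

lemma hat_optimal:
  assumes "b *\<^sub>R Gamma_hat \<preceq> Gamma2_hat"
  shows "b \<le> \<beta>"
proof -
  obtain \<eta> where \<eta>: "P \<eta> \<noteq> 0"
    using P_nonzero by (metis blinfun_eqI zero_blinfun.rep_eq)
  define \<xi> where "\<xi> = P \<eta>"
  have P\<xi>: "P \<xi> = (1 - l) *\<^sub>R \<xi>"
    using PP by (metis \<xi>_def blinfun_apply_blinfun_compose scaleR_blinfun.rep_eq)
  have Q\<xi>: "Q \<xi> = \<xi>"
    using QP by (metis \<xi>_def blinfun_apply_blinfun_compose)
  have G: "Gamma_hat \<xi> = (c / 2 * t) *\<^sub>R \<xi>"
    by (simp add: scaleR_blinfun.rep_eq plus_blinfun.rep_eq P\<xi> Q\<xi> scaleR_left_distrib[symmetric])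
  have "c * (1 - l) = 1" using lam_less by (simp add: c_def)
  then have "(Q - c *\<^sub>R P) \<xi> = 0"
    by (simp add: minus_blinfun.rep_eq scaleR_blinfun.rep_eq P\<xi> Q\<xi>)
  then have zero: "(Gamma2_hat - \<beta> *\<^sub>R Gamma_hat) \<xi> = 0"
    unfolding hat_difference by (simp add: scaleR_blinfun.rep_eq)
  have split: "(B - b *\<^sub>R A) \<xi> = (B - \<beta> *\<^sub>R A) \<xi> + (\<beta> - b) *\<^sub>R A \<xi>" for A B :: "'h op"
    by (simp add: minus_blinfun.rep_eq scaleR_blinfun.rep_eq scaleR_left_diff_distrib)
  have "(Gamma2_hat - b *\<^sub>R Gamma_hat) \<xi> = (\<beta> - b) *\<^sub>R Gamma_hat \<xi>"
    unfolding split[of Gamma2_hat Gamma_hat] zero by (rule add_0)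
  also have "\<dots> = ((\<beta> - b) * (c / 2 * t)) *\<^sub>R \<xi>"
    unfolding G by (rule scaleR_scaleR)
  finally have "(Gamma2_hat - b *\<^sub>R Gamma_hat) \<xi> = ((\<beta> - b) * (c / 2 * t)) *\<^sub>R \<xi>" .
  moreover have "cinner \<xi> ((Gamma2_hat - b *\<^sub>R Gamma_hat) \<xi>) \<in> \<real>\<^sub>\<ge>\<^sub>0"
    using assms by (simp add: op_le_def op_pos_def)
  ultimately have "of_real ((\<beta> - b) * (c / 2 * t) * (norm \<xi>)\<^sup>2) \<in> (\<real>\<^sub>\<ge>\<^sub>0 :: complex set)"
    by (simp add: cinner_scaleR_right cinner_self)
  then have "(\<beta> - b) * (c / 2 * t) * (norm \<xi>)\<^sup>2 \<ge> 0"
    by (simp only: nonneg_Reals_of_real_iff)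
  moreover have "(c / 2 * t) * (norm \<xi>)\<^sup>2 > 0"
    using \<eta> c_pos t_pos by (simp add: \<xi>_def)
  ultimately show ?thesis
    by (simp add: mult.assoc zero_le_mult_iff)
qed

end

theorem proposition3p9:
  fixes T :: "'h::complex_hilbert tower"
    and \<Phi> :: "real \<Rightarrow> 'h op \<Rightarrow> 'h op" and L :: "'h op \<Rightarrow> 'h op"
  assumes "jones_tower T"
    and "lam T < 1"
    and "bimodule_qms (subalg T) (alg T 0) \<Phi> L"
    and "Lhat0 T L = (1 / (lam T powr (-1/2) - lam T powr (1/2))) *\<^sub>R (\<one> - jp T 2)"
    and "\<forall>x\<in>alg T 0. Lw T L x = 0"
  shows "(\<forall>x\<in>alg T 0. L x = (1 / (1 - lam T)) *\<^sub>R (x - EN T x)) \<and>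
    ((1/2 + lam T) * (1 / (1 - lam T))) *\<^sub>R form_multiplier T (Gam L)
      \<preceq> form_multiplier T (Gam2 L) \<and>
    (\<forall>\<beta>::real. \<beta> *\<^sub>R form_multiplier T (Gam L) \<preceq> form_multiplier T (Gam2 L) \<longrightarrow>
      \<beta> \<le> (1/2 + lam T) * (1 / (1 - lam T)))"
proof -
  interpret jones_generator T L
    using assms by unfold_locales auto
  have \<beta>: "(1/2 + lam T) * (1 / (1 - lam T)) = \<beta>"
    by (simp add: \<beta>_def c_def)
  show ?thesis
    unfolding \<beta> form_multiplier_eqI[OF represents_Gam] form_multiplier_eqI[OF represents_Gam2]
    using L_eq hat_lower_bound hat_optimal by (auto simp: c_def)
qed

end
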